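(* Let $P$ be a probability measure on $\Omega$ satisfying the following three conditions: (C1) the $\{\omega^x\}_{x\in\mathbb{Z}}$ are i.i.d. under $P$; (C2) for $P$-a.e. environment $\omega$, the Markov chain induced by $P_\omega^0$ is irreducible; (C3) there exist $L$ and $R$ such that for $P$-a.e. environment $\omega$, $\omega(a,b)=0$ whenever $b$ is outside $[a-L,a+R]$. Then there is a $\mathbb{P}^0$-almost sure limiting velocity $v=\lim_{n\to\infty}\frac{X_n}{n}$. Moreover, $\lim_{x\to\infty}\frac{H_{\geq x}}{x}=\frac1v$, where $\frac1v$ is understood to be $\infty$ if $v=0$.
   Context: An environment on $\mathbb{Z}$ is a function $\omega:\mathbb{Z}\times\mathbb{Z}\to[0,1]$ with $\sum_{y\in\mathbb{Z}}\omega(x,y)=1$ for every $x\in\mathbb{Z}$. For $x\in\mathbb{Z}$, $\omega^x$ is the probability measure on $\mathbb{Z}$ given by $\omega^x(y)=\omega(x,x+y)$; $\omega$ is identified with $(\omega^x)_{x\in\mathbb{Z}}$. Let $\mathcal{M}_1(\mathbb{Z})$ be the set of probability measures on $\mathbb{Z}$ with the topology of weak convergence, and let $\Omega=\prod_{x\in\mathbb{Z}}\mathcal{M}_1(\mathbb{Z})$, the set of all environments, with the Borel sigma-field of the product topology. Interval notation such as $[a-L,a+R]$ denotes sets of consecutive integers (except that $[0,1]$ denotes the real unit interval). For an environment $\omega$ and $x\in\mathbb{Z}$, the quenched measure $P_\omega^x$ is the law on $\mathbb{Z}^{\mathbb{N}}$ (with $0\in\mathbb{N}$) of the Markov chain $\mathbf{X}=(X_n)_{n\ge0}$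 on $\mathbb{Z}$ started at $X_0=x$ with transition probabilities given by $\omega$, i.e. from site $X_n$ the chain moves to $y$ with probability $\omega(X_n,y)$. Given a probability measure $P$ on $\Omega$, the annealed measure $\mathbb{P}^x$ on $\Omega\times\mathbb{Z}^{\mathbb{N}}$ is defined by $\mathbb{P}^x(A\times B)=\int_A P_\omega^x(B)\,P(d\omega)$ for measurable $A\subset\Omega$, $B\subset\mathbb{Z}^{\mathbb{N}}$; for an event $B\subset\mathbb{Z}^{\mathbb{N}}$ one writes $\mathbb{P}^x(B)$ for $\mathbb{P}^x(\Omega\times B)$. For $x\in\mathbb{Z}$, $H_{\ge x}$ is the hitting time of the half-infinite interval $[x,\infty)$, that is, $H_{\ge x}=\inf\{n\in\mathbb{N}: X_n\ge x\}$.
   Formalization: For v < 0 the limit of H_{≥x}/x is stated to be ∞ instead of 1/v: the literal value 1/v is negative and false there (e.g. steps −1 and +1 with probabilities 2/3 and 1/3, where H_{≥x} = ∞ for all large x almost surely); for v ≥ 0 the claim is unchanged. *)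

theory Defs
  imports "HOL-Probability.Probability"
begin

definition borel_of :: "'a topology \<Rightarrow> 'a measure" where
  "borel_of T = sigma (topspace T) {U. openin T U}"

(* Probability measures on the discrete space of integers are represented by the type
   "int pmf". The weak topology is the coarsest one for which the integrals of all bounded
   continuous functions are continuous. *)
definition M1_topology :: "int pmf topology" where
  "M1_topology = topology_generated_by
     {{\<mu>. measure_pmf.expectation \<mu> f \<in> U} | f U.
        continuous_on UNIV f \<and> bounded (range f) \<and> open (U :: real set)}"

definition M1_space :: "int pmf measure" where
  "M1_space = borel_of M1_topology"

(* An environment is stored as the family of its jump laws: "\<omega> a" is the law of the jump made
   from site a, so the probability to move from a to b is the mass "\<omega> a" gives to b - a. *)
type_synonym env = "int \<Rightarrow> int pmf"

definition transition :: "env \<Rightarrow> int \<Rightarrow> int \<Rightarrow> real" where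
  "transition \<omega> a b = pmf (\<omega> a) (b - a)"

definition env_space :: "env measure" where
  "env_space = borel_of (product_topology (\<lambda>_. M1_topology) UNIV)"

type_synonym path = "nat \<Rightarrow> int"

definition path_space :: "path measure" where
  "path_space = (\<Pi>\<^sub>M n\<in>UNIV. count_space UNIV)"

(* The law of X n given the values h 0, ..., h (n - 1) of the chain started at x. *)
definition step_kernel :: "env \<Rightarrow> int \<Rightarrow> nat \<Rightarrow> path \<Rightarrow> int measure" where
  "step_kernel \<omega> x n h =
     (case n of 0 \<Rightarrow> return (count_space UNIV) x
      | Suc m \<Rightarrow> measure_pmf (map_pmf (\<lambda>j. h m + j) (\<omega> (h m))))"

(* The measure on path space constructed from the kernels by the Ionescu-Tulcea theorem;
   see emeasure_quenched_cylinder for its finite-dimensional distributions. *)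
definition quenched :: "env \<Rightarrow> int \<Rightarrow> path measure" where
  "quenched \<omega> x =
     projective_family.lim UNIV
       (Ionescu_Tulcea.CI (step_kernel \<omega> x) (\<lambda>_. count_space UNIV)) (\<lambda>_. count_space UNIV)"

definition annealed :: "env measure \<Rightarrow> int \<Rightarrow> (env \<times> path) measure" where
  "annealed P x =
     P \<bind> (\<lambda>\<omega>. distr (quenched \<omega> x) (env_space \<Otimes>\<^sub>M path_space) (\<lambda>X. (\<omega>, X)))"

definition irreducible_env :: "env \<Rightarrow> bool" where
  "irreducible_env \<omega> \<longleftrightarrow>
     (\<forall>a b. \<exists>n. measure (quenched \<omega> a) {X \<in> space path_space. X n = b} > 0)"

(* Infinite if the path never reaches [x, \<infinity>). *)
definition hitting_time_ge :: "path \<Rightarrow> int \<Rightarrow> enat" where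
  "hitting_time_ge X x = (INF n\<in>{n. X n \<ge> x}. enat n)"

subsection \<open>The quenched and annealed measures are well defined\<close>

lemma space_borel_of: "space (borel_of T) = topspace T"
  and sets_borel_of: "sets (borel_of T) = sigma_sets (topspace T) {U. openin T U}"
  by (auto simp: borel_of_def dest: openin_subset intro!: space_measure_of sets_measure_of)

lemma topspace_M1 [simp]: "topspace M1_topology = UNIV"
proof -
  have "UNIV \<in> {{\<mu>. measure_pmf.expectation \<mu> f \<in> U} | f U.
        continuous_on (UNIV :: int set) f \<and> bounded (range f) \<and> open (U :: real set)}"
    by (rule CollectI, rule exI[of _ "\<lambda>_. 0"], rule exI[of _ UNIV]) auto
  from Union_upper[OF this] show ?thesis
    unfolding M1_topology_def topology_generated_by_topspace by (rule top_le)
qed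

lemma space_M1_space [simp]: "space M1_space = UNIV"
  by (simp add: M1_space_def space_borel_of)

lemma space_env_space [simp]: "space env_space = UNIV"
  by (simp add: env_space_def space_borel_of)

lemma space_path_space [simp]: "space path_space = UNIV"
  by (simp add: path_space_def space_PiM)

lemma measurable_borel_of_continuous:
  assumes "continuous_map S T f"
  shows "f \<in> measurable (borel_of S) (borel_of T)"
  unfolding borel_of_def[of T]
proof (rule measurable_measure_of)
  show "{U. openin T U} \<subseteq> Pow (topspace T)"
    by (auto dest: openin_subset)
  show "f \<in> space (borel_of S) \<rightarrow> topspace T"
    using assms by (auto simp: space_borel_of continuous_map_def)
  fix U assume "U \<in> {U. openin T U}"
  then have "openin S {x \<in> topspace S. f x \<in> U}"
    using assms by (auto simp: continuous_map_def)
  moreover have "f -` U \<inter> space (borel_of S) = {x \<in> topspace S. f x \<in> U}"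
    by (auto simp: space_borel_of)
  ultimately show "f -` U \<inter> space (borel_of S) \<in> sets (borel_of S)"
    by (simp add: sets_borel_of sigma_sets.Basic)
qed

lemma measurable_env_component [measurable]: "(\<lambda>\<omega>. \<omega> a) \<in> env_space \<rightarrow>\<^sub>M M1_space"
  unfolding env_space_def M1_space_def
  by (rule measurable_borel_of_continuous)
     (rule continuous_map_product_projection, simp)

lemma measurable_M1_pmf [measurable]: "(\<lambda>\<mu>. pmf \<mu> j) \<in> borel_measurable M1_space"
proof (rule borel_measurableI)
  fix U :: "real set" assume "open U"
  have "(\<lambda>\<mu>. pmf \<mu> j) -` U \<inter> space M1_space =
      {\<mu>. measure_pmf.expectation \<mu> (indicator {j}) \<in> U}"
    by (auto simp: measure_pmf_single)
  moreover have "openin M1_topology {\<mu>. measure_pmf.expectation \<mu> (indicator {j}) \<in> U}"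
    unfolding M1_topology_def
  proof (rule topology_generated_by_Basis)
    have "bounded (range (indicator {j} :: int \<Rightarrow> real))"
      by (rule boundedI[of _ 1]) (auto simp: indicator_def)
    with \<open>open U\<close> show "{\<mu>. measure_pmf.expectation \<mu> (indicator {j}) \<in> U} \<in>
        {{\<mu>. measure_pmf.expectation \<mu> f \<in> U} | f U.
          continuous_on (UNIV :: int set) f \<and> bounded (range f) \<and> open (U :: real set)}"
      by (intro CollectI exI[of _ "indicator {j}"] exI[of _ U]) auto
  qed
  ultimately show "(\<lambda>\<mu>. pmf \<mu> j) -` U \<inter> space M1_space \<in> sets M1_space"
    by (simp add: M1_space_def sets_borel_of sigma_sets.Basic)
qed

lemma measurable_transition [measurable]: "(\<lambda>\<omega>. transition \<omega> a b) \<in> borel_measurable env_space"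
  unfolding transition_def by measurable

lemma prob_space_step_kernel: "prob_space (step_kernel \<omega> x n h)"
  by (auto simp: step_kernel_def split: nat.split intro!: prob_space_return measure_pmf.prob_space_axioms)

lemma sets_step_kernel: "sets (step_kernel \<omega> x n h) = UNIV"
  by (auto simp: step_kernel_def split: nat.split)

lemma Ionescu_Tulcea_step_kernel:
  "Ionescu_Tulcea (step_kernel \<omega> x) (\<lambda>_. count_space UNIV)"
proof (rule Ionescu_Tulcea.intro)
  fix n :: nat
  let ?H = "PiM {0..<n} (\<lambda>_. count_space (UNIV :: int set))"
  let ?S = "subprob_algebra (count_space (UNIV :: int set))"
  show "step_kernel \<omega> x n \<in> ?H \<rightarrow>\<^sub>M ?S"
  proof (cases n)
    case 0
    then show ?thesis
      using measurable_const[of "return (count_space UNIV) x" ?S ?H]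
      by (simp add: step_kernel_def[abs_def] space_subprob_algebra prob_space_return
          prob_space_imp_subprob_space)
  next
    case (Suc m)
    have "(\<lambda>h. h m) \<in> ?H \<rightarrow>\<^sub>M count_space UNIV"
      by (rule measurable_component_singleton) (simp add: Suc)
    moreover have "(\<lambda>a. measure_pmf (map_pmf (\<lambda>j. a + j) (\<omega> a))) \<in> count_space UNIV \<rightarrow>\<^sub>M ?S"
      by (simp add: space_subprob_algebra measure_pmf.subprob_space_axioms)
    ultimately have "(\<lambda>h. measure_pmf (map_pmf (\<lambda>j. h m + j) (\<omega> (h m)))) \<in> ?H \<rightarrow>\<^sub>M ?S"
      by (rule measurable_compose)
    then show ?thesis
      by (simp add: Suc step_kernel_def[abs_def])
  qed
qed (rule prob_space_step_kernel)

lemma sets_quenched [simp, measurable_cong]: "sets (quenched \<omega> x) = sets path_space"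
proof -
  interpret Ionescu_Tulcea "step_kernel \<omega> x" "\<lambda>_. count_space UNIV"
    by (rule Ionescu_Tulcea_step_kernel)
  show ?thesis
    by (simp add: quenched_def path_space_def)
qed

lemma space_quenched [simp]: "space (quenched \<omega> x) = UNIV"
  using sets_eq_imp_space_eq[OF sets_quenched] by simp

lemma emeasure_quenched_cylinder:
  "emeasure (quenched \<omega> x) {X. \<forall>i\<le>n. X i = xs i} =
     (if xs 0 = x then \<Prod>i<n. ennreal (transition \<omega> (xs i) (xs (Suc i))) else 0)"
proof -
  let ?M = "\<lambda>_. count_space UNIV :: int measure"
  interpret Ionescu_Tulcea "step_kernel \<omega> x" ?M
    by (rule Ionescu_Tulcea_step_kernel)
  define S where "S m = {restrict xs {0..<m}}" for m :: nat
  have S_PiE: "S m = PiE {0..<m} (\<lambda>i. {xs i})" for m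
  proof -
    have "PiE {0..<m} (\<lambda>i. {xs i}) = PiE {0..<m} (\<lambda>i. {restrict xs {0..<m} i})"
      by (rule PiE_cong) simp
    then show ?thesis
      using PiE_singleton[of "restrict xs {0..<m}" "{0..<m}"] by (simp only: S_def restrict_extensional)
  qed
  have S_sets[measurable]: "S m \<in> sets (PiM {0..<m} ?M)" for m
    unfolding S_PiE by (rule sets_PiM_I_finite) auto
  have eP_S: "emeasure (eP m h) (S (Suc m)) =
      emeasure (step_kernel \<omega> x m (restrict xs {0..<m})) {xs m} * indicator (S m) h"
    if h: "h \<in> space (PiM {0..<m} ?M)" for m h
  proof -
    have h': "h j = undefined" if "j \<ge> m" for j
      using h that by (auto simp: space_PiM PiE_def extensional_def)
    have r: "restrict xs {0..<Suc m} = (restrict xs {0..<m})(m := xs m)"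
      by (auto simp: fun_eq_iff restrict_def)
    have "h(m := y) = restrict xs {0..<Suc m} \<longleftrightarrow> y = xs m \<and> h = restrict xs {0..<m}" for y
    proof
      assume eq: "h(m := y) = restrict xs {0..<Suc m}"
      have "h j = restrict xs {0..<m} j" for j
        using fun_cong[OF eq, of j] h' by (cases "j = m") (auto simp: r)
      then show "y = xs m \<and> h = restrict xs {0..<m}"
        using fun_cong[OF eq, of m] by (auto simp: r)
    qed (simp add: r)
    then have "h(m := y) \<in> S (Suc m) \<longleftrightarrow> y = xs m \<and> h \<in> S m" for y
      by (simp only: S_def singleton_iff)
    then have "(\<lambda>y. h(m := y)) -` S (Suc m) = (if h \<in> S m then {xs m} else {})"
      by auto
    moreover have "step_kernel \<omega> x m h = step_kernel \<omega> x m (restrict xs {0..<m})" if "h \<in> S m"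
      using that by (simp only: S_def singleton_iff)
    ultimately show ?thesis
      by (subst emeasure_eP[OF h S_sets]) simp
  qed
  have u: "(\<lambda>_. undefined) \<in> space (PiM {0..<0::nat} ?M)"
    by (simp add: space_PiM)
  have C_S: "emeasure (C 0 m (\<lambda>_. undefined)) (S m) =
      (\<Prod>i<m. emeasure (step_kernel \<omega> x i (restrict xs {0..<i})) {xs i})" for m
  proof (induction m)
    case 0
    show ?case
      using S_sets[of 0] by (simp add: S_def restrict_def)
  next
    case (Suc m)
    have "emeasure (C 0 (Suc m) (\<lambda>_. undefined)) (S (Suc m)) =
        (\<integral>\<^sup>+h. emeasure (eP m h) (S (Suc m)) \<partial>C 0 m (\<lambda>_. undefined))"
    proof -
      have "eP m \<in> C 0 m (\<lambda>_. undefined) \<rightarrow>\<^sub>M subprob_algebra (PiM {0..<Suc m} ?M)"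
        using measurable_eP[of m] by (simp add: measurable_cong_sets[OF sets_C[OF u] refl])
      moreover have "space (C 0 m (\<lambda>_. undefined)) \<noteq> {}"
        using prob_space.not_empty[OF prob_space_C[OF u]] .
      ultimately show ?thesis
        using emeasure_bind[of "C 0 m (\<lambda>_. undefined)" "eP m" "PiM {0..<Suc m} ?M" "S (Suc m)"]
          S_sets[of "Suc m"] by simp
    qed
    also have "\<dots> = (\<integral>\<^sup>+h. emeasure (step_kernel \<omega> x m (restrict xs {0..<m})) {xs m} *
        indicator (S m) h \<partial>C 0 m (\<lambda>_. undefined))"
      by (intro nn_integral_cong eP_S) (simp add: space_C[OF u])
    also have "\<dots> = emeasure (step_kernel \<omega> x m (restrict xs {0..<m})) {xs m} *
        emeasure (C 0 m (\<lambda>_. undefined)) (S m)"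
      using S_sets[of m] by (intro nn_integral_cmult_indicator) (simp add: sets_C[OF u])
    finally show ?case
      by (simp only: Suc.IH prod.lessThan_Suc mult.commute)
  qed
  have "{X. \<forall>i\<le>n. X i = xs i} = PF.emb UNIV {0..<Suc n} (S (Suc n))"
    by (auto simp: S_PiE prod_emb_def space_PiM PiE_iff less_Suc_eq_le)
  then have "emeasure (quenched \<omega> x) {X. \<forall>i\<le>n. X i = xs i} = emeasure (CI {0..<Suc n}) (S (Suc n))"
    unfolding quenched_def using lim[of "{0..<Suc n}" "S (Suc n)"] by simp
  also have "\<dots> = emeasure (C 0 (Suc n) (\<lambda>_. undefined)) (PF.emb {0..<Suc n} {0..<Suc n} (S (Suc n)))"
    by (rule emeasure_CI) auto
  also have "PF.emb {0..<Suc n} {0..<Suc n} (S (Suc n)) = S (Suc n)"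
    by (rule prod_emb_id) (auto simp: S_PiE PiE_iff)
  also note C_S
  also have "(\<Prod>i<Suc n. emeasure (step_kernel \<omega> x i (restrict xs {0..<i})) {xs i}) =
      emeasure (step_kernel \<omega> x 0 (restrict xs {0..<0})) {xs 0} *
      (\<Prod>i<n. emeasure (step_kernel \<omega> x (Suc i) (restrict xs {0..<Suc i})) {xs (Suc i)})"
    by (rule prod.lessThan_Suc_shift)
  also have "emeasure (step_kernel \<omega> x 0 (restrict xs {0..<0})) {xs 0} = (if xs 0 = x then 1 else 0)"
    by (simp add: step_kernel_def)
  also have "(\<Prod>i<n. emeasure (step_kernel \<omega> x (Suc i) (restrict xs {0..<Suc i})) {xs (Suc i)}) =
      (\<Prod>i<n. ennreal (transition \<omega> (xs i) (xs (Suc i))))"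
  proof (rule prod.cong[OF refl])
    fix i
    have "pmf (map_pmf (\<lambda>j. xs i + j) (\<omega> (xs i))) (xs (Suc i)) = pmf (\<omega> (xs i)) (xs (Suc i) - xs i)"
      using pmf_map_inj'[of "\<lambda>j. xs i + j" "\<omega> (xs i)" "xs (Suc i) - xs i"] by simp
    then show "emeasure (step_kernel \<omega> x (Suc i) (restrict xs {0..<Suc i})) {xs (Suc i)} =
        ennreal (transition \<omega> (xs i) (xs (Suc i)))"
      by (simp add: step_kernel_def transition_def emeasure_pmf_single)
  qed
  finally show ?thesis
    by simp
qed

lemma prob_space_quenched: "prob_space (quenched \<omega> x)"
proof -
  interpret Ionescu_Tulcea "step_kernel \<omega> x" "\<lambda>_. count_space UNIV"
    by (rule Ionescu_Tulcea_step_kernel)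
  have "prob_space (distr PF.lim (PiM {} (\<lambda>_. count_space UNIV)) (\<lambda>X. restrict X {}))"
    by (subst distr_lim) (auto intro: PF.prob_space_P)
  then show ?thesis
    unfolding quenched_def
    by (rule prob_space_distrD[rotated])
       (auto intro!: measurable_restrict simp: measurable_cong_sets[OF PF.sets_lim])
qed

lemma measurable_quenched [measurable]: "(\<lambda>\<omega>. quenched \<omega> x) \<in> env_space \<rightarrow>\<^sub>M prob_algebra path_space"
proof -
  define cyl where "cyl l = {X :: path. \<forall>i<length l. X i = l ! i}" for l :: "int list"
  let ?G = "insert {} (range cyl)"
  have cyl_Int: "cyl k \<inter> cyl l = (if take (length k) l = k then cyl l else {})"
    if "length k \<le> length l" for k l
  proof -
    have "take (length k) l = k \<longleftrightarrow> (\<forall>i<length k. l ! i = k ! i)"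
      using that by (auto simp: list_eq_iff_nth_eq)
    then show ?thesis
      using that by (auto simp: cyl_def dest: less_le_trans)
  qed
  have Int_G: "cyl k \<inter> cyl l \<in> ?G" for k l
    using cyl_Int[of k l] cyl_Int[of l k] by (cases "length k \<le> length l") (auto simp: Int_commute)
  then have "Int_stable ?G"
    unfolding Int_stable_def by (simp add: Int_G)
  have component: "(\<lambda>X. X i) \<in> sigma UNIV ?G \<rightarrow>\<^sub>M count_space UNIV" for i
    unfolding measurable_count_space_eq2_countable
  proof (intro conjI ballI)
    fix a :: int
    have "(\<lambda>X. X i) -` {a} \<inter> space (sigma UNIV ?G) = (\<Union>l\<in>{l. length l = Suc i \<and> l ! i = a}. cyl l)"
    proof safe
      fix X :: path
      have "X \<in> cyl (map X [0..<Suc i])" "length (map X [0..<Suc i]) = Suc i"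
        "map X [0..<Suc i] ! i = X i"
        by (auto simp: cyl_def simp del: upt_Suc)
      then show "X \<in> (\<Union>l\<in>{l. length l = Suc i \<and> l ! i = X i}. cyl l)"
        by blast
    qed (auto simp: cyl_def space_measure_of_conv)
    also have "\<dots> \<in> sets (sigma UNIV ?G)"
      by (intro sets.countable_UN') (auto intro: countableI_type)
    finally show "(\<lambda>X. X i) -` {a} \<inter> space (sigma UNIV ?G) \<in> sets (sigma UNIV ?G)" .
  qed auto
  have sets_cyl: "cyl l \<in> sets path_space" for l
  proof -
    have "cyl l = {X \<in> space path_space. \<forall>i<length l. X i = l ! i}"
      by (simp add: cyl_def)
    also have "\<dots> \<in> sets path_space"
      unfolding path_space_def by measurable
    finally show ?thesis .
  qed
  have "(\<lambda>X. X) \<in> sigma UNIV ?G \<rightarrow>\<^sub>M path_space"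
    unfolding path_space_def by (rule measurable_PiM_single') (auto intro: component)
  then have "sets path_space \<subseteq> sigma_sets UNIV ?G"
    by (auto dest!: measurable_sets)
  moreover have "sigma_sets UNIV ?G \<subseteq> sets path_space"
    using sets.sigma_sets_subset[of ?G path_space] sets_cyl by auto
  ultimately have sets_eq: "sets path_space = sigma_sets UNIV ?G"
    by blast
  show ?thesis
  proof (rule measurable_prob_algebra_generated[OF sets_eq \<open>Int_stable ?G\<close>])
    fix A assume "A \<in> ?G"
    then consider "A = {}" | l where "A = cyl l"
      by auto
    then show "(\<lambda>\<omega>. emeasure (quenched \<omega> x) A) \<in> borel_measurable env_space"
    proof cases
      case 2
      show ?thesis
      proof (cases l)
        case Nil
        have "emeasure (quenched \<omega> x) UNIV = 1" for \<omega>
          using prob_space.emeasure_space_1[OF prob_space_quenched[of \<omega> x]] by simp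
        with 2 Nil show ?thesis
          by (simp add: cyl_def)
      next
        case (Cons a k)
        then have "A = {X. \<forall>i\<le>length k. X i = l ! i}"
          using 2 by (simp add: cyl_def less_Suc_eq_le)
        then show ?thesis
          by (simp only: emeasure_quenched_cylinder) measurable
      qed
    qed simp
  qed (auto simp: prob_space_quenched)
qed

lemma
  assumes "prob_space P" and "sets P = sets env_space"
  shows sets_annealed: "sets (annealed P x) = sets (env_space \<Otimes>\<^sub>M path_space)"
    and prob_space_annealed: "prob_space (annealed P x)"
    and emeasure_annealed_Times: "A \<in> sets env_space \<Longrightarrow> B \<in> sets path_space \<Longrightarrow>
      emeasure (annealed P x) (A \<times> B) = (\<integral>\<^sup>+\<omega>\<in>A. emeasure (quenched \<omega> x) B \<partial>P)"
proof -
  let ?N = "env_space \<Otimes>\<^sub>M path_space"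
  let ?K = "\<lambda>\<omega>. distr (quenched \<omega> x) ?N (\<lambda>X. (\<omega>, X))"
  have "?K \<in> env_space \<rightarrow>\<^sub>M prob_algebra ?N"
    by (rule measurable_distr_prob_space2[where M = path_space]) measurable
  then have K: "?K \<in> P \<rightarrow>\<^sub>M prob_algebra ?N"
    by (simp add: measurable_cong_sets[OF assms(2) refl])
  have P: "P \<in> space (prob_algebra env_space)" "P \<in> space (prob_algebra P)"
    using assms by (auto simp: space_prob_algebra)
  have space_P: "space P = UNIV"
    using sets_eq_imp_space_eq[OF assms(2)] by simp
  show "sets (annealed P x) = sets ?N"
    unfolding annealed_def
    by (rule sets_bind) (auto simp: space_P)
  show "prob_space (annealed P x)"
    unfolding annealed_def by (rule prob_space_bind'[OF P(2) K])
  assume A: "A \<in> sets env_space" and B: "B \<in> sets path_space"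
  have "emeasure (annealed P x) (A \<times> B) = (\<integral>\<^sup>+\<omega>. emeasure (?K \<omega>) (A \<times> B) \<partial>P)"
    unfolding annealed_def using A B by (intro emeasure_bind_prob_algebra[OF P(2) K]) auto
  also have "\<dots> = (\<integral>\<^sup>+\<omega>\<in>A. emeasure (quenched \<omega> x) B \<partial>P)"
  proof (rule nn_integral_cong)
    fix \<omega>
    have "(\<lambda>X. (\<omega>, X)) \<in> quenched \<omega> x \<rightarrow>\<^sub>M ?N"
      by (rule measurable_compose[OF _ measurable_Pair1']) (auto simp: measurable_ident_sets)
    moreover have "(\<lambda>X. (\<omega>, X)) -` (A \<times> B) = (if \<omega> \<in> A then B else {})"
      by auto
    ultimately show "emeasure (?K \<omega>) (A \<times> B) = emeasure (quenched \<omega> x) B * indicator A \<omega>"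
      using A B by (subst emeasure_distr) auto
  qed
  finally show "emeasure (annealed P x) (A \<times> B) = (\<integral>\<^sup>+\<omega>\<in>A. emeasure (quenched \<omega> x) B \<partial>P)" .
qed

end

theory Submission
  imports Defs
begin

text \<open>Let \<open>p\<close> be the annealed probability that the walk never goes to the left of its starting point.

  If \<open>p > 0\<close>, the walk is almost surely unbounded to the right: by a zero-one law and stationarity
  there are, arbitrarily far to the left, windows of width \<open>w\<close> from all of whose sites the walk is
  unbounded to the right with probability bounded below, and a walk with jumps at most \<open>w\<close> cannot
  cross them all. So it keeps setting records, each of which is a regeneration point (never
  undershot again) with probability \<open>p\<close>, independently of the past. The increments of time and
  position between regenerations are i.i.d.; the position increments have finite mean because the
  records have positive density. The law of large numbers yields the velocity.

  If \<open>p = 0\<close>, an escape by \<open>m\<close> to the right without returning to the starting point has small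
  probability for large \<open>m\<close>. Looking at the last visit to \<open>(-\<infinity>, k w]\<close> before the walk advances
  by \<open>m\<close> beyond \<open>k w\<close>, for most \<open>k\<close> the walk needs many visits to the site in question before it
  escapes, so that it advances at speed zero.

  Applying the dichotomy to the environment and to its reflection leaves only the case where
  both upper speeds vanish. The statement on hitting times is deterministic.\<close>

section \<open>Path space\<close>

text \<open>A walk with jumps up to \<open>w\<close> can leap over single sites, so there is no
  site-by-site recursion for crossing times. What remains of the nearest-neighbour structure is that
  a walk passing \<open>w\<close> consecutive sites must visit one of them. In the transient case
  the time between regenerations may have infinite mean; the number of regenerations per unit of
  time then tends to 0 and so does the speed, so finiteness of the mean is an issue for the position
  increments only. If \<open>p = 0\<close> there is no renewal structure. There the number
  \<open>C\<close> of required visits is fixed before \<open>m\<close> is chosen so large that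
  escapes are rare, and the speed is at most a constant times w / C. The sigma-field of the
  statement is the Borel field of a product topology, whereas the independence arguments use a
  product measure over the sigma-field generated by the point masses; the two are linked through
  images of laws, which also takes care of the reflection.\<close>

abbreviation cyl :: "nat \<Rightarrow> path \<Rightarrow> path set" where
  "cyl n xs \<equiv> {X. \<forall>i\<le>n. X i = xs i}"

text \<open>Dependence on the coordinates up to time \<open>n\<close> only. The implication in one
  direction is enough, since \<open>X\<close> and \<open>Y\<close> can be exchanged.\<close>

definition adapted :: "nat \<Rightarrow> (path \<Rightarrow> bool) \<Rightarrow> bool" where
  "adapted n N \<longleftrightarrow> (\<forall>X Y. (\<forall>i\<le>n. X i = Y i) \<longrightarrow> N X \<longrightarrow> N Y)"

definition shift :: "nat \<Rightarrow> path \<Rightarrow> path" where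
  "shift n X = (\<lambda>i. X (n + i))"

lemma shift_apply [simp]: "shift n X i = X (n + i)"
  by (simp add: shift_def)

lemma adapted_cong: "adapted n N \<Longrightarrow> (\<And>i. i \<le> n \<Longrightarrow> X i = Y i) \<Longrightarrow> N X = N Y"
  unfolding adapted_def by metis

lemma adapted_conj:
  assumes "adapted n N" "adapted n M"
  shows "adapted n (\<lambda>X. N X \<and> M X)"
  unfolding adapted_def
proof (intro allI impI)
  fix X Y :: path assume "\<forall>i\<le>n. X i = Y i" "N X \<and> M X"
  then show "N Y \<and> M Y"
    using adapted_cong[OF assms(1), of X Y] adapted_cong[OF assms(2), of X Y] by simp
qed

lemma measurable_path_component [measurable]: "(\<lambda>X. X i) \<in> path_space \<rightarrow>\<^sub>M count_space UNIV"
  unfolding path_space_def by measurable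

lemma pred_countable2:
  fixes f g :: "'a \<Rightarrow> 'b :: countable"
  assumes [measurable]: "f \<in> M \<rightarrow>\<^sub>M count_space UNIV" "g \<in> M \<rightarrow>\<^sub>M count_space UNIV"
  shows "Measurable.pred M (\<lambda>x. P (f x) (g x))"
proof -
  have "(\<lambda>x. (\<lambda>a x. P a (g x)) (f x) x) \<in> M \<rightarrow>\<^sub>M count_space UNIV"
    by (rule measurable_compose_countable) measurable
  then show ?thesis by simp
qed

lemma pred_less_int [measurable (raw)]:
  fixes f g :: "'a \<Rightarrow> int"
  assumes "f \<in> M \<rightarrow>\<^sub>M count_space UNIV" "g \<in> M \<rightarrow>\<^sub>M count_space UNIV"
  shows "Measurable.pred M (\<lambda>x. f x < g x)" "Measurable.pred M (\<lambda>x. f x \<le> g x)"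
    "Measurable.pred M (\<lambda>x. f x = g x)"
  using assms by (rule pred_countable2)+

lemma measurable_int_op:
  fixes f g :: "'a \<Rightarrow> int"
  assumes f: "f \<in> M \<rightarrow>\<^sub>M count_space UNIV" and g: "g \<in> M \<rightarrow>\<^sub>M count_space UNIV"
  shows "(\<lambda>x. h (f x) (g x) :: 'b) \<in> M \<rightarrow>\<^sub>M count_space UNIV"
  by (rule measurable_compose_countable[OF _ f])
    (rule measurable_compose[OF g], simp)

lemma measurable_int_add [measurable (raw)]:
  fixes f g :: "'a \<Rightarrow> int"
  assumes "f \<in> M \<rightarrow>\<^sub>M count_space UNIV" "g \<in> M \<rightarrow>\<^sub>M count_space UNIV"
  shows "(\<lambda>x. f x + g x) \<in> M \<rightarrow>\<^sub>M count_space UNIV" "(\<lambda>x. f x - g x) \<in> M \<rightarrow>\<^sub>M count_space UNIV"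
  using assms by (rule measurable_int_op)+

lemma measurable_to_path_space:
  assumes "\<And>i. (\<lambda>x. f x i) \<in> M \<rightarrow>\<^sub>M count_space UNIV"
  shows "f \<in> M \<rightarrow>\<^sub>M path_space"
  unfolding path_space_def by (rule measurable_PiM_single') (auto intro: assms)

lemma measurable_shift [measurable]: "shift n \<in> path_space \<rightarrow>\<^sub>M path_space"
  by (rule measurable_to_path_space) simp

lemma path_setsI: "Measurable.pred path_space P \<Longrightarrow> {X. P X} \<in> sets path_space"
  by (simp add: pred_def)

lemma cyl_sets [measurable]: "cyl n xs \<in> sets path_space"
  by (rule path_setsI) measurable

text \<open>Initial segments of n + 1 points are coded as lists, which makes the family of cylinders
  countable and disjoint. Values \<open>l ! i\<close> beyond the end of the list are arbitrary, but
  by adaptedness \<open>N\<close> cannot see them.\<close>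

lemma adapted_cover:
  assumes "adapted n N"
  shows "{X. N X} = (\<Union>l\<in>{l. length l = Suc n \<and> N (\<lambda>i. l ! i)}. cyl n (\<lambda>i. l ! i))"
proof safe
  fix X assume "N X"
  let ?l = "map X [0..<Suc n]"
  have *: "X i = ?l ! i" if "i \<le> n" for i
    using that by (simp del: upt_Suc)
  with \<open>N X\<close> have "N (\<lambda>i. ?l ! i)"
    using adapted_cong[OF assms, of X "\<lambda>i. ?l ! i"] by metis
  with * show "X \<in> (\<Union>l\<in>{l. length l = Suc n \<and> N (\<lambda>i. l ! i)}. cyl n (\<lambda>i. l ! i))"
    by (intro UN_I[of ?l]) (auto simp del: upt_Suc)
next
  fix X l assume *: "N (\<lambda>i. l ! i)" "\<forall>i\<le>n. X i = l ! i"
  then show "N X"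
    using adapted_cong[OF assms, of X "\<lambda>i. l ! i"] by metis
qed

lemma disjoint_cyl: "disjoint_family_on (\<lambda>l. cyl n (\<lambda>i. l ! i)) {l. length l = Suc n \<and> Q l}"
  by (auto simp: disjoint_family_on_def list_eq_iff_nth_eq less_Suc_eq_le)

lemma adapted_sets:
  assumes "adapted n N"
  shows "{X. N X} \<in> sets path_space"
  unfolding adapted_cover[OF assms]
  by (intro sets.countable_UN') (auto intro: countableI_type)

text \<open>An adapted event is a countable disjoint union of cylinders, so a comparison on the
  cylinders inside it can be summed.\<close>

lemma emeasure_adapted_le:
  assumes "sets M = sets path_space" "sets M' = sets path_space" "adapted n N"
    and "\<And>xs. N xs \<Longrightarrow> emeasure M (cyl n xs) \<le> emeasure M' (cyl n xs)"
  shows "emeasure M {X. N X} \<le> emeasure M' {X. N X}"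
proof -
  let ?I = "{l. length l = Suc n \<and> N (\<lambda>i. l ! i)}"
  have eq: "emeasure K {X. N X} = (\<integral>\<^sup>+l. emeasure K (cyl n (\<lambda>i. l ! i)) \<partial>count_space ?I)"
    if "sets K = sets path_space" for K
    unfolding adapted_cover[OF assms(3)]
    by (rule emeasure_UN_countable) (auto simp: that disjoint_cyl intro: countableI_type)
  show ?thesis
    unfolding eq[OF assms(1)] eq[OF assms(2)]
    by (rule nn_integral_mono) (auto intro!: assms(4))
qed

lemma emeasure_adapted_eq:
  assumes "sets M = sets path_space" "sets M' = sets path_space" "adapted n N"
    and "\<And>xs. N xs \<Longrightarrow> emeasure M (cyl n xs) = emeasure M' (cyl n xs)"
  shows "emeasure M {X. N X} = emeasure M' {X. N X}"
  by (intro antisym emeasure_adapted_le[OF _ _ assms(3)]) (simp_all add: assms)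

section \<open>Cylinders as a generator of the path space\<close>

definition path_cyls :: "path set set" where
  "path_cyls = insert {} (range (\<lambda>(n, xs). cyl n xs))"

lemma cyl_in_path_cyls: "cyl n xs \<in> path_cyls"
  by (auto simp: path_cyls_def)

text \<open>Two cylinders either contradict each other or one contains the other. The first case is
  the reason for adding the empty set to the generator.\<close>

lemma Int_stable_path_cyls: "Int_stable path_cyls"
  unfolding Int_stable_def
proof (intro ballI)
  have cInt: "cyl n xs \<inter> cyl m ys \<in> path_cyls" if "n \<le> m" for n m xs ys
  proof (cases "\<forall>i\<le>n. xs i = ys i")
    case True
    then have "cyl n xs \<inter> cyl m ys = cyl m ys"
      using that by auto
    then show ?thesis by (simp add: cyl_in_path_cyls)
  next
    case False
    then have "cyl n xs \<inter> cyl m ys = {}"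
      using that by force
    then show ?thesis by (simp only: path_cyls_def insertI1)
  qed
  fix a b assume ab: "a \<in> path_cyls" "b \<in> path_cyls"
  have *: "cyl n xs \<inter> cyl m ys \<in> path_cyls" for n m xs ys
    using cInt[of n m xs ys] cInt[of m n ys xs] by (metis Int_commute linear)
  show "a \<inter> b \<in> path_cyls"
  proof (cases "a = {} \<or> b = {}")
    case True
    then show ?thesis by (auto simp: path_cyls_def)
  next
    case False
    with ab obtain n xs m ys where "a = cyl n xs" "b = cyl m ys" by (auto simp: path_cyls_def)
    with * show ?thesis by simp
  qed
qed

lemma sets_path_space: "sets path_space = sigma_sets UNIV path_cyls"
proof -
  let ?E = path_cyls
  have sub: "?E \<subseteq> sets path_space" by (auto simp: path_cyls_def)
  have "(\<lambda>X. X) \<in> sigma UNIV ?E \<rightarrow>\<^sub>M path_space"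
  proof (rule measurable_to_path_space)
    fix i
    show "(\<lambda>X. X i) \<in> sigma UNIV ?E \<rightarrow>\<^sub>M count_space UNIV"
      unfolding measurable_count_space_eq2_countable
    proof (intro conjI ballI)
      fix a :: int
      have "(\<lambda>X. X i) -` {a} \<inter> space (sigma UNIV ?E) = {X. X i = a}"
        by auto
      also have "\<dots> = (\<Union>l\<in>{l. length l = Suc i \<and> l ! i = a}. cyl i (\<lambda>i. l ! i))"
        by (rule adapted_cover) (simp add: adapted_def)
      also have "\<dots> \<in> sets (sigma UNIV ?E)"
        by (intro sets.countable_UN') (auto intro: countableI_type cyl_in_path_cyls)
      finally show "(\<lambda>X. X i) -` {a} \<inter> space (sigma UNIV ?E) \<in> sets (sigma UNIV ?E)" .
    qed auto
  qed
  then have "sets path_space \<subseteq> sigma_sets UNIV ?E"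
    by (auto dest!: measurable_sets)
  moreover have "sigma_sets UNIV ?E \<subseteq> sets path_space"
    using sets.sigma_sets_subset[OF sub] by simp
  ultimately show ?thesis by blast
qed

text \<open>Uniqueness on an intersection-stable generator. This is the common tool for the Markov
  property, translation, reflection and locality: each comparison comes down to products of
  transition probabilities along a finite path.\<close>

lemma path_measure_eqI:
  assumes sM: "sets M = sets path_space" and sN: "sets N = sets path_space"
    and fin: "finite_measure M"
    and eq: "\<And>n xs. emeasure M (cyl n xs) = emeasure N (cyl n xs)"
  shows "M = N"
proof (rule measure_eqI_generator_eq[OF Int_stable_path_cyls])
  show "sets M = sigma_sets UNIV path_cyls" "sets N = sigma_sets UNIV path_cyls"
    using sM sN sets_path_space by auto
  show "path_cyls \<subseteq> Pow UNIV" by auto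
  show "emeasure M X = emeasure N X" if "X \<in> path_cyls" for X
    using that eq by (auto simp: path_cyls_def)
  \<comment> \<open>The whole space is not a cylinder; it is exhausted by fixing the starting point,
    enumerated through \<open>from_nat\<close>.\<close>
  show "range (\<lambda>k. cyl 0 (\<lambda>_. from_nat k)) \<subseteq> path_cyls"
    by (intro image_subsetI cyl_in_path_cyls)
  show "(\<Union>k. cyl 0 (\<lambda>_. from_nat k)) = (UNIV :: path set)"
  proof safe
    fix X :: path
    show "X \<in> (\<Union>k. cyl 0 (\<lambda>_. from_nat k))"
      by (rule UN_I[of "to_nat (X 0)"]) auto
  qed auto
  show "emeasure M (cyl 0 (\<lambda>_. from_nat i)) \<noteq> \<infinity>" for i
    using finite_measure.emeasure_finite[OF fin] by (simp add: top_unique)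
qed

section \<open>The quenched chain\<close>

lemma AE_quenchedI:
  assumes "{X. P X} \<in> sets path_space" "emeasure (quenched \<omega> x) {X. \<not> P X} = 0"
  shows "AE X in quenched \<omega> x. P X"
proof (rule AE_I[of _ _ "{X. \<not> P X}"])
  have "{X. \<not> P X} = space path_space - {X. P X}" by auto
  also have "\<dots> \<in> sets path_space" using assms(1) by blast
  finally show "{X. \<not> P X} \<in> sets (quenched \<omega> x)" by simp
qed (use assms(2) in auto)

lemma quenched_le_1: "emeasure (quenched \<omega> x) B \<le> 1"
  using prob_space.emeasure_le_1[OF prob_space_quenched] .

lemma quenched_start: "AE X in quenched \<omega> x. X 0 = x"
proof -
  interpret prob_space "quenched \<omega> x" by (rule prob_space_quenched)
  have "emeasure (quenched \<omega> x) {X. X 0 = x} = 1"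
    using emeasure_quenched_cylinder[of \<omega> x 0 "\<lambda>_. x"] by simp
  then have "prob {X. X 0 = x} = 1"
    by (simp add: emeasure_eq_measure)
  from AE_prob_1[OF this] show ?thesis by simp
qed

section \<open>The Markov property of the quenched chain\<close>

lemma emeasure_density_indicator:
  assumes "A \<in> sets M" "S \<in> sets M"
  shows "emeasure (density M (indicator S)) A = emeasure M (A \<inter> S)"
proof -
  have "emeasure (density M (indicator S)) A = (\<integral>\<^sup>+x. indicator S x * indicator A x \<partial>M)"
    using assms by (intro emeasure_density) auto
  also have "\<dots> = (\<integral>\<^sup>+x. indicator (A \<inter> S) x \<partial>M)"
    by (intro nn_integral_cong) (auto simp: indicator_def)
  finally show ?thesis using assms by simp
qed

text \<open>Both sides are finite measures in \<open>B\<close>: the law of the shifted path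
  restricted to the cylinder (a density with an indicator, pushed forward), and a multiple of the
  chain started from \<open>xs n\<close>. On cylinders they agree because the product of transitions
  along a concatenated path factors.\<close>

lemma quenched_cyl_markov:
  assumes B: "B \<in> sets path_space"
  shows "emeasure (quenched \<omega> x) (cyl n xs \<inter> {X. shift n X \<in> B}) =
    emeasure (quenched \<omega> x) (cyl n xs) * emeasure (quenched \<omega> (xs n)) B"
proof -
  interpret prob_space "quenched \<omega> x" by (rule prob_space_quenched)
  let ?P = "quenched \<omega> x"
  let ?M = "distr (density ?P (indicator (cyl n xs))) path_space (shift n)"
  let ?N = "scale_measure (emeasure ?P (cyl n xs)) (quenched \<omega> (xs n))"
  have M: "emeasure ?M A = emeasure ?P (cyl n xs \<inter> {X. shift n X \<in> A})"
    if A: "A \<in> sets path_space" for A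
  proof -
    have [measurable]: "shift n \<in> density ?P (indicator (cyl n xs)) \<rightarrow>\<^sub>M path_space"
      by simp
    have A': "{X. shift n X \<in> A} \<in> sets path_space"
      using measurable_sets[OF measurable_shift A, of n] by (simp add: vimage_def)
    have "emeasure ?M A = emeasure (density ?P (indicator (cyl n xs))) {X. shift n X \<in> A}"
      using A by (simp add: emeasure_distr vimage_def)
    also have "\<dots> = emeasure ?P ({X. shift n X \<in> A} \<inter> cyl n xs)"
      by (rule emeasure_density_indicator) (simp_all only: A' cyl_sets sets_quenched)
    also have "{X. shift n X \<in> A} \<inter> cyl n xs = cyl n xs \<inter> {X. shift n X \<in> A}" by (rule Int_commute)
    finally show ?thesis .
  qed
  have "?M = ?N"
  proof (rule path_measure_eqI)
    show "finite_measure ?M"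
      using M[of UNIV] sets.top[of path_space]
      by (intro finite_measureI) (simp add: emeasure_eq_measure)
    fix m ys
    have "emeasure ?M (cyl m ys) = emeasure ?P (cyl n xs \<inter> {X. shift n X \<in> cyl m ys})"
      by (rule M) simp
    also have "\<dots> = emeasure ?N (cyl m ys)"
    proof (cases "ys 0 = xs n")
      case False
      then have "cyl n xs \<inter> {X. shift n X \<in> cyl m ys} = {}"
        by fastforce
      with False show ?thesis
        by (simp only: emeasure_quenched_cylinder emeasure_scale_measure) simp
    next
      case True
      \<comment> \<open>The two pieces share the point at time \<open>n\<close>, so no transition is
        lost or counted twice.\<close>
      define zs where "zs i = (if i \<le> n then xs i else ys (i - n))" for i
      have zs: "zs (n + i) = ys i" for i
        using True by (auto simp: zs_def)
      have "cyl n xs \<inter> {X. shift n X \<in> cyl m ys} = cyl (n + m) zs"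
      proof safe
        fix X i assume *: "\<forall>i\<le>n. X i = xs i" "\<forall>i\<le>m. shift n X i = ys i" "i \<le> n + m"
        show "X i = zs i"
          using *(1) *(2)[rule_format, of "i - n"] *(3) by (cases "i \<le> n") (auto simp: zs_def)
      next
        fix X i assume *: "\<forall>i\<le>n + m. X i = zs i" "i \<le> n"
        then show "X i = xs i" by (simp add: zs_def)
      next
        fix X i assume *: "\<forall>i\<le>n + m. X i = zs i" "i \<le> m"
        then show "shift n X i = ys i" by (simp add: zs)
      qed
      moreover have "(\<Prod>i<n + m. ennreal (transition \<omega> (zs i) (zs (Suc i)))) =
         (\<Prod>i<n. ennreal (transition \<omega> (xs i) (xs (Suc i)))) *
         (\<Prod>i<m. ennreal (transition \<omega> (ys i) (ys (Suc i))))"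
      proof -
        have "(\<Prod>i<n + m. ennreal (transition \<omega> (zs i) (zs (Suc i)))) =
         (\<Prod>i<n. ennreal (transition \<omega> (zs i) (zs (Suc i)))) *
         (\<Prod>i<m. ennreal (transition \<omega> (zs (n + i)) (zs (n + Suc i))))"
          by (induction m) (simp_all add: mult.assoc)
        also have "(\<Prod>i<n. ennreal (transition \<omega> (zs i) (zs (Suc i)))) =
          (\<Prod>i<n. ennreal (transition \<omega> (xs i) (xs (Suc i))))"
          by (rule prod.cong) (auto simp: zs_def)
        finally show ?thesis by (simp only: zs)
      qed
      moreover have "zs 0 = xs 0" by (simp add: zs_def)
      ultimately show ?thesis
        using True by (simp only: emeasure_quenched_cylinder emeasure_scale_measure) simp
    qed
    finally show "emeasure ?M (cyl m ys) = emeasure ?N (cyl m ys)" .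
  qed (simp_all)
  then show ?thesis
    using M[OF B] by simp
qed

lemma shift_vimage_sets:
  assumes "B \<in> sets path_space"
  shows "{X. shift n X \<in> B} \<in> sets path_space"
  using measurable_sets[OF measurable_shift assms, of n] by (simp add: vimage_def)

text \<open>The cylinder case extends to adapted events by viewing both sides as measures of the
  past event: the chain restricted to the future event, and a multiple of the chain.\<close>

lemma quenched_markov:
  assumes N: "adapted n N" and B: "B \<in> sets path_space"
  shows "emeasure (quenched \<omega> x) {X. N X \<and> X n = y \<and> shift n X \<in> B} =
    emeasure (quenched \<omega> x) {X. N X \<and> X n = y} * emeasure (quenched \<omega> y) B"
proof -
  let ?P = "quenched \<omega> x"
  let ?S = "{X. shift n X \<in> B}"
  have S: "?S \<in> sets path_space" using B by (rule shift_vimage_sets)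
  have N': "adapted n (\<lambda>X. N X \<and> X n = y)"
    by (rule adapted_conj[OF N]) (simp add: adapted_def)
  have "emeasure (density ?P (indicator ?S)) {X. N X \<and> X n = y} =
    emeasure (scale_measure (emeasure (quenched \<omega> y) B) ?P) {X. N X \<and> X n = y}"
  proof (rule emeasure_adapted_eq[OF _ _ N'])
    fix xs assume xs: "N xs \<and> xs n = y"
    have "emeasure (density ?P (indicator ?S)) (cyl n xs) = emeasure ?P (cyl n xs \<inter> ?S)"
      by (rule emeasure_density_indicator) (simp_all only: S cyl_sets sets_quenched)
    then show "emeasure (density ?P (indicator ?S)) (cyl n xs) =
        emeasure (scale_measure (emeasure (quenched \<omega> y) B) ?P) (cyl n xs)"
      using quenched_cyl_markov[OF B, of \<omega> x n xs] xs by (simp only: emeasure_scale_measure mult.commute)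
  qed simp_all
  also have "emeasure (density ?P (indicator ?S)) {X. N X \<and> X n = y} =
     emeasure ?P {X. N X \<and> X n = y \<and> shift n X \<in> B}"
  proof -
    have "emeasure (density ?P (indicator ?S)) {X. N X \<and> X n = y} =
        emeasure ?P ({X. N X \<and> X n = y} \<inter> ?S)"
      by (rule emeasure_density_indicator) (simp_all only: S adapted_sets[OF N'] sets_quenched)
    also have "{X. N X \<and> X n = y} \<inter> ?S = {X. N X \<and> X n = y \<and> shift n X \<in> B}" by auto
    finally show ?thesis .
  qed
  finally show ?thesis
    by (simp add: mult.commute)
qed

lemma emeasure_split_state:
  assumes "sets M = sets path_space" "{X. P X} \<in> sets path_space"
  shows "emeasure M {X. P X} = (\<integral>\<^sup>+y. emeasure M {X. P X \<and> X n = y} \<partial>count_space UNIV)"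
proof -
  have [measurable]: "Measurable.pred path_space P"
    using assms(2) by (simp add: pred_def)
  have "{X. P X \<and> X n = y} = {X \<in> space path_space. P X \<and> X n = y}" for y by simp
  also have "\<dots> y \<in> sets path_space" for y by measurable
  finally have m: "{X. P X \<and> X n = y} \<in> sets path_space" for y .
  have "{X. P X} = (\<Union>y\<in>UNIV. {X. P X \<and> X n = y})" by auto
  also have "emeasure M \<dots> = (\<integral>\<^sup>+y. emeasure M {X. P X \<and> X n = y} \<partial>count_space UNIV)"
    by (rule emeasure_UN_countable) (auto simp: assms m disjoint_family_on_def)
  finally show ?thesis .
qed

lemma adapted_shift_sets:
  assumes "adapted n N" "B \<in> sets path_space"
  shows "{X. N X \<and> shift n X \<in> B} \<in> sets path_space"
proof -
  have "{X. N X \<and> shift n X \<in> B} = {X. N X} \<inter> {X. shift n X \<in> B}" by auto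
  then show ?thesis
    using adapted_sets[OF assms(1)] shift_vimage_sets[OF assms(2), of n] by simp
qed

text \<open>Decomposition over the state at time \<open>n\<close>. A uniform bound \<open>g\<close>
  on the future probability keeps the state out of the conclusion.\<close>

lemma quenched_markov_le:
  assumes N: "adapted n N" and B: "B \<in> sets path_space"
    and g: "\<And>X. N X \<Longrightarrow> emeasure (quenched \<omega> (X n)) B \<le> g"
  shows "emeasure (quenched \<omega> x) {X. N X \<and> shift n X \<in> B} \<le> g * emeasure (quenched \<omega> x) {X. N X}"
proof -
  let ?P = "quenched \<omega> x"
  have "emeasure ?P {X. N X \<and> shift n X \<in> B} =
     (\<integral>\<^sup>+y. emeasure ?P {X. (N X \<and> shift n X \<in> B) \<and> X n = y} \<partial>count_space UNIV)"
    by (rule emeasure_split_state) (auto intro: adapted_shift_sets N B)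
  also have "\<dots> \<le> (\<integral>\<^sup>+y. g * emeasure ?P {X. N X \<and> X n = y} \<partial>count_space UNIV)"
  proof (rule nn_integral_mono)
    fix y
    have "emeasure ?P {X. (N X \<and> shift n X \<in> B) \<and> X n = y} =
      emeasure ?P {X. N X \<and> X n = y} * emeasure (quenched \<omega> y) B"
      using quenched_markov[OF N B, of \<omega> x y] by (simp add: conj_ac)
    also have "\<dots> \<le> g * emeasure ?P {X. N X \<and> X n = y}"
    proof (cases "\<exists>X. N X \<and> X n = y")
      case True
      then show ?thesis using g by (auto intro: mult_left_mono simp: mult.commute[of g])
    next
      case False
      then have "{X. N X \<and> X n = y} = {}" by auto
      then show ?thesis by (simp only: emeasure_empty mult_zero_left zero_le)
    qed
    finally show "emeasure ?P {X. (N X \<and> shift n X \<in> B) \<and> X n = y} \<le>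
      g * emeasure ?P {X. N X \<and> X n = y}" .
  qed
  also have "\<dots> = g * emeasure ?P {X. N X}"
    by (simp add: nn_integral_cmult emeasure_split_state[of ?P N n] adapted_sets[OF N])
  finally show ?thesis .
qed

text \<open>\<open>N n\<close> plays the role of the event that a stopping time equals
  \<open>n\<close>. Mutual exclusion replaces the stopping time itself, so no value has to be
  assigned on paths where it never occurs. The Markov bound is summed over \<open>n\<close>.\<close>

lemma quenched_strong_markov_le:
  assumes N: "\<And>n. adapted n (N n)" and ex: "\<And>n m X. N n X \<Longrightarrow> N m X \<Longrightarrow> n = m"
    and B: "B \<in> sets path_space"
    and g: "\<And>n X. N n X \<Longrightarrow> emeasure (quenched \<omega> (X n)) B \<le> g"
  shows "emeasure (quenched \<omega> x) {X. \<exists>n. N n X \<and> shift n X \<in> B} \<le>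
    g * emeasure (quenched \<omega> x) {X. \<exists>n. N n X}"
proof -
  let ?P = "quenched \<omega> x"
  have disj: "disjoint_family (\<lambda>n. {X. N n X})" "disjoint_family (\<lambda>n. {X. N n X \<and> shift n X \<in> B})"
    using ex by (auto simp: disjoint_family_on_def)
  have "{X. \<exists>n. N n X \<and> shift n X \<in> B} = (\<Union>n. {X. N n X \<and> shift n X \<in> B})" by auto
  also have "emeasure ?P \<dots> = (\<Sum>n. emeasure ?P {X. N n X \<and> shift n X \<in> B})"
    using disj by (intro suminf_emeasure[symmetric]) (auto intro: adapted_shift_sets N B)
  also have "\<dots> \<le> (\<Sum>n. g * emeasure ?P {X. N n X})"
    by (intro suminf_le quenched_markov_le N B g) auto
  also have "\<dots> = g * (\<Sum>n. emeasure ?P {X. N n X})" by simp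
  also have "(\<Sum>n. emeasure ?P {X. N n X}) = emeasure ?P (\<Union>n. {X. N n X})"
    using disj by (intro suminf_emeasure) (auto intro: adapted_sets N)
  also have "(\<Union>n. {X. N n X}) = {X. \<exists>n. N n X}" by auto
  finally show ?thesis .
qed

section \<open>Translations and local dependence on the environment\<close>

lemma quenched_translate:
  "distr (quenched \<omega> x) path_space (\<lambda>X i. X i - c) = quenched (\<lambda>a. \<omega> (a + c)) (x - c)"
proof (rule path_measure_eqI)
  interpret prob_space "quenched \<omega> x" by (rule prob_space_quenched)
  have [measurable]: "(\<lambda>X i. X i - c) \<in> quenched \<omega> x \<rightarrow>\<^sub>M path_space"
    by (rule measurable_to_path_space) measurable
  show "finite_measure (distr (quenched \<omega> x) path_space (\<lambda>X i. X i - c))"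
    by (rule finite_measure_distr) simp
  fix n and xs :: path
  have "emeasure (distr (quenched \<omega> x) path_space (\<lambda>X i. X i - c)) (cyl n xs) =
    emeasure (quenched \<omega> x) (cyl n (\<lambda>i. xs i + c))"
    by (subst emeasure_distr) (auto simp: vimage_def algebra_simps)
  also have "\<dots> = emeasure (quenched (\<lambda>a. \<omega> (a + c)) (x - c)) (cyl n xs)"
    by (simp add: emeasure_quenched_cylinder transition_def algebra_simps)
  finally show "emeasure (distr (quenched \<omega> x) path_space (\<lambda>X i. X i - c)) (cyl n xs) =
    emeasure (quenched (\<lambda>a. \<omega> (a + c)) (x - c)) (cyl n xs)" .
qed simp_all

lemma quenched_translate_event:
  assumes B: "B \<in> sets path_space"
  shows "emeasure (quenched (\<lambda>a. \<omega> (a + c)) x) B = emeasure (quenched \<omega> (x + c)) {X. (\<lambda>i. X i - c) \<in> B}"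
proof -
  have m: "(\<lambda>X i. X i - c) \<in> quenched \<omega> (x + c) \<rightarrow>\<^sub>M path_space"
    by (rule measurable_to_path_space) measurable
  have "quenched (\<lambda>a. \<omega> (a + c)) x = distr (quenched \<omega> (x + c)) path_space (\<lambda>X i. X i - c)"
    by (simp add: quenched_translate)
  then show ?thesis using m B by (simp add: emeasure_distr vimage_def)
qed

text \<open>A path of \<open>n\<close> steps uses the jump laws at its positions at times
  \<open>i < n\<close> only; the site where it stands at time \<open>n\<close> does not enter. This
  is what leaves the environment at a record site fresh.\<close>

lemma quenched_local_adapted:
  assumes "adapted n N" "\<And>X i. N X \<Longrightarrow> i < n \<Longrightarrow> X i \<in> A" "\<And>a. a \<in> A \<Longrightarrow> \<omega> a = \<omega>' a"
  shows "emeasure (quenched \<omega> x) {X. N X} = emeasure (quenched \<omega>' x) {X. N X}"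
proof (rule emeasure_adapted_eq[OF _ _ assms(1)])
  fix xs assume "N xs"
  then have "(\<Prod>i<n. ennreal (transition \<omega> (xs i) (xs (Suc i)))) =
    (\<Prod>i<n. ennreal (transition \<omega>' (xs i) (xs (Suc i))))"
    using assms(2,3) by (intro prod.cong) (auto simp: transition_def)
  then show "emeasure (quenched \<omega> x) (cyl n xs) = emeasure (quenched \<omega>' x) (cyl n xs)"
    by (simp only: emeasure_quenched_cylinder)
qed simp_all

text \<open>The laws restricted to paths that never leave \<open>A\<close> coincide: on a cylinder
  the restricted mass is a decreasing limit of masses of finite-time events, to which the
  finite-time version applies.\<close>

lemma quenched_local:
  assumes B: "B \<in> sets path_space" and A: "\<And>X i. X \<in> B \<Longrightarrow> X i \<in> A"
    and eq: "\<And>a. a \<in> A \<Longrightarrow> \<omega> a = \<omega>' a"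
  shows "emeasure (quenched \<omega> x) B = emeasure (quenched \<omega>' x) B"
proof -
  let ?S = "{X :: path. \<forall>i. X i \<in> A}"
  have [measurable]: "?S \<in> sets path_space"
    by (rule path_setsI) measurable
  let ?D = "\<lambda>\<omega>. density (quenched \<omega> x) (indicator ?S)"
  have "?D \<omega> = ?D \<omega>'"
  proof (rule path_measure_eqI)
    have "emeasure (?D \<omega>) UNIV = emeasure (quenched \<omega> x) ?S"
      using sets.top[of path_space] by (simp add: emeasure_density_indicator)
    also have "\<dots> < \<infinity>"
      using quenched_le_1[of \<omega> x ?S] by (simp add: le_less_trans)
    finally show "finite_measure (?D \<omega>)"
      by (intro finite_measureI) simp
    fix n xs
    have *: "emeasure (?D \<omega>) (cyl n xs) =
      (INF k. emeasure (quenched \<omega> x) {X. (\<forall>i\<le>n. X i = xs i) \<and> (\<forall>i<n + k. X i \<in> A)})" for \<omega>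
    proof -
      interpret prob_space "quenched \<omega> x" by (rule prob_space_quenched)
      let ?F = "\<lambda>k. {X. (\<forall>i\<le>n. X i = xs i) \<and> (\<forall>i<n + k. X i \<in> A)}"
      have "adapted (n + k) (\<lambda>X. (\<forall>i\<le>n. X i = xs i) \<and> (\<forall>i<n + k. X i \<in> A))" for k
        by (auto simp: adapted_def)
      then have F: "?F k \<in> sets (quenched \<omega> x)" for k
        using adapted_sets by simp
      have "emeasure (?D \<omega>) (cyl n xs) = emeasure (quenched \<omega> x) (cyl n xs \<inter> ?S)"
        by (rule emeasure_density_indicator) simp_all
      also have "cyl n xs \<inter> ?S = (\<Inter>k. ?F k)"
      proof safe
        fix X i assume "X \<in> (\<Inter>k. ?F k)"
        then have "X \<in> ?F (Suc i)" by blast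
        then show "X i \<in> A" by simp
      qed auto
      also have "emeasure (quenched \<omega> x) (\<Inter>k. ?F k) = (INF k. emeasure (quenched \<omega> x) (?F k))"
        using F by (intro INF_emeasure_decseq[symmetric]) (auto simp: decseq_def)
      finally show ?thesis .
    qed
    show "emeasure (?D \<omega>) (cyl n xs) = emeasure (?D \<omega>') (cyl n xs)"
    proof (unfold *, rule INF_cong[OF refl])
      fix k
      show "emeasure (quenched \<omega> x) {X. (\<forall>i\<le>n. X i = xs i) \<and> (\<forall>i<n + k. X i \<in> A)} =
        emeasure (quenched \<omega>' x) {X. (\<forall>i\<le>n. X i = xs i) \<and> (\<forall>i<n + k. X i \<in> A)}"
        by (rule quenched_local_adapted[of "n + k" _ A]) (auto simp: adapted_def eq)
    qed
  qed simp_all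
  then have "emeasure (?D \<omega>) B = emeasure (?D \<omega>') B" by simp
  moreover have "B \<inter> ?S = B" using A by auto
  ultimately show ?thesis
    using B by (simp add: emeasure_density_indicator)
qed

lemma quenched_bounded_jumps:
  assumes "\<And>a b. \<bar>b - a\<bar> > w \<Longrightarrow> transition \<omega> a b = 0"
  shows "AE X in quenched \<omega> x. \<forall>n. \<bar>X (Suc n) - X n\<bar> \<le> w"
  unfolding AE_all_countable
proof
  fix n
  have ad: "adapted (Suc n) (\<lambda>X. \<bar>X (Suc n) - X n\<bar> > w)"
    by (auto simp: adapted_def)
  have ad': "adapted (Suc n) (\<lambda>X. \<bar>X (Suc n) - X n\<bar> \<le> w)"
    by (auto simp: adapted_def)
  have "emeasure (quenched \<omega> x) {X. \<bar>X (Suc n) - X n\<bar> > w} =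
      emeasure (null_measure path_space) {X. \<bar>X (Suc n) - X n\<bar> > w}"
    by (rule emeasure_adapted_eq[OF _ _ ad])
      (simp_all only: sets_quenched sets_null_measure emeasure_quenched_cylinder,
       auto simp: assms intro!: prod_zero)
  then show "AE X in quenched \<omega> x. \<bar>X (Suc n) - X n\<bar> \<le> w"
    by (intro AE_quenchedI adapted_sets[OF ad']) (simp add: not_le)
qed

section \<open>Sets from which a target is hit with uniform probability\<close>

lemma hit_sets: "{X :: path. \<exists>n. X n \<in> A} \<in> sets path_space"
  by (rule path_setsI) measurable

text \<open>Let \<open>s\<close> be the supremum over all starting points of the probability of the
  bad event \<open>B\<close>. From a point of \<open>S\<close> the target is reached within some
  finite time with probability above \<epsilon>/2, and otherwise the bad event still lies ahead.
  Waiting for the first visit to \<open>S\<close> gives s \<le> (1 - \<epsilon>/2) s, hence s =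
  0.\<close>

lemma hit_io:
  fixes \<epsilon> :: real
  assumes "\<epsilon> > 0" and hit: "\<And>x. x \<in> S \<Longrightarrow> measure (quenched \<omega> x) {X. \<exists>n. X n \<in> A} \<ge> \<epsilon>"
  shows "AE X in quenched \<omega> x. (\<exists>\<^sub>\<infinity>n. X n \<in> S) \<longrightarrow> (\<exists>n. X n \<in> A)"
proof -
  let ?P = "quenched \<omega>"
  define B where "B = {X :: path. (\<exists>\<^sub>\<infinity>n. X n \<in> S) \<and> (\<forall>n. X n \<notin> A)}"
  define s where "s = (SUP x. emeasure (?P x) B)"
  have [measurable]: "B \<in> sets path_space"
    unfolding B_def INFM_nat by (rule path_setsI) measurable
  have le_s: "emeasure (?P y) B \<le> s" for y
    unfolding s_def by (rule SUP_upper) simp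
  have from_S: "emeasure (?P y) B \<le> ennreal (1 - \<epsilon> / 2) * s" if "y \<in> S" for y
  proof -
    interpret prob_space "?P y" by (rule prob_space_quenched)
    have ad: "adapted n (\<lambda>X. \<forall>i\<le>n. X i \<notin> A)" for n
      by (simp add: adapted_def)
    have ms: "{X. \<forall>i\<le>n. X i \<notin> A} \<in> events" for n
      using adapted_sets[OF ad] by simp
    have "(\<lambda>n. prob {X. \<forall>i\<le>n. X i \<notin> A}) \<longlonglongrightarrow> prob (\<Inter>n. {X. \<forall>i\<le>n. X i \<notin> A})"
      by (intro finite_Lim_measure_decseq) (use ms in \<open>auto simp: decseq_def\<close>)
    moreover have "prob (\<Inter>n. {X. \<forall>i\<le>n. X i \<notin> A}) < 1 - \<epsilon> / 2"
    proof -
      have "{X. \<exists>n. X n \<in> A} \<in> events" using hit_sets by simp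
      moreover have "(\<Inter>n. {X :: path. \<forall>i\<le>n. X i \<notin> A}) = space (?P y) - {X. \<exists>n. X n \<in> A}"
        by auto
      ultimately have "prob (\<Inter>n. {X. \<forall>i\<le>n. X i \<notin> A}) = 1 - prob {X. \<exists>n. X n \<in> A}"
        by (simp only: prob_compl)
      then show ?thesis
        using hit[OF that] \<open>\<epsilon> > 0\<close> by simp
    qed
    ultimately have "eventually (\<lambda>n. prob {X. \<forall>i\<le>n. X i \<notin> A} < 1 - \<epsilon> / 2) sequentially"
      by (rule order_tendstoD)
    \<comment> \<open>The horizon \<open>n\<close> depends on the starting point, but the factor 1 -
      \<epsilon>/2 does not; giving up half of \<epsilon> buys a finite horizon.\<close>
    then obtain n where n: "prob {X. \<forall>i\<le>n. X i \<notin> A} < 1 - \<epsilon> / 2"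
      by (auto simp: eventually_sequentially)
    have "emeasure (?P y) B \<le> emeasure (?P y) {X. (\<forall>i\<le>n. X i \<notin> A) \<and> shift n X \<in> B}"
    proof (intro emeasure_mono subsetI CollectI conjI)
      fix X assume X: "X \<in> B"
      then show "\<forall>i\<le>n. X i \<notin> A" by (auto simp: B_def)
      have "\<exists>k>m. X (n + k) \<in> S" for m
      proof -
        obtain k where "k > n + m" "X k \<in> S"
          using X by (auto simp: B_def INFM_nat)
        then show ?thesis by (intro exI[of _ "k - n"]) auto
      qed
      with X show "shift n X \<in> B" by (auto simp: B_def INFM_nat)
    qed (use adapted_shift_sets[OF ad] in simp)
    also have "\<dots> \<le> s * emeasure (?P y) {X. \<forall>i\<le>n. X i \<notin> A}"
      by (rule quenched_markov_le[OF ad]) (auto intro: le_s)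
    also have "\<dots> \<le> s * ennreal (1 - \<epsilon> / 2)"
      using n by (intro mult_left_mono) (auto simp: emeasure_eq_measure intro: ennreal_leI)
    finally show ?thesis by (simp add: mult.commute)
  qed
  have "emeasure (?P y) B \<le> ennreal (1 - \<epsilon> / 2) * s" for y
  proof -
    let ?N = "\<lambda>n X. X n \<in> S \<and> (\<forall>i<n. X i \<notin> S)"
    have "emeasure (?P y) B \<le> emeasure (?P y) {X. \<exists>n. ?N n X \<and> shift n X \<in> B}"
    proof (intro emeasure_mono subsetI CollectI)
      fix X assume X: "X \<in> B"
      then obtain k where "X k \<in> S" by (auto simp: B_def INFM_nat)
      define n where "n = (LEAST k. X k \<in> S)"
      have "?N n X"
        unfolding n_def using LeastI[of "\<lambda>k. X k \<in> S", OF \<open>X k \<in> S\<close>] by (auto dest: not_less_Least)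
      moreover have "\<exists>k>m. X (n + k) \<in> S" for m
      proof -
        obtain k where "k > n + m" "X k \<in> S"
          using X by (auto simp: B_def INFM_nat)
        then show ?thesis by (intro exI[of _ "k - n"]) auto
      qed
      then have "shift n X \<in> B"
        using X by (auto simp: B_def INFM_nat)
      ultimately show "\<exists>n. ?N n X \<and> shift n X \<in> B" by blast
    next
      show "{X. \<exists>n. ?N n X \<and> shift n X \<in> B} \<in> sets (?P y)"
        unfolding sets_quenched by (rule path_setsI) measurable
    qed
    also have "\<dots> \<le> (ennreal (1 - \<epsilon> / 2) * s) * emeasure (?P y) {X. \<exists>n. ?N n X}"
    proof (rule quenched_strong_markov_le)
      show "n = m" if "?N n X" "?N m X" for n m :: nat and X
        using that by (cases n m rule: linorder_cases) auto
    qed (auto simp: adapted_def intro: from_S)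
    also have "\<dots> \<le> (ennreal (1 - \<epsilon> / 2) * s) * 1"
      by (intro mult_left_mono quenched_le_1) auto
    finally show ?thesis by simp
  qed
  then have "s \<le> ennreal (1 - \<epsilon> / 2) * s"
    unfolding s_def by (intro SUP_least) auto
  \<comment> \<open>Infinity could satisfy the inequality for \<open>s\<close> as well, so
    finiteness has to be known before it is solved.\<close>
  moreover have "s \<le> 1"
    unfolding s_def by (intro SUP_least quenched_le_1)
  then obtain r where r: "s = ennreal r" "r \<ge> 0"
    by (cases s) (auto simp: top_unique)
  have "r = 0"
  proof (cases "\<epsilon> \<le> 2")
    case True
    then have "r \<le> (1 - \<epsilon> / 2) * r"
      using calculation r by (simp add: ennreal_mult'[symmetric])
    then have "\<epsilon> * r \<le> 0" by (simp add: algebra_simps)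
    then show ?thesis using \<open>\<epsilon> > 0\<close> r(2) by (simp add: mult_le_0_iff)
  next
    case False
    then show ?thesis using calculation r by (simp add: ennreal_neg)
  qed
  then have "emeasure (?P x) B = 0"
    using le_s[of x] r by simp
  moreover have "{X. (\<exists>\<^sub>\<infinity>n. X n \<in> S) \<longrightarrow> (\<exists>n. X n \<in> A)} = space path_space - B"
    by (auto simp: B_def)
  moreover have "{X. \<not> ((\<exists>\<^sub>\<infinity>n. X n \<in> S) \<longrightarrow> (\<exists>n. X n \<in> A))} = B"
    by (auto simp: B_def)
  ultimately show ?thesis
    by (intro AE_quenchedI) (simp_all only: sets.compl_sets \<open>B \<in> sets path_space\<close>)
qed

section \<open>Independent environments\<close>

text \<open>The sigma-field generated by the point masses. With it the environment law is a genuine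
  product measure, and measurability of a map into the environments is checked one site and one mass
  at a time.\<close>

definition pmf_algebra :: "int pmf measure" where
  "pmf_algebra = vimage_algebra UNIV (\<lambda>\<mu> j. pmf \<mu> j) (\<Pi>\<^sub>M j\<in>UNIV. borel)"

definition env_algebra :: "env measure" where
  "env_algebra = (\<Pi>\<^sub>M a\<in>UNIV. pmf_algebra)"

lemma space_pmf_algebra [simp]: "space pmf_algebra = UNIV"
  by (simp add: pmf_algebra_def)

lemma space_env_algebra [simp]: "space env_algebra = UNIV"
  by (simp add: env_algebra_def space_PiM)

lemma measurable_pmf_algebra [measurable]: "(\<lambda>\<mu>. pmf \<mu> j) \<in> borel_measurable pmf_algebra"
proof -
  have "(\<lambda>\<mu> j. pmf \<mu> j) \<in> pmf_algebra \<rightarrow>\<^sub>M (\<Pi>\<^sub>M j\<in>UNIV. borel)"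
    unfolding pmf_algebra_def by (rule measurable_vimage_algebra1) (simp add: space_PiM)
  from measurable_compose[OF this measurable_component_singleton[of j]] show ?thesis by simp
qed

lemma measurable_to_pmf_algebra:
  assumes "\<And>j. (\<lambda>x. pmf (f x) j) \<in> borel_measurable N"
  shows "f \<in> N \<rightarrow>\<^sub>M pmf_algebra"
  unfolding pmf_algebra_def
  by (rule measurable_vimage_algebra2) (auto intro!: measurable_PiM_single' assms)

lemma measurable_env_algebra_component [measurable]: "(\<lambda>\<omega>. \<omega> a) \<in> env_algebra \<rightarrow>\<^sub>M pmf_algebra"
  unfolding env_algebra_def by measurable

lemma measurable_to_env_algebra:
  assumes "\<And>a. (\<lambda>x. f x a) \<in> N \<rightarrow>\<^sub>M pmf_algebra"
  shows "f \<in> N \<rightarrow>\<^sub>M env_algebra"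
  unfolding env_algebra_def by (rule measurable_PiM_single') (auto intro: assms)

lemma measurable_transition_env_algebra [measurable]:
  "(\<lambda>\<omega>. transition \<omega> a b) \<in> borel_measurable env_algebra"
  unfolding transition_def by measurable

lemma measurable_quenched_env_algebra [measurable]:
  "(\<lambda>\<omega>. quenched \<omega> x) \<in> env_algebra \<rightarrow>\<^sub>M prob_algebra path_space"
proof (rule measurable_prob_algebra_generated[OF sets_path_space Int_stable_path_cyls])
  fix A assume "A \<in> path_cyls"
  then consider "A = {}" | n xs where "A = cyl n xs" by (auto simp: path_cyls_def)
  then show "(\<lambda>\<omega>. emeasure (quenched \<omega> x) A) \<in> borel_measurable env_algebra"
  proof cases
    case 2
    then show ?thesis by (simp only: emeasure_quenched_cylinder) measurable
  qed simp
qed (auto simp: prob_space_quenched)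

lemma measurable_emeasure_quenched [measurable]:
  assumes "B \<in> sets path_space"
  shows "(\<lambda>\<omega>. emeasure (quenched \<omega> x) B) \<in> borel_measurable env_algebra"
  using measurable_compose[OF measurable_prob_algebraD[OF measurable_quenched_env_algebra]
      measurable_emeasure_subprob_algebra[OF assms]] .

section \<open>The product environment and the annealed law of the path\<close>

locale iid_environment = prob_space M for M :: "int pmf measure" +
  assumes sets_M [measurable_cong]: "sets M = sets pmf_algebra"
begin

definition env :: "env measure" where
  "env = (\<Pi>\<^sub>M a\<in>UNIV. M)"

lemma sets_env [simp, measurable_cong]: "sets env = sets env_algebra"
  unfolding env_def env_algebra_def by (intro sets_PiM_cong refl sets_M)

lemma space_env [simp]: "space env = UNIV"
  using sets_eq_imp_space_eq[OF sets_env] by simp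

lemma prob_space_env: "prob_space env"
  unfolding env_def by (rule prob_space_PiM) (rule prob_space_axioms)

lemma distr_env_component: "distr env M (\<lambda>\<omega>. \<omega> a) = M"
  unfolding env_def by (rule distr_PiM_component) (auto intro: prob_space_axioms)

lemma env_shift: "distr env env_algebra (\<lambda>\<omega> a. \<omega> (a + c)) = env"
proof -
  have "distr (\<Pi>\<^sub>M a\<in>UNIV. M) (\<Pi>\<^sub>M a\<in>UNIV. M) (\<lambda>\<omega>. \<lambda>n\<in>UNIV. \<omega> (n + c)) = (\<Pi>\<^sub>M a\<in>UNIV. M)"
    by (rule distr_PiM_reindex) (auto intro: prob_space_axioms)
  then show ?thesis
    by (simp only: env_def[symmetric] restrict_UNIV) (simp cong: distr_cong)
qed

lemma nn_integral_env_shift: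
  assumes [measurable]: "f \<in> borel_measurable env_algebra"
  shows "(\<integral>\<^sup>+\<omega>. f (\<lambda>a. \<omega> (a + c)) \<partial>env) = (\<integral>\<^sup>+\<omega>. f \<omega> \<partial>env)"
proof -
  have [measurable]: "(\<lambda>\<omega> a. \<omega> (a + c)) \<in> env \<rightarrow>\<^sub>M env_algebra"
    by (rule measurable_to_env_algebra) measurable
  have "(\<integral>\<^sup>+\<omega>. f \<omega> \<partial>distr env env_algebra (\<lambda>\<omega> a. \<omega> (a + c))) = (\<integral>\<^sup>+\<omega>. f (\<lambda>a. \<omega> (a + c)) \<partial>env)"
    by (rule nn_integral_distr) measurable
  then show ?thesis by (simp only: env_shift)
qed

text \<open>Dependence on the sites in \<open>K i\<close> is stated pointwise, the form in which
  locality of the quenched chain delivers it. Each \<open>f i\<close> is rewritten as a measurable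
  function of the environment restricted to \<open>K i\<close>, and restrictions to disjoint sets of
  coordinates are independent under a product measure.\<close>

lemma nn_integral_env_prod:
  assumes fin: "finite I" and disj: "disjoint_family_on K I"
    and meas: "\<And>i. i \<in> I \<Longrightarrow> f i \<in> borel_measurable env_algebra"
    and dep: "\<And>i \<omega> \<omega>'. i \<in> I \<Longrightarrow> (\<And>a. a \<in> K i \<Longrightarrow> \<omega> a = \<omega>' a) \<Longrightarrow> f i \<omega> = (f i \<omega>' :: ennreal)"
  shows "(\<integral>\<^sup>+\<omega>. (\<Prod>i\<in>I. f i \<omega>) \<partial>env) = (\<Prod>i\<in>I. \<integral>\<^sup>+\<omega>. f i \<omega> \<partial>env)"
proof -
  interpret E: prob_space env by (rule prob_space_env)
  have comp: "(\<lambda>\<omega>. \<omega> a) \<in> env \<rightarrow>\<^sub>M M" for a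
    unfolding env_def by measurable
  have "E.indep_vars (\<lambda>_. M) (\<lambda>a \<omega>. \<omega> a) UNIV"
  proof (subst E.indep_vars_iff_distr_eq_PiM')
    have "distr env (\<Pi>\<^sub>M a\<in>UNIV. M) (\<lambda>\<omega>. \<lambda>a\<in>UNIV. \<omega> a) = env"
      using env_shift[of 0] by (simp only: env_def[symmetric] restrict_UNIV) (simp cong: distr_cong)
    then show "distr env (\<Pi>\<^sub>M a\<in>UNIV. M) (\<lambda>\<omega>. \<lambda>a\<in>UNIV. \<omega> a) = (\<Pi>\<^sub>M a\<in>UNIV. distr env M (\<lambda>\<omega>. \<omega> a))"
      by (simp only: distr_env_component env_def[symmetric])
  qed (auto intro: comp)
  then have "E.indep_vars (\<lambda>i. \<Pi>\<^sub>M a\<in>K i. M) (\<lambda>i \<omega>. restrict (\<lambda>a. \<omega> a) (K i)) I"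
    using disj by (intro E.indep_vars_restrict) auto
  \<comment> \<open>Outside \<open>K i\<close> the environment is filled with the arbitrary law
    \<open>return_pmf 0\<close>, which \<open>f i\<close> does not see by
    \<open>dep\<close>.\<close>
  then have "E.indep_vars (\<lambda>_. borel) (\<lambda>i \<omega>. f i (\<lambda>a. if a \<in> K i then restrict \<omega> (K i) a else return_pmf 0)) I"
  proof (rule E.indep_vars_compose2)
    fix i assume i: "i \<in> I"
    have "(\<lambda>\<eta> a. if a \<in> K i then \<eta> a else return_pmf 0) \<in> (\<Pi>\<^sub>M a\<in>K i. M) \<rightarrow>\<^sub>M env_algebra"
    proof (rule measurable_to_env_algebra)
      fix a
      show "(\<lambda>\<eta>. if a \<in> K i then \<eta> a else return_pmf 0) \<in> (\<Pi>\<^sub>M a\<in>K i. M) \<rightarrow>\<^sub>M pmf_algebra"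
        using measurable_component_singleton[of a "K i" "\<lambda>_. M"]
        by (cases "a \<in> K i") (simp_all add: measurable_cong_sets[OF refl sets_M])
    qed
    from measurable_compose[OF this meas[OF i]]
    show "(\<lambda>\<eta>. f i (\<lambda>a. if a \<in> K i then \<eta> a else return_pmf 0)) \<in> (\<Pi>\<^sub>M a\<in>K i. M) \<rightarrow>\<^sub>M borel" .
  qed
  moreover have "f i (\<lambda>a. if a \<in> K i then restrict \<omega> (K i) a else return_pmf 0) = f i \<omega>" if "i \<in> I" for i \<omega>
    by (rule dep[OF that]) simp
  then have "E.indep_vars (\<lambda>_. borel) (\<lambda>i \<omega>. f i (\<lambda>a. if a \<in> K i then restrict \<omega> (K i) a else return_pmf 0)) I
      \<longleftrightarrow> E.indep_vars (\<lambda>_. borel) f I"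
    by (intro E.indep_vars_cong) auto
  ultimately have "E.indep_vars (\<lambda>_. borel) f I" by blast
  then show ?thesis
    by (intro E.indep_vars_nn_integral fin) auto
qed

lemma nn_integral_env_mult:
  assumes "A \<inter> B = {}"
    and f: "f \<in> borel_measurable env_algebra" and g: "g \<in> borel_measurable env_algebra"
    and df: "\<And>\<omega> \<omega>'. (\<And>a. a \<in> A \<Longrightarrow> \<omega> a = \<omega>' a) \<Longrightarrow> f \<omega> = (f \<omega>' :: ennreal)"
    and dg: "\<And>\<omega> \<omega>'. (\<And>a. a \<in> B \<Longrightarrow> \<omega> a = \<omega>' a) \<Longrightarrow> g \<omega> = g \<omega>'"
  shows "(\<integral>\<^sup>+\<omega>. f \<omega> * g \<omega> \<partial>env) = (\<integral>\<^sup>+\<omega>. f \<omega> \<partial>env) * (\<integral>\<^sup>+\<omega>. g \<omega> \<partial>env)"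
proof -
  have "(\<integral>\<^sup>+\<omega>. (\<Prod>b\<in>UNIV. (if b then g else f) \<omega>) \<partial>env) = (\<Prod>b\<in>UNIV. \<integral>\<^sup>+\<omega>. (if b then g else f) \<omega> \<partial>env)"
  proof (rule nn_integral_env_prod[where K = "\<lambda>b. if b then B else A"])
    show "disjoint_family_on (\<lambda>b. if b then B else A) UNIV"
      using assms(1) by (auto simp: disjoint_family_on_def)
    show "(if i then g else f) \<omega> = (if i then g else f) \<omega>'"
      if "\<And>a. a \<in> (if i then B else A) \<Longrightarrow> \<omega> a = \<omega>' a" for i \<omega> \<omega>'
      using that by (cases i) (simp_all, rule dg, simp, rule df, simp)
  qed (simp_all add: f g)
  then show ?thesis by (simp add: UNIV_bool)
qed

definition law :: "int \<Rightarrow> path measure" where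
  "law x = env \<bind> (\<lambda>\<omega>. quenched \<omega> x)"

lemma quenched_env [measurable]: "(\<lambda>\<omega>. quenched \<omega> x) \<in> env \<rightarrow>\<^sub>M prob_algebra path_space"
  by (simp add: measurable_cong_sets[OF sets_env refl])

lemma env_in_prob_algebra: "env \<in> space (prob_algebra env)"
  by (simp add: space_prob_algebra prob_space_env)

lemma sets_law [simp, measurable_cong]: "sets (law x) = sets path_space"
  unfolding law_def by (rule sets_bind) auto

lemma space_law [simp]: "space (law x) = UNIV"
  using sets_eq_imp_space_eq[OF sets_law] by simp

lemma prob_space_law: "prob_space (law x)"
  unfolding law_def by (rule prob_space_bind'[OF env_in_prob_algebra quenched_env])

lemma emeasure_law: "B \<in> sets path_space \<Longrightarrow>
    emeasure (law x) B = (\<integral>\<^sup>+\<omega>. emeasure (quenched \<omega> x) B \<partial>env)"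
  unfolding law_def by (rule emeasure_bind_prob_algebra[OF env_in_prob_algebra quenched_env])

lemma AE_law:
  assumes "Measurable.pred path_space P"
  shows "(AE X in law x. P X) \<longleftrightarrow> (AE \<omega> in env. AE X in quenched \<omega> x. P X)"
  unfolding law_def by (rule AE_bind[OF measurable_prob_algebraD[OF quenched_env] assms])

text \<open>Shifting the path by \<open>c\<close> amounts to shifting the environment, and the
  product law is invariant under shifts.\<close>

lemma law_translate:
  assumes B: "B \<in> sets path_space"
  shows "emeasure (law x) {X. (\<lambda>i. X i - c) \<in> B} = emeasure (law (x - c)) B"
proof -
  have m: "(\<lambda>X i. X i - c) \<in> path_space \<rightarrow>\<^sub>M path_space"
    by (rule measurable_to_path_space) measurable
  then have B': "{X. (\<lambda>i. X i - c) \<in> B} \<in> sets path_space"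
    using measurable_sets[OF m B] by (simp add: vimage_def)
  have "emeasure (quenched \<omega> x) {X. (\<lambda>i. X i - c) \<in> B} = emeasure (quenched (\<lambda>a. \<omega> (a + c)) (x - c)) B" for \<omega>
    using quenched_translate_event[OF B, of \<omega> c "x - c"] by simp
  then show ?thesis
    using nn_integral_env_shift[OF measurable_emeasure_quenched[OF B, of "x - c"], of c]
    by (simp add: emeasure_law B B')
qed

end

section \<open>Environments without escape to the right\<close>

definition stay_right :: "path set" where
  "stay_right = {Y. \<forall>i. Y 0 \<le> Y i}"

definition escape :: "nat \<Rightarrow> path set" where
  "escape m = {Y. \<exists>t. Y 0 + int m \<le> Y t \<and> (\<forall>s. 0 < s \<and> s < t \<longrightarrow> Y 0 < Y s)}"

lemma stay_right_sets [measurable]: "stay_right \<in> sets path_space"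
  unfolding stay_right_def by (rule path_setsI) measurable

lemma adapted_imp_pred: "adapted n N \<Longrightarrow> Measurable.pred path_space N"
  using adapted_sets[of n N] by (simp add: pred_def)

lemma escape_sets [measurable]: "escape m \<in> sets path_space"
proof -
  have [measurable]: "Measurable.pred path_space (\<lambda>Y. Y 0 + int m \<le> Y t \<and> (\<forall>s. 0 < s \<and> s < t \<longrightarrow> Y 0 < Y s))" for t
    by (rule adapted_imp_pred[of t]) (simp add: adapted_def)
  show ?thesis
    unfolding escape_def by (rule path_setsI) measurable
qed

lemma decseq_escape: "decseq escape"
  unfolding decseq_def
proof (intro allI impI subsetI)
  fix m n and Y assume "m \<le> n" "Y \<in> escape n"
  then obtain t where "Y 0 + int n \<le> Y t" "\<forall>s. 0 < s \<and> s < t \<longrightarrow> Y 0 < Y s"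
    by (auto simp: escape_def)
  with \<open>m \<le> n\<close> show "Y \<in> escape m"
    unfolding escape_def by (intro CollectI exI[of _ t]) auto
qed

text \<open>Up to time \<open>s\<close> a path climbs only a finite height. An escape beyond that
  height can only be completed after \<open>s\<close>, and then the position at time
  \<open>s\<close> > 0 is forced to be above the start.\<close>

lemma Inter_escape_subset: "(\<Inter>m. escape m) \<subseteq> stay_right"
proof (rule subsetI)
  fix Y assume Y: "Y \<in> (\<Inter>m. escape m)"
  have "Y 0 \<le> Y s" for s
  proof (cases "s = 0")
    case False
    define m where "m = nat (Max ((\<lambda>i. Y i - Y 0) ` {..s}) + 1)"
    have le: "Y i - Y 0 < int m" if "i \<le> s" for i
    proof -
      have "Y i - Y 0 \<le> Max ((\<lambda>i. Y i - Y 0) ` {..s})"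
        using that by (intro Max_ge) auto
      then show ?thesis unfolding m_def by linarith
    qed
    from Y have "Y \<in> escape m" by blast
    then obtain t where t: "Y 0 + int m \<le> Y t" "\<forall>s. 0 < s \<and> s < t \<longrightarrow> Y 0 < Y s"
      by (auto simp: escape_def)
    have "s < t"
      using le[of t] t(1) by (cases "s < t") auto
    with t(2) False show ?thesis by (simp add: less_imp_le)
  qed simp
  then show "Y \<in> stay_right" by (simp add: stay_right_def)
qed

lemma quenched_escape_local:
  assumes "\<And>a. a \<in> {y..<y + int m} \<Longrightarrow> \<omega> a = \<omega>' a"
  shows "emeasure (quenched \<omega> y) (escape m) = emeasure (quenched \<omega>' y) (escape m)"
proof -
  let ?N = "\<lambda>t (X :: path). X 0 = y \<and> y + int m \<le> X t \<and> (\<forall>s<t. X s < y + int m \<and> (0 < s \<longrightarrow> y < X s))"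
  have ad: "adapted t (?N t)" for t
    by (simp add: adapted_def)
  have disj: "disjoint_family (\<lambda>t. {X. ?N t X})"
    unfolding disjoint_family_on_def
  proof (intro ballI impI)
    fix t t' :: nat assume "t \<noteq> t'"
    then show "{X. ?N t X} \<inter> {X. ?N t' X} = {}"
      by (cases t t' rule: linorder_cases) force+
  qed
  have eq: "{X \<in> escape m. X 0 = y} = (\<Union>t. {X. ?N t X})"
  proof safe
    fix X assume X: "X \<in> escape m" "y = X 0"
    then have ex: "\<exists>t. X 0 + int m \<le> X t" by (auto simp: escape_def)
    define t where "t = (LEAST t. X 0 + int m \<le> X t)"
    have t: "X 0 + int m \<le> X t" using LeastI_ex[OF ex] by (simp add: t_def)
    have less: "X s < X 0 + int m" if "s < t" for s
      using not_less_Least[of s "\<lambda>t. X 0 + int m \<le> X t"] that by (auto simp: t_def)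
    obtain t' where t': "X 0 + int m \<le> X t'" "\<forall>s. 0 < s \<and> s < t' \<longrightarrow> X 0 < X s"
      using X by (auto simp: escape_def)
    have "t \<le> t'" using t'(1) by (auto simp: t_def intro: Least_le)
    with t less t' X(2) show "X \<in> (\<Union>t. {Xa. Xa 0 = X 0 \<and> X 0 + int m \<le> Xa t \<and>
        (\<forall>s<t. Xa s < X 0 + int m \<and> (0 < s \<longrightarrow> X 0 < Xa s))})"
      by (intro UN_I[of t]) auto
  next
    fix X :: path and t assume "X 0 + int m \<le> X t" "\<forall>s<t. X s < X 0 + int m \<and> (0 < s \<longrightarrow> X 0 < X s)"
    then show "X \<in> escape m" by (auto simp: escape_def)
  qed
  have "emeasure (quenched \<omega> y) (escape m) = (\<Sum>t. emeasure (quenched \<omega> y) {X. ?N t X})" for \<omega>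
  proof -
    have "emeasure (quenched \<omega> y) (escape m) = emeasure (quenched \<omega> y) (\<Union>t. {X. ?N t X})"
      using quenched_start[where \<omega> = \<omega> and x = y] adapted_sets[OF ad]
      by (intro emeasure_eq_AE) (auto simp: eq[symmetric])
    also have "\<dots> = (\<Sum>t. emeasure (quenched \<omega> y) {X. ?N t X})"
      using disj adapted_sets[OF ad] by (intro suminf_emeasure[symmetric]) auto
    finally show ?thesis .
  qed
  moreover have "emeasure (quenched \<omega> y) {X. ?N t X} = emeasure (quenched \<omega>' y) {X. ?N t X}" for t
    using assms by (intro quenched_local_adapted[OF ad, where A = "{y..<y + int m}"]) (auto simp: le_less)
  ultimately show ?thesis by simp
qed

lemma (in iid_environment) law_centered_event:
  assumes "B \<in> sets path_space" "\<And>X. X \<in> B \<longleftrightarrow> (\<lambda>i. X i - y) \<in> B"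
  shows "emeasure (law y) B = emeasure (law 0) B"
proof -
  have "{X. (\<lambda>i. X i - y) \<in> B} = B" using assms(2) by blast
  then show ?thesis using law_translate[OF assms(1), of y y] by simp
qed

lemma (in iid_environment) law_escape: "emeasure (law y) (escape m) = emeasure (law 0) (escape m)"
  by (rule law_centered_event[OF escape_sets]) (simp add: escape_def algebra_simps)

section \<open>Blocks of width \<open>w\<close> and early escapes from them\<close>

definition block :: "int \<Rightarrow> nat \<Rightarrow> int set" where
  "block w k = {(int k - 1) * w<..int k * w}"

text \<open>From one of its first \<open>C\<close> visits to some site of block \<open>k\<close>, made before the walk has come
  within reach of later blocks, the walk escapes by \<open>m\<close> to the right; seen by time \<open>n\<close>.\<close>

definition early_escape :: "int \<Rightarrow> nat \<Rightarrow> nat \<Rightarrow> nat \<Rightarrow> nat \<Rightarrow> path \<Rightarrow> bool" where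
  "early_escape w C m k n X \<longleftrightarrow> (\<exists>r t. r < t \<and> t \<le> n \<and> X r \<in> block w k \<and>
     (\<forall>s<r. X s < int k * w + int m) \<and> card {s. s < r \<and> X s = X r} < C \<and>
     X r + int m \<le> X t \<and> (\<forall>s. r < s \<and> s < t \<longrightarrow> X r < X s))"

lemma adapted_early_escape: "adapted n (early_escape w C m k n)"
  unfolding adapted_def
proof (intro allI impI)
  fix X Y :: path assume eq: "\<forall>i\<le>n. X i = Y i" and "early_escape w C m k n X"
  then obtain r t where rt: "r < t" "t \<le> n" "X r \<in> block w k"
     "\<forall>s<r. X s < int k * w + int m" "card {s. s < r \<and> X s = X r} < C"
     "X r + int m \<le> X t" "\<forall>s. r < s \<and> s < t \<longrightarrow> X r < X s"
    unfolding early_escape_def by blast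
  have "{s. s < r \<and> Y s = Y r} = {s. s < r \<and> X s = X r}"
    using eq rt(1,2) by auto
  with eq rt show "early_escape w C m k n Y"
    unfolding early_escape_def by (intro exI[of _ r] exI[of _ t]) auto
qed

lemma early_escape_pred [measurable]: "Measurable.pred path_space (early_escape w C m k n)"
  by (rule adapted_imp_pred[OF adapted_early_escape])

abbreviation escapes_early :: "int \<Rightarrow> nat \<Rightarrow> nat \<Rightarrow> nat \<Rightarrow> path \<Rightarrow> bool" where
  "escapes_early w C m k X \<equiv> \<exists>n. early_escape w C m k n X"

text \<open>Blocks are sampled along a residue class modulo \<open>m + 1\<close>, because escapes
  from blocks that far apart involve disjoint stretches of the environment.\<close>

abbreviation crowded :: "int \<Rightarrow> nat \<Rightarrow> nat \<Rightarrow> nat \<Rightarrow> nat \<Rightarrow> path \<Rightarrow> bool" where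
  "crowded w C m N r X \<equiv> N \<le> 2 * card {j \<in> {..<N}. escapes_early w C m (r + (m + 1) * j) X}"

text \<open>An escape by \<open>m\<close> from block \<open>k\<close> uses only sites below
  \<open>k w + m\<close>; the condition puts these before every later block of the family.\<close>

definition spaced :: "int \<Rightarrow> nat \<Rightarrow> nat set \<Rightarrow> bool" where
  "spaced w m J \<longleftrightarrow> (\<forall>k\<in>J. \<forall>k'\<in>J. k < k' \<longrightarrow> int k * w + int m \<le> (int k' - 1) * w)"

text \<open>Standing in block \<open>k'\<close> means having passed \<open>k w + m\<close>. By
  definition the early escape starts before any such passage, and if it is not completed by time
  \<open>n\<close>, the high position \<open>X n\<close> completes it. So the fate of the lower
  block is known at time \<open>n\<close>.\<close>

lemma early_escape_before:
  assumes "early_escape w C m k n' X" and Xn: "X n \<in> block w k'"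
    and sp: "int k * w + int m \<le> (int k' - 1) * w"
  shows "early_escape w C m k n X"
proof -
  obtain r t where rt: "r < t" "t \<le> n'" "X r \<in> block w k"
     "\<forall>s<r. X s < int k * w + int m" "card {s. s < r \<and> X s = X r} < C"
     "X r + int m \<le> X t" "\<forall>s. r < s \<and> s < t \<longrightarrow> X r < X s"
    using assms(1) unfolding early_escape_def by blast
  have big: "int k * w + int m < X n"
    using Xn sp by (auto simp: block_def)
  have Xr: "X r \<le> int k * w" using rt(3) by (auto simp: block_def)
  have "r \<le> n" using rt(4) big by (meson less_asym not_le)
  moreover have "r \<noteq> n" using Xr big by auto
  ultimately have "r < n" by simp
  show ?thesis
  proof (cases "t \<le> n")
    case True
    with rt show ?thesis unfolding early_escape_def by blast
  next
    case False
    with rt \<open>r < n\<close> big Xr show ?thesis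
      unfolding early_escape_def by (intro exI[of _ r] exI[of _ n]) auto
  qed
qed

text \<open>Strict growth of the visit count makes the time of a visit with a given number unique,
  as the strong Markov bound requires.\<close>

lemma card_visits_less:
  assumes "X n = y" "n < (n' :: nat)"
  shows "card {s. s < n \<and> X s = y} < card {s. s < n' \<and> X s = y}"
proof (rule psubset_card_mono)
  show "{s. s < n \<and> X s = y} \<subset> {s. s < n' \<and> X s = y}"
    using assms by (auto simp: psubset_eq) 
qed auto

text \<open>The largest block is split off. An early escape from it starts at one of the first
  \<open>C\<close> visits to one of its sites \<open>y\<close>. At that time the events of the
  smaller blocks are already decided, so the strong Markov bound contributes the escape probability
  from \<open>y\<close>, and a union bound over \<open>y\<close> and the visit number gives the sum
  times \<open>C\<close>.\<close>

lemma quenched_early_escapes: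
  assumes "finite J" "spaced w m J"
  shows "emeasure (quenched \<omega> x) {X. \<forall>k\<in>J. escapes_early w C m k X} \<le>
    (\<Prod>k\<in>J. of_nat C * (\<Sum>y\<in>block w k. emeasure (quenched \<omega> y) (escape m)))"
  using assms
proof (induction J rule: finite_linorder_max_induct)
  case empty
  show ?case by (simp add: quenched_le_1)
next
  case (insert b J)
  let ?P = "quenched \<omega> x"
  let ?E = "{X. \<forall>k\<in>J. escapes_early w C m k X}"
  \<comment> \<open>The number \<open>i\<close> counts the visits before time \<open>n\<close>, so
    the first \<open>C\<close> visits correspond to \<open>i < C\<close>.\<close>
  let ?N = "\<lambda>y i n X. X n = y \<and> card {s. s < n \<and> X s = y} = i \<and> (\<forall>k\<in>J. early_escape w C m k n X)"
  let ?F = "\<lambda>(y, i). {X. \<exists>n. ?N y i n X \<and> shift n X \<in> escape m}"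
  have sE [measurable]: "?E \<in> sets path_space"
    by (rule path_setsI) (use insert.hyps(1) in measurable)
  have ad: "adapted n (?N y i n)" for y i n
    unfolding adapted_def
  proof (intro allI impI)
    fix X Y :: path assume eq: "\<forall>i\<le>n. X i = Y i" and N: "?N y i n X"
    have "{s. s < n \<and> Y s = y} = {s. s < n \<and> X s = y}"
      using eq by auto
    moreover have "early_escape w C m k n X = early_escape w C m k n Y" for k
      using eq by (intro adapted_cong[OF adapted_early_escape]) auto
    ultimately show "?N y i n Y" using N eq by auto
  qed
  have sF: "?F q \<in> sets path_space" for q
  proof -
    obtain y i where q: "q = (y, i)" by (cases q)
    have "{X. ?N y i n X \<and> shift n X \<in> escape m} \<in> sets path_space" for n
      by (rule adapted_shift_sets[OF ad]) simp
    moreover have "?F q = (\<Union>n. {X. ?N y i n X \<and> shift n X \<in> escape m})" by (auto simp: q)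
    ultimately show ?thesis
      by (simp only:) (intro sets.countable_UN image_subsetI)
  qed
  have F: "emeasure ?P (?F (y, i)) \<le> emeasure (quenched \<omega> y) (escape m) * emeasure ?P ?E" for y i
  proof -
    have "emeasure ?P {X. \<exists>n. ?N y i n X \<and> shift n X \<in> escape m} \<le>
      emeasure (quenched \<omega> y) (escape m) * emeasure ?P {X. \<exists>n. ?N y i n X}"
    proof (rule quenched_strong_markov_le[OF ad])
      show "n = n'" if "?N y i n X" "?N y i n' X" for n n' :: nat and X
        using that card_visits_less[of X n y n'] card_visits_less[of X n' y n]
        by (cases n n' rule: linorder_cases) auto
    qed auto
    also have "emeasure ?P {X. \<exists>n. ?N y i n X} \<le> emeasure ?P ?E"
      by (intro emeasure_mono) (use sE in auto)
    finally show ?thesis by (simp add: mult_left_mono)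
  qed
  have fin: "finite (block w k)" for k by (simp add: block_def)
  have "{X. \<forall>k\<in>insert b J. escapes_early w C m k X} \<subseteq> (\<Union>q\<in>block w b \<times> {..<C}. ?F q)"
  proof
    fix X assume X: "X \<in> {X. \<forall>k\<in>insert b J. escapes_early w C m k X}"
    then obtain n where "early_escape w C m b n X" by auto
    then obtain r t where rt: "r < t" "X r \<in> block w b" "card {s. s < r \<and> X s = X r} < C"
        "X r + int m \<le> X t" "\<forall>s. r < s \<and> s < t \<longrightarrow> X r < X s"
      unfolding early_escape_def by blast
    have "early_escape w C m k r X" if "k \<in> J" for k
    proof -
      from X that obtain n' where n': "early_escape w C m k n' X" by auto
      have "int k * w + int m \<le> (int b - 1) * w"
        using insert.prems insert.hyps(2) that unfolding spaced_def by blast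
      with n' rt(2) show ?thesis by (rule early_escape_before)
    qed
    moreover have "shift r X \<in> escape m"
      unfolding escape_def using rt by (auto intro!: exI[of _ "t - r"])
    ultimately have "X \<in> ?F (X r, card {s. s < r \<and> X s = X r})" by auto
    with rt show "X \<in> (\<Union>q\<in>block w b \<times> {..<C}. ?F q)"
      by (intro UN_I[of "(X r, card {s. s < r \<and> X s = X r})"]) auto
  qed
  moreover have "(\<Union>q\<in>block w b \<times> {..<C}. ?F q) \<in> sets ?P"
    unfolding sets_quenched by (rule sets.finite_UN[OF finite_cartesian_product[OF fin finite_lessThan] sF])
  ultimately have "emeasure ?P {X. \<forall>k\<in>insert b J. escapes_early w C m k X} \<le>
      emeasure ?P (\<Union>q\<in>block w b \<times> {..<C}. ?F q)"
    by (rule emeasure_mono)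
  also have "\<dots> \<le> (\<Sum>q\<in>block w b \<times> {..<C}. emeasure ?P (?F q))"
    using fin sF by (intro emeasure_subadditive_finite) auto
  also have "\<dots> \<le> (\<Sum>q\<in>block w b \<times> {..<C}. emeasure (quenched \<omega> (fst q)) (escape m) * emeasure ?P ?E)"
    by (intro sum_mono) (use F in auto)
  also have "\<dots> = (\<Sum>y\<in>block w b. \<Sum>i<C. emeasure (quenched \<omega> y) (escape m) * emeasure ?P ?E)"
    by (simp only: sum.cartesian_product split_def)
  also have "\<dots> = (of_nat C * (\<Sum>y\<in>block w b. emeasure (quenched \<omega> y) (escape m))) * emeasure ?P ?E"
    by (simp add: sum_distrib_left[symmetric] sum_distrib_right[symmetric] mult.assoc)
  also have "\<dots> \<le> (of_nat C * (\<Sum>y\<in>block w b. emeasure (quenched \<omega> y) (escape m))) *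
      (\<Prod>k\<in>J. of_nat C * (\<Sum>y\<in>block w k. emeasure (quenched \<omega> y) (escape m)))"
    using insert.prems by (intro mult_left_mono insert.IH) (auto simp: spaced_def)
  also have "\<dots> = (\<Prod>k\<in>insert b J. of_nat C * (\<Sum>y\<in>block w k. emeasure (quenched \<omega> y) (escape m)))"
    using insert.hyps by (subst prod.insert) auto
  finally show ?case .
qed

text \<open>The quenched factors depend on disjoint stretches of sites, one for each block of the
  spaced family, so their means multiply. By stationarity all \<open>w\<close> sites of a block
  contribute the same.\<close>

lemma (in iid_environment) law_early_escapes:
  assumes "finite J" "spaced w m J"
  shows "emeasure (law x) {X. \<forall>k\<in>J. escapes_early w C m k X} \<le>
    (of_nat C * of_nat (nat w) * emeasure (law 0) (escape m)) ^ card J"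
proof -
  have sE: "{X. \<forall>k\<in>J. escapes_early w C m k X} \<in> sets path_space"
    by (rule path_setsI) (use assms(1) in measurable)
  let ?f = "\<lambda>k \<omega>. of_nat C * (\<Sum>y\<in>block w k. emeasure (quenched \<omega> y) (escape m)) :: ennreal"
  have "emeasure (law x) {X. \<forall>k\<in>J. escapes_early w C m k X} \<le> (\<integral>\<^sup>+\<omega>. (\<Prod>k\<in>J. ?f k \<omega>) \<partial>env)"
    unfolding emeasure_law[OF sE]
    by (intro nn_integral_mono quenched_early_escapes assms)
  also have "\<dots> = (\<Prod>k\<in>J. \<integral>\<^sup>+\<omega>. ?f k \<omega> \<partial>env)"
  proof (rule nn_integral_env_prod[where K = "\<lambda>k. {(int k - 1) * w<..<int k * w + int m}"])
    have "{(int k - 1) * w<..<int k * w + int m} \<inter> {(int k' - 1) * w<..<int k' * w + int m} = {}"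
      if "k \<in> J" "k' \<in> J" "k < k'" for k k'
    proof -
      have "int k * w + int m \<le> (int k' - 1) * w"
        using assms(2) that unfolding spaced_def by blast
      then show ?thesis by auto
    qed
    then show "disjoint_family_on (\<lambda>k. {(int k - 1) * w<..<int k * w + int m}) J"
      unfolding disjoint_family_on_def by (metis Int_commute linorder_neqE_nat)
    show "?f k \<omega> = ?f k \<omega>'"
      if eq: "\<And>a. a \<in> {(int k - 1) * w<..<int k * w + int m} \<Longrightarrow> \<omega> a = \<omega>' a" for k \<omega> \<omega>'
    proof -
      have "emeasure (quenched \<omega> y) (escape m) = emeasure (quenched \<omega>' y) (escape m)" if y: "y \<in> block w k" for y
        by (rule quenched_escape_local, rule eq) (use y in \<open>auto simp: block_def\<close>)
      then show ?thesis by (intro arg_cong2[where f = "(*)"] sum.cong refl)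
    qed
  qed (use assms in measurable)
  also have "\<dots> = (\<Prod>k\<in>J. of_nat C * of_nat (nat w) * emeasure (law 0) (escape m))"
  proof (intro prod.cong refl)
    fix k
    have "(\<integral>\<^sup>+\<omega>. ?f k \<omega> \<partial>env) = of_nat C * (\<Sum>y\<in>block w k. \<integral>\<^sup>+\<omega>. emeasure (quenched \<omega> y) (escape m) \<partial>env)"
      by (subst nn_integral_cmult, measurable, subst nn_integral_sum, measurable)
    also have "(\<Sum>y\<in>block w k. \<integral>\<^sup>+\<omega>. emeasure (quenched \<omega> y) (escape m) \<partial>env) =
       (\<Sum>y\<in>block w k. emeasure (law 0) (escape m))"
      by (intro sum.cong refl) (simp only: emeasure_law[OF escape_sets, symmetric], rule law_escape)
    also have "\<dots> = of_nat (card (block w k)) * emeasure (law 0) (escape m)" by simp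
    also have "card (block w k) = nat w"
      by (simp add: block_def algebra_simps)
    finally show "(\<integral>\<^sup>+\<omega>. ?f k \<omega> \<partial>env) = of_nat C * of_nat (nat w) * emeasure (law 0) (escape m)"
      by (simp add: mult.assoc)
  qed
  finally show ?thesis by simp
qed


text \<open>Follow the walk to its first time at or above \<open>k w + m\<close> and go back to its
  last visit at or below \<open>k w\<close>. The jump bound puts that visit in block
  \<open>k\<close>, and from there the walk escapes. If the escape is not early, its site has been
  visited at least \<open>C\<close> times before. Visits to different blocks happen at different
  times, so all of them fit into \<open>T\<close> steps.\<close>

lemma early_escape_count:
  fixes X :: path
  assumes X0: "X 0 \<le> 0" and jump: "\<And>n. \<bar>X (Suc n) - X n\<bar> \<le> w" and w: "w \<ge> 1" and m: "m \<ge> 1"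
    and T: "int K * w + int m \<le> X T"
  shows "C * card {k \<in> {1..K}. \<not> (escapes_early w C m k X)} \<le> T"
proof -
  let ?V = "\<lambda>k. {s. s < T \<and> X s \<in> block w k}"
  let ?I = "{k \<in> {1..K}. \<not> (escapes_early w C m k X)}"
  have "C \<le> card (?V k)" if k: "k \<in> ?I" for k
  proof -
    have ex: "int k * w + int m \<le> X T"
    proof -
      have "int k * w \<le> int K * w" using k w by (intro mult_right_mono) auto
      with T show ?thesis by linarith
    qed
    define t where "t = (LEAST t. int k * w + int m \<le> X t)"
    have t: "int k * w + int m \<le> X t"
      unfolding t_def using ex by (rule LeastI)
    have tT: "t \<le> T" unfolding t_def using ex by (rule Least_le)
    have lt: "X s < int k * w + int m" if "s < t" for s
      using not_less_Least[of s "\<lambda>t. int k * w + int m \<le> X t"] that by (auto simp: t_def)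
    have pos: "0 \<le> int k * w" using w by simp
    define r where "r = (GREATEST s. s \<le> t \<and> X s \<le> int k * w)"
    have "0 \<le> t \<and> X 0 \<le> int k * w" using X0 pos by auto
    then have r: "r \<le> t \<and> X r \<le> int k * w"
      unfolding r_def by (rule GreatestI_nat[where b = t]) auto
    have after: "int k * w < X s" if "r < s" "s \<le> t" for s
    proof (rule ccontr)
      assume "\<not> int k * w < X s"
      with that have "s \<le> r" unfolding r_def by (intro Greatest_le_nat[where b = t]) auto
      with that show False by simp
    qed
    have "r \<noteq> t" using r t m by auto
    with r have rt: "r < t" by simp
    have Xr: "X r \<in> block w k"
      using after[of "Suc r"] jump[of r] rt r by (auto simp: block_def algebra_simps)
    have mid: "X r < X s" if "r < s" "s < t" for s
      using after[of s] that r by simp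
    have "X r + int m \<le> X t" using r t by linarith
    then have "early_escape w C m k t X" if "card {s. s < r \<and> X s = X r} < C"
      unfolding early_escape_def using that rt lt Xr mid by (intro exI[of _ r] exI[of _ t]) auto
    then have "\<not> card {s. s < r \<and> X s = X r} < C"
      using k by blast
    moreover have "card {s. s < r \<and> X s = X r} \<le> card (?V k)"
      using Xr rt tT by (intro card_mono) auto
    ultimately show ?thesis by simp
  qed
  then have "(\<Sum>k\<in>?I. C) \<le> (\<Sum>k\<in>?I. card (?V k))"
    by (rule sum_mono)
  also have "\<dots> = card (\<Union>k\<in>?I. ?V k)"
  proof (rule card_UN_disjoint[symmetric])
    have "block w i \<inter> block w j = {}" if "i < j" for i j
    proof -
      have "int i * w \<le> (int j - 1) * w" using that w by (intro mult_right_mono) auto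
      then show ?thesis by (auto simp: block_def)
    qed
    then have "block w i \<inter> block w j = {}" if "i \<noteq> j" for i j
      using that by (metis Int_commute linorder_neqE_nat)
    then show "\<forall>i\<in>?I. \<forall>j\<in>?I. i \<noteq> j \<longrightarrow> ?V i \<inter> ?V j = {}" by blast
  qed auto
  also have "\<dots> \<le> card {..<T}" by (rule card_mono) auto
  finally show ?thesis by (simp add: mult.commute)
qed

section \<open>Upper speed zero in the absence of escape\<close>

locale bounded_environment = iid_environment +
  fixes w :: int
  assumes w: "w \<ge> 1" and bounded_jumps: "AE \<mu> in M. \<forall>j. \<bar>j\<bar> > w \<longrightarrow> pmf \<mu> j = 0"
begin

lemma AE_env_bounded: "AE \<omega> in env. \<forall>a b. \<bar>b - a\<bar> > w \<longrightarrow> transition \<omega> a b = 0"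
proof -
  have "AE \<omega> in env. \<forall>j. \<bar>j\<bar> > w \<longrightarrow> pmf (\<omega> a) j = 0" for a
    unfolding env_def by (rule AE_PiM_component) (auto intro: prob_space_axioms bounded_jumps)
  then have "AE \<omega> in env. \<forall>a. \<forall>j. \<bar>j\<bar> > w \<longrightarrow> pmf (\<omega> a) j = 0"
    by (rule AE_all_countable[THEN iffD2, rule_format])
  then show ?thesis by eventually_elim (simp add: transition_def)
qed

lemma jump_pred [measurable]: "Measurable.pred path_space (\<lambda>X. \<forall>n. \<bar>X (Suc n) - X n\<bar> \<le> w)"
proof -
  have [measurable]: "Measurable.pred path_space (\<lambda>X. \<bar>X (Suc n) - X n\<bar> \<le> w)" for n
    by (rule adapted_imp_pred[of "Suc n"]) (simp add: adapted_def)
  show ?thesis by measurable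
qed

lemma AE_law_jumps: "AE X in law x. \<forall>n. \<bar>X (Suc n) - X n\<bar> \<le> w"
  unfolding AE_law[OF jump_pred]
  using AE_env_bounded by eventually_elim (intro quenched_bounded_jumps, auto)

lemma AE_law_start: "AE X in law x. X 0 = x"
  by (subst AE_law) (auto simp: quenched_start)

text \<open>The events \<open>escape m\<close> decrease to a subset of \<open>stay_right\<close>, so
  continuity from above applies.\<close>

lemma escape_prob_small:
  assumes "emeasure (law 0) stay_right = 0" "\<epsilon> > 0"
  shows "\<exists>m. emeasure (law 0) (escape m) < \<epsilon>"
proof -
  interpret L: prob_space "law 0" by (rule prob_space_law)
  have "(INF m. emeasure (law 0) (escape m)) = emeasure (law 0) (\<Inter>m. escape m)"
    by (rule INF_emeasure_decseq) (auto simp: decseq_escape)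
  also have "\<dots> \<le> emeasure (law 0) stay_right"
    by (rule emeasure_mono[OF Inter_escape_subset]) simp
  finally have "(INF m. emeasure (law 0) (escape m)) < \<epsilon>"
    using assms by simp
  then show ?thesis by (auto simp: INF_less_iff)
qed

text \<open>A union bound over m + 1 residues and at most 2^N sets of at least N/2 indices. Each
  choice has probability at most (1/16)^(N/2) = (1/4)^N, which leaves (m + 1) 2^N 4^(-N). The
  constant 1/16 is what beats the number of subsets.\<close>

lemma law_many_early_escapes:
  assumes small: "of_nat C * of_nat (nat w) * emeasure (law 0) (escape m) \<le> ennreal (1 / 16)"
  shows "emeasure (law x) {X. \<exists>r\<in>{1..m + 1}. crowded w C m N r X} \<le>
    ennreal (real (m + 1) * (1 / 2) ^ N)"
proof -
  let ?k = "\<lambda>r j. r + (m + 1) * j"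
  let ?\<J> = "{J. J \<subseteq> {..<N} \<and> N \<le> 2 * card J}"
  let ?E = "\<lambda>(r, J). {X. \<forall>k\<in>?k r ` J. escapes_early w C m k X}"
  have sE: "?E q \<in> sets path_space" if "q \<in> {1..m + 1} \<times> ?\<J>" for q
  proof -
    obtain r J where q: "q = (r, J)" by (cases q)
    with that have "finite (?k r ` J)" by (auto intro: finite_subset)
    have "?E q = {X \<in> space path_space. \<forall>k\<in>?k r ` J. escapes_early w C m k X}" by (simp add: q)
    also have "\<dots> \<in> sets path_space" using \<open>finite (?k r ` J)\<close> by measurable
    finally show ?thesis .
  qed
  have pE: "emeasure (law x) (?E q) \<le> ennreal ((1 / 4) ^ N)" if q: "q \<in> {1..m + 1} \<times> ?\<J>" for q
  proof -
    obtain r J where q': "q = (r, J)" by (cases q)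
    have J: "J \<subseteq> {..<N}" "N \<le> 2 * card J" "finite J" using q q' by (auto intro: finite_subset)
    have inj: "inj_on (?k r) J"
    proof (rule inj_onI)
      fix i j assume "?k r i = ?k r j"
      then have "(m + 1) * i = (m + 1) * j" by (rule add_left_imp_eq)
      then show "i = j" by (simp only: mult_cancel1) simp
    qed
    have "spaced w m (?k r ` J)"
      unfolding spaced_def
    proof (intro ballI impI)
      fix k k' assume "k \<in> ?k r ` J" "k' \<in> ?k r ` J" "k < k'"
      then obtain j j' where jj: "k = ?k r j" "k' = ?k r j'" by auto
      with \<open>k < k'\<close> have "(m + 1) * j < (m + 1) * j'" by linarith
      then have "Suc j \<le> j'" by (simp only: mult_less_cancel1) simp
      then have "(m + 1) * Suc j \<le> (m + 1) * j'" by (rule mult_le_mono2)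
      then have "k + (m + 1) \<le> k'" unfolding jj by simp
      then have le: "int k + int m \<le> int k' - 1" by linarith
      \<comment> \<open>Since w \<ge> 1, a gap of \<open>m\<close> blocks covers the length
        \<open>m\<close> of an escape. The one further index is there because block
        \<open>k'\<close> begins at \<open>(k' - 1) w\<close>.\<close>
      have "int m * 1 \<le> int m * w" using w by (intro mult_left_mono) auto
      then have "int k * w + int m \<le> (int k + int m) * w" by (simp add: algebra_simps)
      also have "\<dots> \<le> (int k' - 1) * w" using le w by (intro mult_right_mono) auto
      finally show "int k * w + int m \<le> (int k' - 1) * w" .
    qed
    then have "emeasure (law x) (?E q) \<le> (of_nat C * of_nat (nat w) * emeasure (law 0) (escape m)) ^ card (?k r ` J)"
      unfolding q' prod.case using J by (intro law_early_escapes) auto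
    also have "\<dots> \<le> ennreal (1 / 16) ^ card J"
      unfolding card_image[OF inj] by (intro power_mono small) auto
    also have "\<dots> = ennreal ((1 / 4) ^ (2 * card J))"
      by (simp add: ennreal_power power_mult power2_eq_square)
    also have "\<dots> \<le> ennreal ((1 / 4) ^ N)"
      using J by (intro ennreal_leI power_decreasing) auto
    finally show ?thesis .
  qed
  have fin: "finite ({1..m + 1} \<times> ?\<J>)" by auto
  have "emeasure (law x) {X. \<exists>r\<in>{1..m + 1}. crowded w C m N r X}
      \<le> emeasure (law x) (\<Union>q\<in>{1..m + 1} \<times> ?\<J>. ?E q)"
  proof (rule emeasure_mono)
    show "{X. \<exists>r\<in>{1..m + 1}. crowded w C m N r X} \<subseteq>
      (\<Union>q\<in>{1..m + 1} \<times> ?\<J>. ?E q)"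
    proof
      fix X assume "X \<in> {X. \<exists>r\<in>{1..m + 1}. crowded w C m N r X}"
      then obtain r where r: "r \<in> {1..m + 1}" "crowded w C m N r X"
        by blast
      then show "X \<in> (\<Union>q\<in>{1..m + 1} \<times> ?\<J>. ?E q)"
        by (intro UN_I[of "(r, {j \<in> {..<N}. escapes_early w C m (?k r j) X})"]) auto
    qed
    show "(\<Union>q\<in>{1..m + 1} \<times> ?\<J>. ?E q) \<in> sets (law x)"
      unfolding sets_law using fin sE by (rule sets.finite_UN)
  qed
  also have "\<dots> \<le> (\<Sum>q\<in>{1..m + 1} \<times> ?\<J>. emeasure (law x) (?E q))"
    using fin by (rule emeasure_subadditive_finite) (use sE in auto)
  also have "\<dots> \<le> (\<Sum>q\<in>{1..m + 1} \<times> ?\<J>. ennreal ((1 / 4) ^ N))"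
    by (rule sum_mono) (rule pE)
  also have "\<dots> = of_nat (card ({1..m + 1} \<times> ?\<J>)) * ennreal ((1 / 4) ^ N)"
    by (rule sum_constant)
  also have "\<dots> \<le> of_nat ((m + 1) * 2 ^ N) * ennreal ((1 / 4) ^ N)"
  proof (intro mult_right_mono)
    have "card ?\<J> \<le> card (Pow {..<N})" by (intro card_mono) auto
    then have "(m + 1) * card ?\<J> \<le> (m + 1) * 2 ^ N"
      by (intro mult_le_mono2) (simp add: card_Pow)
    then have "card ({1..m + 1} \<times> ?\<J>) \<le> (m + 1) * 2 ^ N"
      by (simp add: card_cartesian_product)
    then show "(of_nat (card ({1..m + 1} \<times> ?\<J>)) :: ennreal) \<le> of_nat ((m + 1) * 2 ^ N)"
      by (rule of_nat_mono)
  qed simp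
  also have "\<dots> = ennreal (real ((m + 1) * 2 ^ N) * (1 / 4) ^ N)"
    by (simp add: ennreal_mult' ennreal_of_nat_eq_real_of_nat)
  also have "real ((m + 1) * 2 ^ N) * (1 / 4) ^ N = real (m + 1) * (1 / 2) ^ N"
  proof -
    have "real ((m + 1) * 2 ^ N) * (1 / 4) ^ N = real (m + 1) * (2 * (1 / 4)) ^ N"
      by (simp only: of_nat_mult of_nat_power power_mult_distrib mult.assoc of_nat_numeral)
    then show ?thesis by simp
  qed
  finally show ?thesis .
qed

text \<open>Counting is replaced by a choice of the exact set \<open>J\<close> of early escapes,
  which turns the event into a finite combination of measurable ones.\<close>

lemma many_early_escapes_sets:
  "{X. \<exists>r\<in>{1..m + 1}. crowded w C m N r X} \<in> sets path_space"
proof -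
  have eq: "crowded w C m N r X \<longleftrightarrow>
    (\<exists>J\<in>{J. J \<subseteq> {..<N} \<and> N \<le> 2 * card J}.
      \<forall>j\<in>{..<N}. j \<in> J \<longleftrightarrow> (escapes_early w C m (r + (m + 1) * j) X))" for X r
  proof
    assume "crowded w C m N r X"
    then show "\<exists>J\<in>{J. J \<subseteq> {..<N} \<and> N \<le> 2 * card J}.
      \<forall>j\<in>{..<N}. j \<in> J \<longleftrightarrow> (escapes_early w C m (r + (m + 1) * j) X)"
      by (intro bexI[of _ "{j \<in> {..<N}. escapes_early w C m (r + (m + 1) * j) X}"]) auto
  next
    assume "\<exists>J\<in>{J. J \<subseteq> {..<N} \<and> N \<le> 2 * card J}.
      \<forall>j\<in>{..<N}. j \<in> J \<longleftrightarrow> (escapes_early w C m (r + (m + 1) * j) X)"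
    then obtain J where J: "J \<subseteq> {..<N}" "N \<le> 2 * card J"
      "\<forall>j\<in>{..<N}. j \<in> J \<longleftrightarrow> (escapes_early w C m (r + (m + 1) * j) X)" by blast
    then have "J = {j \<in> {..<N}. escapes_early w C m (r + (m + 1) * j) X}" by blast
    with J show "crowded w C m N r X" by simp
  qed
  have "{X. \<exists>r\<in>{1..m + 1}. crowded w C m N r X} =
    {X \<in> space path_space. \<exists>r\<in>{1..m + 1}. \<exists>J\<in>{J. J \<subseteq> {..<N} \<and> N \<le> 2 * card J}.
      \<forall>j\<in>{..<N}. j \<in> J \<longleftrightarrow> (escapes_early w C m (r + (m + 1) * j) X)}"
    by (simp only: eq space_path_space UNIV_I simp_thms)
  also have "\<dots> \<in> sets path_space" by measurable
  finally show ?thesis .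
qed

text \<open>Adding up the residue classes, at most half of the first (m + 1) N blocks escape early;
  each of the others costs \<open>C\<close> units of time.\<close>

lemma late_arrival:
  fixes X :: path
  assumes X0: "X 0 = 0" and jump: "\<And>n. \<bar>X (Suc n) - X n\<bar> \<le> w" and m: "m \<ge> 1"
    and few: "\<And>r. r \<in> {1..m + 1} \<Longrightarrow>
      2 * card {j \<in> {..<N}. escapes_early w C m (r + (m + 1) * j) X} < N"
    and T: "int ((m + 1) * N) * w + int m \<le> X T"
  shows "C * ((m + 1) * N) \<le> 2 * T"
proof -
  let ?B = "\<lambda>k. escapes_early w C m k X"
  let ?K = "(m + 1) * N"
  have "{k \<in> {1..?K}. ?B k} \<subseteq> (\<Union>r\<in>{1..m + 1}. (\<lambda>j. r + (m + 1) * j) ` {j \<in> {..<N}. ?B (r + (m + 1) * j)})"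
  proof
    fix k assume k: "k \<in> {k \<in> {1..?K}. ?B k}"
    \<comment> \<open>Blocks are numbered from 1, hence the shift by one before the division and the
      residues in \<open>{1..m + 1}\<close>.\<close>
    define j r where "j = (k - 1) div (m + 1)" and "r = (k - 1) mod (m + 1) + 1"
    have "(k - 1) mod (m + 1) + (m + 1) * ((k - 1) div (m + 1)) = k - 1" by (rule mod_mult_div_eq)
    then have kr: "k = r + (m + 1) * j" using k unfolding j_def r_def by simp
    have "(k - 1) mod (m + 1) < m + 1" by simp
    then have r: "r \<in> {1..m + 1}" unfolding r_def by simp
    have "1 \<le> k" "k \<le> (m + 1) * N" using k by simp_all
    moreover have "(m + 1) * N = N * (m + 1)" by (rule mult.commute)
    ultimately have "k - 1 < N * (m + 1)" by linarith
    then have "j < N" unfolding j_def by (rule less_mult_imp_div_less)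
    with k r show "k \<in> (\<Union>r\<in>{1..m + 1}. (\<lambda>j. r + (m + 1) * j) ` {j \<in> {..<N}. ?B (r + (m + 1) * j)})"
    proof (intro UN_I[of r] image_eqI[of _ _ j])
      show "j \<in> {j \<in> {..<N}. ?B (r + (m + 1) * j)}"
        using \<open>j < N\<close> k by (simp only: kr[symmetric] mem_Collect_eq lessThan_iff simp_thms)
    qed (simp_all only: kr)
  qed
  then have "card {k \<in> {1..?K}. ?B k} \<le> card (\<Union>r\<in>{1..m + 1}. (\<lambda>j. r + (m + 1) * j) ` {j \<in> {..<N}. ?B (r + (m + 1) * j)})"
    by (intro card_mono) auto
  also have "\<dots> \<le> (\<Sum>r\<in>{1..m + 1}. card ((\<lambda>j. r + (m + 1) * j) ` {j \<in> {..<N}. ?B (r + (m + 1) * j)}))"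
    by (rule card_UN_le) simp
  also have "\<dots> \<le> (\<Sum>r\<in>{1..m + 1}. card {j \<in> {..<N}. ?B (r + (m + 1) * j)})"
    by (intro sum_mono card_image_le) simp
  finally have "2 * card {k \<in> {1..?K}. ?B k} \<le> 2 * (\<Sum>r\<in>{1..m + 1}. card {j \<in> {..<N}. ?B (r + (m + 1) * j)})"
    by (rule mult_le_mono2)
  also have "\<dots> = (\<Sum>r\<in>{1..m + 1}. 2 * card {j \<in> {..<N}. ?B (r + (m + 1) * j)})"
    by (rule sum_distrib_left)
  also have "\<dots> \<le> (\<Sum>r\<in>{1..m + 1}. N)"
    by (intro sum_mono less_imp_le few)
  finally have "2 * card {k \<in> {1..?K}. ?B k} \<le> ?K" by simp
  moreover have "card {k \<in> {1..?K}. ?B k} + card {k \<in> {1..?K}. \<not> ?B k} = ?K"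
  proof -
    have "card {k \<in> {1..?K}. ?B k} + card {k \<in> {1..?K}. \<not> ?B k} =
        card ({k \<in> {1..?K}. ?B k} \<union> {k \<in> {1..?K}. \<not> ?B k})"
      by (rule card_Un_disjoint[symmetric]) auto
    also have "{k \<in> {1..?K}. ?B k} \<union> {k \<in> {1..?K}. \<not> ?B k} = {1..?K}" by blast
    finally show ?thesis by simp
  qed
  ultimately have "?K \<le> 2 * card {k \<in> {1..?K}. \<not> ?B k}" by linarith
  then have "C * ?K \<le> C * (2 * card {k \<in> {1..?K}. \<not> ?B k})" by (rule mult_le_mono2)
  also have "\<dots> = 2 * (C * card {k \<in> {1..?K}. \<not> ?B k})" by (simp only: mult.left_commute)
  also have "C * card {k \<in> {1..?K}. \<not> ?B k} \<le> T"
    using X0 by (intro early_escape_count[where K = ?K and X = X and w = w] jump w m T) simp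
  finally show ?thesis by simp
qed

text \<open>For fixed \<open>C\<close>, a suitable \<open>m\<close> makes the probabilities of a
  crowded residue class summable in \<open>N\<close>. By Borel-Cantelli, reaching height about (m +
  1) N w then takes time at least C (m + 1) N / 2 for all large \<open>N\<close>. This bounds the
  upper speed by a multiple of w / C, and \<open>C\<close> is arbitrary.\<close>

lemma slow_right:
  assumes p: "emeasure (law 0) stay_right = 0"
  shows "AE X in law 0. \<forall>\<epsilon>>0. eventually (\<lambda>n. real_of_int (X n) \<le> \<epsilon> * real n) sequentially"
proof -
  interpret L: prob_space "law 0" by (rule prob_space_law)
  have "\<exists>m. of_nat C * of_nat (nat w) * emeasure (law 0) (escape m) \<le> ennreal (1 / 16) \<and> m \<ge> 1" for C
  proof -
    \<comment> \<open>The summand 1 keeps the divisor positive also for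
      \<open>C = 0\<close>.\<close>
    let ?c = "real C * real (nat w) + 1"
    have c: "?c > 0" by (intro add_nonneg_pos mult_nonneg_nonneg) auto
    then obtain m where m: "emeasure (law 0) (escape m) < ennreal (1 / 16 / ?c)"
      using escape_prob_small[OF p, of "ennreal (1 / 16 / ?c)"] by (auto simp: ennreal_less_zero_iff)
    have "emeasure (law 0) (escape (max m 1)) \<le> ennreal (1 / 16 / ?c)"
      using order_trans[OF emeasure_mono less_imp_le[OF m]] decseqD[OF decseq_escape, of m "max m 1"] by simp
    then have "ennreal (real C * real (nat w)) * emeasure (law 0) (escape (max m 1)) \<le>
        ennreal (real C * real (nat w)) * ennreal (1 / 16 / ?c)"
      by (rule mult_left_mono) simp
    also have "\<dots> = ennreal (real C * real (nat w) * (1 / 16 / ?c))"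
      using c by (intro ennreal_mult[symmetric]) auto
    also have "\<dots> \<le> ennreal (1 / 16)"
      using c by (intro ennreal_leI) (simp add: field_simps)
    also have "ennreal (real C * real (nat w)) = of_nat C * of_nat (nat w)"
      by (simp add: ennreal_mult ennreal_of_nat_eq_real_of_nat)
    finally show ?thesis by (intro exI[of _ "max m 1"]) simp
  qed
  then obtain m where m: "\<And>C. of_nat C * of_nat (nat w) * emeasure (law 0) (escape (m C)) \<le> ennreal (1 / 16)"
      "\<And>C. m C \<ge> 1"
    by metis
  let ?A = "\<lambda>C N. {X. \<exists>r\<in>{1..m C + 1}. crowded w C (m C) N r X}"
  have "AE X in law 0. eventually (\<lambda>N. X \<in> space (law 0) - ?A C N) sequentially" for C
  proof (rule borel_cantelli_AE1)
    show "?A C N \<in> L.events" for N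
      using many_early_escapes_sets by simp
    show "summable (\<lambda>N. L.prob (?A C N))"
    proof (rule summable_comparison_test_ev)
      show "eventually (\<lambda>N. norm (L.prob (?A C N)) \<le> real (m C + 1) * (1 / 2) ^ N) sequentially"
      proof (intro always_eventually allI)
        fix N
        have "ennreal (L.prob (?A C N)) \<le> ennreal (real (m C + 1) * (1 / 2) ^ N)"
          using law_many_early_escapes[OF m(1)[of C], where N = N and x = 0] by (simp only: L.emeasure_eq_measure)
        then have "L.prob (?A C N) \<le> real (m C + 1) * (1 / 2) ^ N"
          by (subst (asm) ennreal_le_iff) simp_all
        then show "norm (L.prob (?A C N)) \<le> real (m C + 1) * (1 / 2) ^ N"
          by (simp only: real_norm_def abs_of_nonneg measure_nonneg)
      qed
      show "summable (\<lambda>N. real (m C + 1) * (1 / 2) ^ N)"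
        by (intro summable_mult summable_geometric) simp
    qed
  qed (simp add: L.emeasure_eq_measure)
  then have "AE X in law 0. \<forall>C. eventually (\<lambda>N. X \<in> space (law 0) - ?A C N) sequentially"
    by (rule AE_all_countable[THEN iffD2, rule_format])
  then show ?thesis
    using AE_law_jumps[of 0] AE_law_start[of 0]
  proof eventually_elim
    case (elim X)
    show ?case
    proof (intro allI impI)
      fix \<epsilon> :: real assume eps: "\<epsilon> > 0"
      \<comment> \<open>The constant 6 is a factor 2, because only half of the blocks are slow,
        times a factor 3 from rounding the height.\<close>
      obtain C :: nat where C: "6 * real_of_int w / \<epsilon> < real C"
        using reals_Archimedean2 by blast
      let ?d = "m C + 1"
      obtain N0 where N0: "\<And>N. N \<ge> N0 \<Longrightarrow> X \<notin> ?A C N"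
        using elim(1)[rule_format, of C] by (auto simp: eventually_sequentially)
      define N1 where "N1 = max N0 1"
      obtain n0 :: nat where n0: "(real (?d * N1) * real_of_int w + real (m C)) / \<epsilon> < real n0"
        using reals_Archimedean2 by blast
      show "eventually (\<lambda>n. real_of_int (X n) \<le> \<epsilon> * real n) sequentially"
        unfolding eventually_sequentially
      proof (intro exI[of _ n0] allI impI, rule ccontr)
        fix n assume n: "n \<ge> n0" and not: "\<not> real_of_int (X n) \<le> \<epsilon> * real n"
        \<comment> \<open>The number of full rounds of m + 1 blocks that fit below
          \<open>X n\<close>, with room \<open>m\<close> left for the last escape.\<close>
        define N where "N = nat ((X n - int (m C)) div (int ?d * w))"
        have dw: "int ?d * w > 0" using w by (intro mult_pos_pos) auto
        have "real (?d * N1) * real_of_int w + real (m C) < \<epsilon> * real n0"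
          using n0 eps by (simp add: field_simps)
        also have "\<dots> \<le> \<epsilon> * real n" using n eps by simp
        also have "\<dots> < real_of_int (X n)" using not by simp
        finally have "real_of_int (int (?d * N1) * w + int (m C)) < real_of_int (X n)" by simp
        then have big: "int N1 * (int ?d * w) \<le> X n - int (m C)"
          by (simp only: of_int_less_iff) (simp add: algebra_simps)
        have "int N1 = int N1 * (int ?d * w) div (int ?d * w)"
          using dw by (intro nonzero_mult_div_cancel_right[symmetric]) (metis less_irrefl)
        also have "\<dots> \<le> (X n - int (m C)) div (int ?d * w)"
          using big dw by (rule zdiv_mono1)
        finally have "int N1 \<le> (X n - int (m C)) div (int ?d * w)" .
        then have N: "N1 \<le> N" "int N = (X n - int (m C)) div (int ?d * w)"
          unfolding N_def by linarith+
        have le: "int (?d * N) * w + int (m C) \<le> X n"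
        proof -
          have "int N * (int ?d * w) \<le> X n - int (m C)"
            unfolding N(2) using pos_mod_sign[OF dw, of "X n - int (m C)"] by (simp only: minus_mod_eq_div_mult[symmetric])
          moreover have "int (?d * N) * w = int N * (int ?d * w)"
            by (simp only: of_nat_mult mult.assoc mult.left_commute)
          ultimately show ?thesis by linarith
        qed
        have "C * (?d * N) \<le> 2 * n"
        proof (rule late_arrival[where X = X and m = "m C" and N = N and T = n and C = C, OF _ _ m(2) _ le])
          show "2 * card {j \<in> {..<N}. escapes_early w C (m C) (r + (m C + 1) * j) X} < N"
            if "r \<in> {1..m C + 1}" for r
            using N0[of N] N(1) that by (auto simp: N1_def not_le)
        qed (use elim(2,3) in auto)
        then have 1: "real C * (real ?d * real N) \<le> 2 * real n"
          by (metis of_nat_le_iff of_nat_mult of_nat_numeral)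
        have "X n - int (m C) < (int N + 1) * (int ?d * w)"
        proof -
          have "X n - int (m C) = int N * (int ?d * w) + (X n - int (m C)) mod (int ?d * w)"
            unfolding N(2) by (rule div_mult_mod_eq[symmetric])
          moreover have "(X n - int (m C)) mod (int ?d * w) < int ?d * w"
            using dw by (rule pos_mod_bound)
          ultimately show ?thesis by (simp add: algebra_simps)
        qed
        \<comment> \<open>For N \<ge> 1 the last incomplete round and the offset \<open>m\<close>
          each amount to at most the height of N rounds, whence the bound by 3 N rounds.\<close>
        moreover have "(int N + 1) * (int ?d * w) \<le> (2 * int N) * (int ?d * w)"
          using N(1) dw by (intro mult_right_mono) (auto simp: N1_def)
        moreover have "int (m C) \<le> int N * (int ?d * w)"
        proof -
          have "int (m C) * (1 * 1) \<le> int ?d * (int N * w)"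
            using N(1) w by (intro mult_mono) (auto simp: N1_def intro!: mult_mono)
          then show ?thesis by (simp add: mult.left_commute mult.commute)
        qed
        ultimately have "X n < 3 * int N * (int ?d * w)" by linarith
        then have "real_of_int (X n) < real_of_int (3 * int N * (int ?d * w))"
          by (simp only: of_int_less_iff)
        then have 2: "real_of_int (X n) < 3 * real N * (real ?d * real_of_int w)" by simp
        have pos: "real ?d * real N > 0" using N(1) by (simp add: N1_def)
        have "\<epsilon> * (real C * (real ?d * real N)) \<le> \<epsilon> * (2 * real n)"
          using 1 eps by simp
        also have "\<dots> = 2 * (\<epsilon> * real n)" by simp
        also have "\<dots> < 2 * (3 * real N * (real ?d * real_of_int w))" using 2 not by linarith
        also have "\<dots> = 6 * real_of_int w * (real ?d * real N)" by (simp only: mult_ac)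
        finally have "(\<epsilon> * real C) * (real ?d * real N) < (6 * real_of_int w) * (real ?d * real N)"
          by (simp only: mult.assoc)
        then have "\<epsilon> * real C < 6 * real_of_int w"
          using pos by (simp only: mult_less_cancel_right_pos)
        with C eps show False by (simp add: field_simps)
      qed
    qed
  qed
qed

end

section \<open>Escape to the right forces unbounded paths\<close>

definition unbounded_right :: "path set" where
  "unbounded_right = {X. \<forall>k. \<exists>n. k \<le> X n}"

lemma unbounded_right_sets [measurable]: "unbounded_right \<in> sets path_space"
  unfolding unbounded_right_def by (rule path_setsI) measurable

lemma quenched_eq_measure: "emeasure (quenched \<omega> x) B = ennreal (measure (quenched \<omega> x) B)"
  by (rule finite_measure.emeasure_eq_measure[OF prob_space.finite_measure[OF prob_space_quenched]])

lemma irreducible_hit: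
  assumes "irreducible_env \<omega>"
  shows "measure (quenched \<omega> x) {X. \<exists>n. X n \<in> {z}} > 0"
proof -
  interpret prob_space "quenched \<omega> x" by (rule prob_space_quenched)
  obtain n where "prob {X. X n = z} > 0"
    using assms unfolding irreducible_env_def by auto
  also have "prob {X. X n = z} \<le> prob {X. \<exists>n. X n \<in> {z}}"
    using hit_sets[of "{z}"] by (intro finite_measure_mono) auto
  finally show ?thesis .
qed

text \<open>A path confined to \<open>{- int k..int k}\<close> visits this finite set infinitely
  often, and from each of its points \<open>k + 1\<close> is hit with positive probability. The
  minimum of finitely many positive numbers is the uniform bound for \<open>hit_io\<close>.\<close>

lemma irreducible_unbounded:
  assumes irr: "irreducible_env \<omega>"
  shows "AE X in quenched \<omega> x. \<forall>k::nat. \<exists>n. \<bar>X n\<bar> > int k"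
proof (rule AE_all_countable[THEN iffD2, rule_format])
  fix k :: nat
  let ?S = "{- int k..int k}"
  let ?h = "\<lambda>x. measure (quenched \<omega> x) {X. \<exists>n. X n \<in> {int k + 1}}"
  have "AE X in quenched \<omega> x. (\<exists>\<^sub>\<infinity>n. X n \<in> ?S) \<longrightarrow> (\<exists>n. X n \<in> {int k + 1})"
  proof (rule hit_io)
    show "Min (?h ` ?S) > 0"
      using irreducible_hit[OF irr] by (subst Min_gr_iff) auto
  qed (auto intro: Min_le)
  then show "AE X in quenched \<omega> x. \<exists>n. \<bar>X n\<bar> > int k"
  proof eventually_elim
    case (elim X)
    show ?case
    proof (rule ccontr)
      assume "\<not> ?thesis"
      then have *: "\<bar>X n\<bar> \<le> int k" for n by (auto simp: not_less)
      have "X n \<in> ?S" for n using *[of n] by (auto simp: abs_le_iff)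
      then have "\<exists>\<^sub>\<infinity>n. X n \<in> ?S" by (auto simp: INFM_nat)
      with elim obtain n where "X n = int k + 1" by auto
      with *[of n] show False by simp
    qed
  qed
qed

text \<open>The chain is at \<open>y\<close> with positive probability at some fixed time, and what
  precedes that time does not affect unboundedness.\<close>

lemma irreducible_unbounded_right_pos:
  assumes irr: "irreducible_env \<omega>" and pos: "emeasure (quenched \<omega> y) unbounded_right > 0"
  shows "emeasure (quenched \<omega> x) unbounded_right > 0"
proof -
  interpret prob_space "quenched \<omega> x" by (rule prob_space_quenched)
  obtain n where n: "prob {X. X n = y} > 0"
    using irr unfolding irreducible_env_def by auto
  have ad: "adapted n (\<lambda>_. True)" by (simp add: adapted_def)
  have "0 < emeasure (quenched \<omega> x) {X. X n = y} * emeasure (quenched \<omega> y) unbounded_right"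
    using n pos by (simp add: ennreal_zero_less_mult_iff emeasure_eq_measure)
  also have "\<dots> = emeasure (quenched \<omega> x) {X. True \<and> X n = y \<and> shift n X \<in> unbounded_right}"
    by (subst quenched_markov[OF ad]) simp_all
  also have "\<dots> \<le> emeasure (quenched \<omega> x) unbounded_right"
  proof (rule emeasure_mono)
    show "{X. True \<and> X n = y \<and> shift n X \<in> unbounded_right} \<subseteq> unbounded_right"
      unfolding unbounded_right_def by (auto simp: shift_def)
  qed simp
  finally show ?thesis .
qed

text \<open>A path that is bounded below but unbounded in modulus is unbounded above.\<close>

lemma stay_right_le_unbounded_right:
  assumes "irreducible_env \<omega>"
  shows "emeasure (quenched \<omega> x) stay_right \<le> emeasure (quenched \<omega> x) unbounded_right"
proof (rule emeasure_mono_AE)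
  show "AE X in quenched \<omega> x. X \<in> stay_right \<longrightarrow> X \<in> unbounded_right"
    using irreducible_unbounded[OF assms, of x]
  proof eventually_elim
    case (elim X)
    show ?case
    proof
      assume X: "X \<in> stay_right"
      have "\<exists>n. k \<le> X n" for k
      proof -
        obtain n where n: "\<bar>X n\<bar> > int (nat (\<bar>k\<bar> + \<bar>X 0\<bar>))" using elim by blast
        have "X 0 \<le> X n" using X by (simp add: stay_right_def)
        with n have "k \<le> X n" by linarith
        then show ?thesis ..
      qed
      then show "X \<in> unbounded_right" by (simp add: unbounded_right_def)
    qed
  qed
qed simp

lemma quenched_stay_right_local:
  assumes "\<And>a. a \<ge> y \<Longrightarrow> \<omega> a = \<omega>' a"
  shows "emeasure (quenched \<omega> y) stay_right = emeasure (quenched \<omega>' y) stay_right"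
proof -
  let ?B = "{X \<in> stay_right. X 0 = y}"
  have B: "?B \<in> sets path_space"
    by (rule path_setsI) measurable
  have "emeasure (quenched \<omega> y) stay_right = emeasure (quenched \<omega> y) ?B" for \<omega>
    using quenched_start[where \<omega> = \<omega> and x = y] B by (intro emeasure_eq_AE) auto
  moreover have "emeasure (quenched \<omega> y) ?B = emeasure (quenched \<omega>' y) ?B"
    by (rule quenched_local[OF B, of "{y..}"]) (auto simp: stay_right_def assms)
  ultimately show ?thesis by simp
qed

text \<open>The union of the increasing events again has probability \<open>e\<close>. It does not
  change when its first members are dropped, so it is determined by arbitrarily remote sites and is
  independent of every finite set of sites. Hence it is independent of itself, and e = e *
  e.\<close>

lemma (in iid_environment) env_01:
  assumes E: "\<And>n::nat. E n \<in> sets env_algebra" and mono: "incseq E"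
    and dep: "\<And>n \<omega> \<omega>'. (\<And>a. a \<ge> int n \<Longrightarrow> \<omega> a = \<omega>' a) \<Longrightarrow> \<omega> \<in> E n \<longleftrightarrow> \<omega>' \<in> E n"
    and const: "\<And>n. emeasure env (E n) = e"
  shows "e = 0 \<or> e = 1"
proof -
  interpret E: prob_space env by (rule prob_space_env)
  let ?U = "\<Union>n. E n"
  have U: "?U \<in> sets env" using E by auto
  have eU: "emeasure env ?U = e"
  proof -
    have "emeasure env ?U = (SUP n. emeasure env (E n))"
      using E mono by (intro SUP_emeasure_incseq[symmetric]) auto
    then show ?thesis by (simp add: const)
  qed
  have "density env (indicator ?U) = scale_measure e env"
  proof (rule measure_eqI_PiM_infinite[where I = UNIV and M = "\<lambda>_. M"])
    show "finite_measure (density env (indicator ?U))"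
      using U sets.top[of env] by (intro finite_measureI) (simp add: emeasure_density_indicator E.emeasure_eq_measure)
    fix A and J :: "int set" assume J: "finite J" "J \<subseteq> UNIV" and A: "\<And>i. i \<in> J \<Longrightarrow> A i \<in> sets M"
    let ?C = "prod_emb UNIV (\<lambda>_. M) J (Pi\<^sub>E J A)"
    have C: "?C \<in> sets env"
      unfolding env_def using J A by (intro sets_PiM_I) auto
    have Cdep: "\<omega> \<in> ?C \<longleftrightarrow> \<omega>' \<in> ?C" if "\<And>a. a \<in> J \<Longrightarrow> \<omega> a = \<omega>' a" for \<omega> \<omega>'
      using that sets_eq_imp_space_eq[OF sets_M] by (auto simp: prod_emb_def space_PiM PiE_iff)
    \<comment> \<open>From \<open>n0\<close> on the sites lie to the right of \<open>J\<close>, so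
      \<open>E n\<close> is independent of the cylinder for all n \<ge> n0.\<close>
    obtain n0 :: nat where n0: "\<And>a. a \<in> J \<Longrightarrow> a < int n0"
    proof -
      have "a < int (nat (Max (insert 0 J) + 1))" if "a \<in> J" for a
        using Max_ge[of "insert 0 J" a] J(1) that by auto
      then show ?thesis using that by blast
    qed
    have prod: "emeasure env (?C \<inter> E n) = e * emeasure env ?C" if "n \<ge> n0" for n
    proof -
      have "emeasure env (?C \<inter> E n) = (\<integral>\<^sup>+\<omega>. indicator ?C \<omega> * indicator (E n) \<omega> \<partial>env)"
        using C E[of n] by (simp flip: indicator_inter_arith)
      also have "\<dots> = (\<integral>\<^sup>+\<omega>. indicator ?C \<omega> \<partial>env) * (\<integral>\<^sup>+\<omega>. indicator (E n) \<omega> \<partial>env)"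
      proof (rule nn_integral_env_mult[where A = J and B = "{int n..}"])
        show "J \<inter> {int n..} = {}" using n0 that by force
        show "indicator ?C \<omega> = (indicator ?C \<omega>' :: ennreal)" if "\<And>a. a \<in> J \<Longrightarrow> \<omega> a = \<omega>' a" for \<omega> \<omega>'
          using Cdep[OF that] by (simp add: indicator_def)
        show "indicator (E n) \<omega> = (indicator (E n) \<omega>' :: ennreal)" if "\<And>a. a \<in> {int n..} \<Longrightarrow> \<omega> a = \<omega>' a" for \<omega> \<omega>'
          using dep[of n \<omega> \<omega>'] that by (simp add: indicator_def)
      qed (use C E[of n] in auto)
      also have "\<dots> = e * emeasure env ?C"
        using C E[of n] by (simp add: const mult.commute)
      finally show ?thesis .
    qed
    have "emeasure (density env (indicator ?U)) ?C = emeasure env (?C \<inter> ?U)"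
      by (rule emeasure_density_indicator[OF C U])
    also have "?C \<inter> ?U = (\<Union>n. ?C \<inter> E (n + n0))"
    proof -
      have "E n \<subseteq> E (n + n0)" for n using mono by (rule incseqD) simp
      then show ?thesis by blast
    qed
    also have "emeasure env \<dots> = (SUP n. emeasure env (?C \<inter> E (n + n0)))"
    proof (rule SUP_emeasure_incseq[symmetric])
      show "incseq (\<lambda>n. ?C \<inter> E (n + n0))"
        unfolding incseq_def
      proof (intro allI impI)
        fix a b :: nat assume "a \<le> b"
        then have "E (a + n0) \<subseteq> E (b + n0)" by (intro incseqD[OF mono]) simp
        then show "?C \<inter> E (a + n0) \<subseteq> ?C \<inter> E (b + n0)" by blast
      qed
    qed (use C E in auto)
    also have "\<dots> = emeasure (scale_measure e env) ?C"
      by (simp add: prod)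
    finally show "emeasure (density env (indicator ?U)) ?C = emeasure (scale_measure e env) ?C" .
  qed (simp_all add: env_def)
  then have "emeasure (density env (indicator ?U)) ?U = emeasure (scale_measure e env) ?U" by simp
  then have "e = e * e"
    using U by (simp add: emeasure_density_indicator eU)
  moreover have "e \<noteq> \<infinity>" using const[of 0] E.emeasure_finite[of "E 0"] by auto
  ultimately show ?thesis
    by (cases e) (auto simp flip: ennreal_mult)
qed

section \<open>Windows that force the walk to be unbounded to the right\<close>

locale irreducible_environment = bounded_environment +
  assumes irreducible: "AE \<omega> in env. irreducible_env \<omega>"
begin

text \<open>The event that from no site beyond \<open>n\<close> the walk can stay to the right
  increases with \<open>n\<close>, has a probability independent of \<open>n\<close> by
  stationarity, and depends only on the sites from \<open>n\<close> on. By the zero-one law its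
  probability is 0 or 1, and 1 is excluded by the site 0.\<close>

lemma AE_exists_stay_right:
  assumes p: "emeasure (law 0) stay_right > 0"
  shows "AE \<omega> in env. \<exists>y. emeasure (quenched \<omega> y) stay_right > 0"
proof -
  interpret E: prob_space env by (rule prob_space_env)
  let ?E = "\<lambda>n::nat. {\<omega>. \<forall>y\<ge>int n. emeasure (quenched \<omega> y) stay_right = 0}"
  have E: "?E n \<in> sets env_algebra" for n
  proof -
    have "?E n = {\<omega> \<in> space env_algebra. \<forall>y\<in>{int n..}. emeasure (quenched \<omega> y) stay_right = 0}" by auto
    also have "\<dots> \<in> sets env_algebra" by measurable
    finally show ?thesis .
  qed
  have const: "emeasure env (?E n) = emeasure env (?E 0)" for n
  proof -
    have "{X. (\<lambda>i. X i - int n) \<in> stay_right} = stay_right" by (auto simp: stay_right_def)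
    then have shift: "emeasure (quenched (\<lambda>a. \<omega> (a + int n)) y) stay_right = emeasure (quenched \<omega> (y + int n)) stay_right" for \<omega> y
      using quenched_translate_event[OF stay_right_sets, of \<omega> "int n" y] by simp
    have "emeasure env (?E n) = (\<integral>\<^sup>+\<omega>. indicator (?E n) \<omega> \<partial>env)" using E[of n] by simp
    also have "\<dots> = (\<integral>\<^sup>+\<omega>. indicator (?E 0) (\<lambda>a. \<omega> (a + int n)) \<partial>env)"
    proof (rule nn_integral_cong)
      fix \<omega>
      have "\<omega> \<in> ?E n \<longleftrightarrow> (\<lambda>a. \<omega> (a + int n)) \<in> ?E 0"
      proof safe
        fix y assume "\<forall>y\<ge>int n. emeasure (quenched \<omega> y) stay_right = 0" "int 0 \<le> y"
        then show "emeasure (quenched (\<lambda>a. \<omega> (a + int n)) y) stay_right = 0" by (simp add: shift)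
      next
        fix y assume *: "\<forall>y\<ge>int 0. emeasure (quenched (\<lambda>a. \<omega> (a + int n)) y) stay_right = 0" "int n \<le> y"
        then have "emeasure (quenched (\<lambda>a. \<omega> (a + int n)) (y - int n)) stay_right = 0" by simp
        then show "emeasure (quenched \<omega> y) stay_right = 0" by (simp add: shift)
      qed
      then show "indicator (?E n) \<omega> = (indicator (?E 0) (\<lambda>a. \<omega> (a + int n)) :: ennreal)"
        by (simp add: indicator_def)
    qed
    also have "\<dots> = (\<integral>\<^sup>+\<omega>. indicator (?E 0) \<omega> \<partial>env)"
      by (rule nn_integral_env_shift) (use E[of 0] in simp)
    finally show ?thesis using E[of 0] by simp
  qed
  have dep: "\<omega> \<in> ?E n \<longleftrightarrow> \<omega>' \<in> ?E n" if "\<And>a. a \<ge> int n \<Longrightarrow> \<omega> a = \<omega>' a" for n \<omega> \<omega>'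
  proof -
    have "emeasure (quenched \<omega> y) stay_right = emeasure (quenched \<omega>' y) stay_right" if "y \<ge> int n" for y
      by (rule quenched_stay_right_local) (use \<open>\<And>a. a \<ge> int n \<Longrightarrow> \<omega> a = \<omega>' a\<close> that in simp)
    then show ?thesis by simp
  qed
  have "incseq ?E" by (auto simp: incseq_def)
  from env_01[OF E this dep const]
  have "emeasure env (?E 0) = 0 \<or> emeasure env (?E 0) = 1" by simp
  moreover have "emeasure env (?E 0) \<noteq> 1"
  proof
    assume "emeasure env (?E 0) = 1"
    then have "E.prob (?E 0) = 1" by (simp add: E.emeasure_eq_measure)
    from E.AE_prob_1[OF this]
    have "AE \<omega> in env. emeasure (quenched \<omega> 0) stay_right = 0" by eventually_elim simp
    then have "emeasure (law 0) stay_right = 0"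
      by (simp add: emeasure_law nn_integral_0_iff_AE)
    with p show False by simp
  qed
  ultimately have "emeasure env (?E 0) = 0" by blast
  then show ?thesis
    by (intro AE_I[of _ _ "?E 0"]) (use E[of 0] in \<open>auto simp: not_gr_zero\<close>)
qed

text \<open>The bound runs through 1/(j + 1) so that countably many \<open>j\<close> exhaust all
  positive lower bounds.\<close>

definition good_window :: "nat \<Rightarrow> int \<Rightarrow> env set" where
  "good_window j m = {\<omega>. \<forall>x\<in>{m..<m + w}. ennreal (1 / real (Suc j)) \<le> emeasure (quenched \<omega> x) unbounded_right}"

lemma good_window_sets [measurable]: "good_window j m \<in> sets env_algebra"
proof -
  have "good_window j m = {\<omega> \<in> space env_algebra. \<forall>x\<in>{m..<m + w}.
      ennreal (1 / real (Suc j)) \<le> emeasure (quenched \<omega> x) unbounded_right}"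
    by (simp add: good_window_def)
  also have "\<dots> \<in> sets env_algebra" by measurable
  finally show ?thesis .
qed

lemma emeasure_good_window: "emeasure env (good_window j m) = emeasure env (good_window j 0)"
proof -
  have "{X. (\<lambda>i. X i - m) \<in> unbounded_right} = unbounded_right"
    unfolding unbounded_right_def mem_Collect_eq
    by (intro Collect_cong iffI allI) (metis add_diff_cancel_right' diff_add_cancel diff_right_mono add_right_mono)+
  then have shift: "emeasure (quenched (\<lambda>a. \<omega> (a + m)) y) unbounded_right = emeasure (quenched \<omega> (y + m)) unbounded_right" for \<omega> y
    using quenched_translate_event[OF unbounded_right_sets, of \<omega> m y] by simp
  have "emeasure env (good_window j m) = (\<integral>\<^sup>+\<omega>. indicator (good_window j m) \<omega> \<partial>env)" by simp
  also have "\<dots> = (\<integral>\<^sup>+\<omega>. indicator (good_window j 0) (\<lambda>a. \<omega> (a + m)) \<partial>env)"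
  proof (rule nn_integral_cong)
    fix \<omega>
    have im: "{m..<m + w} = (\<lambda>y. y + m) ` {0..<w}"
      by (simp add: image_add_atLeastLessThan' add.commute)
    have "\<omega> \<in> good_window j m \<longleftrightarrow> (\<lambda>a. \<omega> (a + m)) \<in> good_window j 0"
      by (simp only: good_window_def mem_Collect_eq im shift add_0) blast
    then show "indicator (good_window j m) \<omega> = (indicator (good_window j 0) (\<lambda>a. \<omega> (a + m)) :: ennreal)"
      by (simp add: indicator_def)
  qed
  also have "\<dots> = (\<integral>\<^sup>+\<omega>. indicator (good_window j 0) \<omega> \<partial>env)"
    by (rule nn_integral_env_shift) simp
  finally show ?thesis by simp
qed

text \<open>For fixed \<open>j\<close>, infinitely many of the equally likely windows are good with
  at least the probability that a single one is good. This probability tends to 1 with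
  \<open>j\<close>, because finitely many positive numbers have a positive minimum.\<close>

lemma AE_good_windows:
  assumes pos: "AE \<omega> in env. \<forall>x. emeasure (quenched \<omega> x) unbounded_right > 0"
  shows "AE \<omega> in env. \<exists>j. \<exists>\<^sub>\<infinity>m::nat. \<omega> \<in> good_window j (- int m)"
proof -
  interpret E: prob_space env by (rule prob_space_env)
  let ?F = "\<lambda>j. {\<omega>. \<exists>\<^sub>\<infinity>m::nat. \<omega> \<in> good_window j (- int m)}"
  have F_eq: "?F j = (\<Inter>n. \<Union>m\<in>{n<..}. good_window j (- int m))" for j
    by (auto simp: INFM_nat)
  have F: "?F j \<in> E.events" for j
    unfolding F_eq by measurable
  have "emeasure env (good_window j 0) \<le> emeasure env (?F j)" for j
  proof -
    have "emeasure env (good_window j 0) \<le> (INF n. emeasure env (\<Union>m\<in>{n<..}. good_window j (- int m)))"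
    proof (rule INF_greatest)
      fix n :: nat
      have "emeasure env (good_window j 0) = emeasure env (good_window j (- int (Suc n)))"
        by (rule emeasure_good_window[symmetric])
      also have "\<dots> \<le> emeasure env (\<Union>m\<in>{n<..}. good_window j (- int m))"
        by (rule emeasure_mono) auto
      finally show "emeasure env (good_window j 0) \<le> emeasure env (\<Union>m\<in>{n<..}. good_window j (- int m))" .
    qed
    also have "\<dots> = emeasure env (?F j)"
      unfolding F_eq
    proof (rule INF_emeasure_decseq)
      show "decseq (\<lambda>n. \<Union>m\<in>{n<..}. good_window j (- int m))"
        unfolding decseq_def by (intro allI impI UN_mono) auto
    qed auto
    finally show ?thesis .
  qed
  then have "(SUP j. emeasure env (good_window j 0)) \<le> (SUP j. emeasure env (?F j))"
    by (intro SUP_mono) auto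
  also have "\<dots> \<le> emeasure env (\<Union>j. ?F j)"
    using F by (intro SUP_least emeasure_mono) auto
  finally have le: "(SUP j. emeasure env (good_window j 0)) \<le> emeasure env (\<Union>j. ?F j)" .
  have "incseq (\<lambda>j. good_window j 0)"
  proof (rule incseq_SucI, rule subsetI)
    fix j \<omega> assume "\<omega> \<in> good_window j 0"
    moreover have "ennreal (1 / real (Suc (Suc j))) \<le> ennreal (1 / real (Suc j))"
      by (intro ennreal_leI divide_left_mono) auto
    ultimately show "\<omega> \<in> good_window (Suc j) 0"
      unfolding good_window_def by (blast intro: order_trans)
  qed
  then have "(SUP j. emeasure env (good_window j 0)) = emeasure env (\<Union>j. good_window j 0)"
    by (intro SUP_emeasure_incseq) auto
  also have "\<dots> = emeasure env UNIV"
  proof (rule emeasure_eq_AE)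
    show "AE \<omega> in env. \<omega> \<in> (\<Union>j. good_window j 0) \<longleftrightarrow> \<omega> \<in> UNIV"
      using pos
    proof eventually_elim
      case (elim \<omega>)
      let ?m = "Min ((\<lambda>x. measure (quenched \<omega> x) unbounded_right) ` {0..<w})"
      have pm: "measure (quenched \<omega> x) unbounded_right > 0" for x
        using elim by (simp add: quenched_eq_measure)
      have "?m > 0"
        using w pm by (subst Min_gr_iff) auto
      then obtain j where j: "1 / real (Suc j) < ?m"
        using reals_Archimedean[of ?m] by (auto simp: inverse_eq_divide)
      have "ennreal (1 / real (Suc j)) \<le> emeasure (quenched \<omega> x) unbounded_right" if "x \<in> {0..<w}" for x
      proof -
        have "?m \<le> measure (quenched \<omega> x) unbounded_right"
          using that by (intro Min_le) auto
        with j have "ennreal (1 / real (Suc j)) \<le> ennreal (measure (quenched \<omega> x) unbounded_right)"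
          by (intro ennreal_leI) simp
        then show ?thesis by (simp only: quenched_eq_measure)
      qed
      then have "\<omega> \<in> good_window j 0" by (simp add: good_window_def)
      then show ?case by blast
    qed
  qed (use sets.top[of env_algebra] in auto)
  finally have "1 \<le> emeasure env (\<Union>j. ?F j)"
    using le E.emeasure_space_1 by simp
  then have "E.prob (\<Union>j. ?F j) = 1"
    by (simp add: E.emeasure_eq_measure antisym)
  from E.AE_prob_1[OF this] show ?thesis by eventually_elim auto
qed

text \<open>The first step below the right end of a window lands inside it, since it starts at or
  above that end and has length at most \<open>w\<close>. A window to the left of all positions up
  to time \<open>N\<close> makes this visit later than \<open>N\<close>.\<close>

lemma visits_windows:
  fixes X :: path
  assumes jump: "\<And>n. \<bar>X (Suc n) - X n\<bar> \<le> w" and low: "\<And>k. \<exists>n. X n \<le> k"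
    and win: "\<exists>\<^sub>\<infinity>m::nat. {- int m..<- int m + w} \<subseteq> S"
  shows "\<exists>\<^sub>\<infinity>n. X n \<in> S"
  unfolding INFM_nat
proof (intro allI)
  fix N
  define b where "b = Min (X ` {..N})"
  have b: "b \<le> X i" if "i \<le> N" for i
    unfolding b_def using that by (intro Min_le) auto
  obtain m :: nat where m: "m > nat (w - b)" "{- int m..<- int m + w} \<subseteq> S"
    using win unfolding INFM_nat by blast
  then have mb: "- int m + w < b" by linarith
  have ex: "\<exists>n. X n < - int m + w" using low[of "- int m + w - 1"] by force
  define n where "n = (LEAST n. X n < - int m + w)"
  have n: "X n < - int m + w" unfolding n_def using ex by (rule LeastI_ex)
  have "n > N" using b[of n] mb n by (cases "n \<le> N") auto
  then obtain k where k: "n = Suc k" by (cases n) auto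
  have "\<not> X k < - int m + w"
    using not_less_Least[of k "\<lambda>n. X n < - int m + w"] k unfolding n_def by simp
  then have "X n \<in> {- int m..<- int m + w}" using jump[of k] n k by auto
  with m \<open>n > N\<close> show "\<exists>n>N. X n \<in> S" by blast
qed

text \<open>A path bounded above is still unbounded in modulus, hence goes arbitrarily far to the
  left and visits good windows infinitely often. From every such visit any given level is reached
  with probability at least 1/(j + 1), so by \<open>hit_io\<close> each level is reached after
  all.\<close>

lemma AE_unbounded_right:
  assumes p: "emeasure (law 0) stay_right > 0"
  shows "AE X in law x. X \<in> unbounded_right"
proof -
  have pos: "AE \<omega> in env. \<forall>x. emeasure (quenched \<omega> x) unbounded_right > 0"
    using AE_exists_stay_right[OF p] irreducible
  proof eventually_elim
    case (elim \<omega>)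
    then obtain y where "emeasure (quenched \<omega> y) stay_right > 0" by blast
    then have "emeasure (quenched \<omega> y) unbounded_right > 0"
      using stay_right_le_unbounded_right[OF elim(2), of y] by (rule less_le_trans)
    then show ?case using irreducible_unbounded_right_pos[OF elim(2)] by blast
  qed
  have "AE \<omega> in env. AE X in quenched \<omega> x. X \<in> unbounded_right"
    using AE_good_windows[OF pos] irreducible AE_env_bounded
  proof eventually_elim
    case (elim \<omega>)
    let ?S = "\<lambda>j. {x. ennreal (1 / real (Suc j)) \<le> emeasure (quenched \<omega> x) unbounded_right}"
    obtain j where j: "\<exists>\<^sub>\<infinity>m::nat. \<omega> \<in> good_window j (- int m)" using elim(1) by blast
    have "{- int m..<- int m + w} \<subseteq> ?S j" if "\<omega> \<in> good_window j (- int m)" for m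
      using that by (auto simp: good_window_def)
    with j have win: "\<exists>\<^sub>\<infinity>m::nat. {- int m..<- int m + w} \<subseteq> ?S j"
      by (rule INFM_mono)
    have "AE X in quenched \<omega> x. (\<exists>\<^sub>\<infinity>n. X n \<in> ?S j) \<longrightarrow> (\<exists>n. X n \<in> {int k..})" for k
    proof (rule hit_io)
      show "0 < 1 / real (Suc j)" by simp
      fix y assume "y \<in> ?S j"
      interpret Y: prob_space "quenched \<omega> y" by (rule prob_space_quenched)
      have "ennreal (1 / real (Suc j)) \<le> emeasure (quenched \<omega> y) unbounded_right"
        using \<open>y \<in> ?S j\<close> by simp
      also have "\<dots> \<le> emeasure (quenched \<omega> y) {X. \<exists>n. X n \<in> {int k..}}"
        using hit_sets[of "{int k..}"] by (intro emeasure_mono) (auto simp: unbounded_right_def)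
      finally show "1 / real (Suc j) \<le> measure (quenched \<omega> y) {X. \<exists>n. X n \<in> {int k..}}"
        by (simp add: Y.emeasure_eq_measure)
    qed
    then have "AE X in quenched \<omega> x. \<forall>k. (\<exists>\<^sub>\<infinity>n. X n \<in> ?S j) \<longrightarrow> (\<exists>n. X n \<in> {int k..})"
      by (rule AE_all_countable[THEN iffD2, rule_format])
    moreover have "AE X in quenched \<omega> x. \<forall>n. \<bar>X (Suc n) - X n\<bar> \<le> w"
      using elim(3) by (intro quenched_bounded_jumps) auto
    ultimately show ?case
      using irreducible_unbounded[OF elim(2), of x]
    proof eventually_elim
      case (elim X)
      show ?case
      proof (rule ccontr)
        assume "X \<notin> unbounded_right"
        then obtain K where K: "\<And>n. X n < K"
          unfolding unbounded_right_def by (auto simp: not_le)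
        have "\<exists>n. X n \<le> k" for k
        proof -
          obtain n where "\<bar>X n\<bar> > int (nat (\<bar>k\<bar> + \<bar>K\<bar>))" using elim(3) by blast
          with K[of n] show ?thesis by (intro exI[of _ n]) linarith
        qed
        then have "\<exists>\<^sub>\<infinity>n. X n \<in> ?S j"
          using elim(2) win by (intro visits_windows) auto
        with elim(1) have "\<exists>n. X n \<in> {int (nat K)..}" by blast
        then obtain n where "int (nat K) \<le> X n" by (auto simp del: int_nat_eq)
        with K[of n] show False by linarith
      qed
    qed
  qed
  then show ?thesis by (subst AE_law) auto
qed

end

section \<open>A law of large numbers for measure-preserving maps\<close>

locale measure_preserving = prob_space +
  fixes T :: "'a \<Rightarrow> 'a"
  assumes measurable_T [measurable]: "T \<in> M \<rightarrow>\<^sub>M M" and preserves: "distr M M T = M"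
begin

lemma measurable_funpow [measurable]: "(T ^^ i) \<in> M \<rightarrow>\<^sub>M M"
  by (induction i) (auto intro: measurable_comp)

lemma distr_funpow: "distr M M (T ^^ i) = M"
proof (induction i)
  case (Suc i)
  have "distr M M (T ^^ Suc i) = distr (distr M M (T ^^ i)) M T"
    by (simp add: distr_distr comp_def)
  then show ?case by (simp only: Suc preserves)
qed (simp add: distr_id2)

lemma expectation_funpow:
  fixes f :: "'a \<Rightarrow> real"
  assumes "f \<in> borel_measurable M"
  shows "expectation (\<lambda>x. f ((T ^^ i) x)) = expectation f"
  using integral_distr[OF measurable_funpow assms, of i] by (simp only: distr_funpow)

lemma integrable_funpow:
  fixes f :: "'a \<Rightarrow> real"
  assumes "integrable M f"
  shows "integrable M (\<lambda>x. f ((T ^^ i) x))"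
proof -
  have "integrable (distr M M (T ^^ i)) f" using assms by (simp only: distr_funpow)
  then show ?thesis by (rule integrable_distr[OF measurable_funpow])
qed

text \<open>The variance of the sums grows at most linearly, so Chebyshev and Borel-Cantelli give
  convergence along the squares. Between the squares k^2 and (k + 1)^2 there are at most 3 k terms,
  each bounded by \<open>K\<close>, which adds an error of order K / k.\<close>

lemma average_bounded:
  fixes g :: "'a \<Rightarrow> real"
  assumes [measurable]: "g \<in> borel_measurable M" and bound: "\<And>x. 0 \<le> g x" "\<And>x. g x \<le> K"
    and uncorrelated: "\<And>i. i \<ge> 1 \<Longrightarrow> expectation (\<lambda>x. g x * g ((T ^^ i) x)) = expectation g * expectation g"
  shows "AE x in M. (\<lambda>n. (\<Sum>i<n. g ((T ^^ i) x)) / real n) \<longlonglongrightarrow> expectation g"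
proof -
  define e where "e = expectation g"
  define h where "h x = g x - e" for x
  define S where "S n x = (\<Sum>i<n. h ((T ^^ i) x))" for n x
  have [measurable]: "h \<in> borel_measurable M" "S n \<in> borel_measurable M" for n
    unfolding h_def[abs_def] S_def[abs_def] by measurable
  have ig: "integrable M g"
    using bound by (intro integrable_const_bound[of _ K]) auto
  have K: "K \<ge> 0" using bound[of undefined] by linarith
  have e: "0 \<le> e" "e \<le> K"
    unfolding e_def using bound ig
    by (auto intro!: integral_nonneg integral_le_const AE_I2)
  have hb: "\<bar>h x\<bar> \<le> K" for x
    using bound[of x] e by (auto simp: h_def)
  have ih: "integrable M (\<lambda>x. h ((T ^^ i) x) * h ((T ^^ j) x))" for i j
  proof (rule integrable_const_bound[of _ "K * K"])
    show "AE x in M. norm (h ((T ^^ i) x) * h ((T ^^ j) x)) \<le> K * K"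
      using hb K by (auto simp: abs_mult intro!: mult_mono)
  qed measurable
  have igg: "integrable M (\<lambda>x. g x * g ((T ^^ k) x))" for k
  proof (rule integrable_const_bound[of _ "K * K"])
    show "AE x in M. norm (g x * g ((T ^^ k) x)) \<le> K * K"
      using bound K by (auto simp: abs_mult intro!: mult_mono)
  qed measurable
  have cov0: "expectation (\<lambda>x. h x * h ((T ^^ k) x)) = 0" if "k \<ge> 1" for k
  proof -
    have "expectation (\<lambda>x. h x * h ((T ^^ k) x)) =
      expectation (\<lambda>x. (g x * g ((T ^^ k) x) - e * g x) - (e * g ((T ^^ k) x) - e * e))"
      by (simp add: h_def algebra_simps)
    also have "\<dots> = (expectation (\<lambda>x. g x * g ((T ^^ k) x)) - e * e) - (e * e - e * e)"
      using igg ig integrable_funpow[OF ig, of k] expectation_funpow[of g k]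
      by (subst Bochner_Integration.integral_diff integral_mult_right_zero, (auto simp: e_def prob_space)[2])+
         (auto simp: e_def prob_space)
    finally show ?thesis using uncorrelated[OF that] by (simp add: e_def)
  qed
  have cov: "expectation (\<lambda>x. h ((T ^^ i) x) * h ((T ^^ j) x)) = 0" if "i < j" for i j
  proof -
    have "expectation (\<lambda>x. h ((T ^^ i) x) * h ((T ^^ j) x)) =
        expectation (\<lambda>x. (\<lambda>y. h y * h ((T ^^ (j - i)) y)) ((T ^^ i) x))"
      using that by (simp flip: funpow_add[THEN fun_cong, unfolded comp_def])
    also have "\<dots> = expectation (\<lambda>y. h y * h ((T ^^ (j - i)) y))"
      by (rule expectation_funpow) measurable
    finally show ?thesis using cov0[of "j - i"] that by simp
  qed
  have var: "expectation (\<lambda>x. (S n x)\<^sup>2) \<le> real n * K\<^sup>2" for n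
  proof -
    have "expectation (\<lambda>x. (S n x)\<^sup>2) = (\<Sum>i<n. \<Sum>j<n. expectation (\<lambda>x. h ((T ^^ i) x) * h ((T ^^ j) x)))"
      unfolding S_def power2_eq_square sum_product
      by (subst Bochner_Integration.integral_sum, (intro Bochner_Integration.integrable_sum ih)[1])
        (intro sum.cong refl Bochner_Integration.integral_sum ih)
    also have "\<dots> = (\<Sum>i<n. expectation (\<lambda>x. h ((T ^^ i) x) * h ((T ^^ i) x)))"
    proof (intro sum.cong refl)
      fix i assume i: "i \<in> {..<n}"
      have "(\<Sum>j<n. expectation (\<lambda>x. h ((T ^^ i) x) * h ((T ^^ j) x))) =
        (\<Sum>j<n. if j = i then expectation (\<lambda>x. h ((T ^^ i) x) * h ((T ^^ i) x)) else 0)"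
      proof (intro sum.cong refl)
        fix j
        show "expectation (\<lambda>x. h ((T ^^ i) x) * h ((T ^^ j) x)) =
          (if j = i then expectation (\<lambda>x. h ((T ^^ i) x) * h ((T ^^ i) x)) else 0)"
          using cov[of i j] cov[of j i] by (cases i j rule: linorder_cases) (auto simp: mult.commute)
      qed
      then show "(\<Sum>j<n. expectation (\<lambda>x. h ((T ^^ i) x) * h ((T ^^ j) x))) =
          expectation (\<lambda>x. h ((T ^^ i) x) * h ((T ^^ i) x))"
        using i by simp
    qed
    also have "\<dots> \<le> (\<Sum>i<n. K\<^sup>2)"
    proof (rule sum_mono)
      fix i
      show "expectation (\<lambda>x. h ((T ^^ i) x) * h ((T ^^ i) x)) \<le> K\<^sup>2"
      proof (rule integral_le_const[OF ih], rule AE_I2)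
        fix x
        have "\<bar>h ((T ^^ i) x)\<bar>\<^sup>2 \<le> K\<^sup>2" using hb by (intro power_mono) auto
        then show "h ((T ^^ i) x) * h ((T ^^ i) x) \<le> K\<^sup>2" by (simp add: power2_eq_square)
      qed
    qed
    finally show ?thesis by simp
  qed
  have iS2: "integrable M (\<lambda>x. (S n x)\<^sup>2)" for n
    unfolding S_def power2_eq_square sum_product by (intro Bochner_Integration.integrable_sum ih)
  have small: "AE x in M. \<forall>l. eventually (\<lambda>k. x \<in> space M - {x \<in> space M. (1 / real (Suc l)) * real ((Suc k)\<^sup>2) \<le> \<bar>S ((Suc k)\<^sup>2) x\<bar>}) sequentially"
  proof (rule AE_all_countable[THEN iffD2, rule_format])
    fix l :: nat
    let ?\<epsilon> = "1 / real (Suc l)"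
    have bnd: "prob {x \<in> space M. ?\<epsilon> * real ((Suc k)\<^sup>2) \<le> \<bar>S ((Suc k)\<^sup>2) x\<bar>} \<le>
        K\<^sup>2 / ?\<epsilon>\<^sup>2 * (1 / (real (Suc k))\<^sup>2)" for k
    proof -
      let ?n = "(Suc k)\<^sup>2"
      have pos: "0 < ?\<epsilon> * real ?n" by (intro mult_pos_pos) auto
      have "{x \<in> space M. ?\<epsilon> * real ?n \<le> \<bar>S ?n x\<bar>} = {x \<in> space M. (?\<epsilon> * real ?n)\<^sup>2 \<le> (S ?n x)\<^sup>2}"
        using pos by (auto simp: abs_le_square_iff[symmetric])
      also have "prob \<dots> \<le> expectation (\<lambda>x. (S ?n x)\<^sup>2) / (?\<epsilon> * real ?n)\<^sup>2"
        using pos by (intro integral_Markov_inequality_measure[where A = "{}"] iS2) auto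
      also have "\<dots> \<le> (real ?n * K\<^sup>2) / (?\<epsilon> * real ?n)\<^sup>2"
        by (intro divide_right_mono var) simp
      also have "\<dots> = K\<^sup>2 / ?\<epsilon>\<^sup>2 * (1 / (real (Suc k))\<^sup>2)"
        unfolding of_nat_power by (simp add: power_mult_distrib power2_eq_square field_simps del: of_nat_Suc)
      finally show ?thesis .
    qed
    show "AE x in M. eventually (\<lambda>k. x \<in> space M - {x \<in> space M. ?\<epsilon> * real ((Suc k)\<^sup>2) \<le> \<bar>S ((Suc k)\<^sup>2) x\<bar>}) sequentially"
    proof (rule borel_cantelli_AE1)
      have "summable (\<lambda>k. inverse ((real (Suc k))\<^sup>2))"
        using inverse_power_summable[of 2] by (subst summable_Suc_iff) (simp add: power_inverse)
      then have "summable (\<lambda>k. K\<^sup>2 / ?\<epsilon>\<^sup>2 * (1 / (real (Suc k))\<^sup>2))"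
        by (intro summable_mult) (simp add: inverse_eq_divide)
      then show "summable (\<lambda>k. prob {x \<in> space M. ?\<epsilon> * real ((Suc k)\<^sup>2) \<le> \<bar>S ((Suc k)\<^sup>2) x\<bar>})"
        by (rule summable_comparison_test[rotated]) (use bnd in auto)
    qed (auto simp: emeasure_eq_measure)
  qed
  show ?thesis
    using small
  proof (eventually_elim)
    case (elim x)
    have sq: "(\<lambda>k. \<bar>S ((Suc k)\<^sup>2) x\<bar> / real ((Suc k)\<^sup>2)) \<longlonglongrightarrow> 0"
    proof (rule LIMSEQ_I)
      fix r :: real assume "r > 0"
      then obtain l where l: "1 / real (Suc l) < r"
        using reals_Archimedean[of r] by (auto simp: inverse_eq_divide)
      obtain k0 where k0: "\<And>k. k \<ge> k0 \<Longrightarrow> x \<in> space M - {x \<in> space M. (1 / real (Suc l)) * real ((Suc k)\<^sup>2) \<le> \<bar>S ((Suc k)\<^sup>2) x\<bar>}"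
        using elim[rule_format, of l] unfolding eventually_sequentially by blast
      show "\<exists>no. \<forall>n\<ge>no. norm (\<bar>S ((Suc n)\<^sup>2) x\<bar> / real ((Suc n)\<^sup>2) - 0) < r"
      proof (intro exI[of _ k0] allI impI)
        fix k assume "k0 \<le> k"
        from k0[OF this] have "\<bar>S ((Suc k)\<^sup>2) x\<bar> < (1 / real (Suc l)) * real ((Suc k)\<^sup>2)"
          by (auto simp: not_le)
        then have "\<bar>S ((Suc k)\<^sup>2) x\<bar> / real ((Suc k)\<^sup>2) < 1 / real (Suc l)"
          by (subst pos_divide_less_eq) auto
        with l show "norm (\<bar>S ((Suc k)\<^sup>2) x\<bar> / real ((Suc k)\<^sup>2) - 0) < r" by simp
      qed
    qed
    \<comment> \<open>\<open>Suc (r n)\<close> is the integer part of the square root; the shift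
      matches the indexing of the squares by \<open>Suc k\<close>.\<close>
    define r where "r n = nat (\<lfloor>sqrt (real n)\<rfloor>) - 1" for n :: nat
    have r: "(Suc (r n))\<^sup>2 \<le> n" "n < (Suc (Suc (r n)))\<^sup>2" if "n \<ge> 1" for n
    proof -
      have s1: "1 \<le> sqrt (real n)" using that by simp
      then have f1: "1 \<le> \<lfloor>sqrt (real n)\<rfloor>" by (simp add: le_floor_iff)
      then have Sr: "real (Suc (r n)) = real_of_int \<lfloor>sqrt (real n)\<rfloor>" by (simp add: r_def)
      have "(real (Suc (r n)))\<^sup>2 \<le> (sqrt (real n))\<^sup>2"
        unfolding Sr using f1 by (intro power_mono) auto
      also have "\<dots> = real n" by simp
      finally show "(Suc (r n))\<^sup>2 \<le> n" by (metis of_nat_le_iff of_nat_power)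
      have "real n = (sqrt (real n))\<^sup>2" by simp
      also have "\<dots> < (real (Suc (r n)) + 1)\<^sup>2"
        unfolding Sr using s1 by (intro power_strict_mono) auto
      also have "\<dots> = (real (Suc (Suc (r n))))\<^sup>2" by simp
      finally show "n < (Suc (Suc (r n)))\<^sup>2" by (metis of_nat_less_iff of_nat_power)
    qed
    have r_lim: "filterlim r at_top sequentially"
      unfolding r_def
      by (rule filterlim_compose[OF filterlim_minus_const_nat_at_top])
        (intro filterlim_compose[OF filterlim_nat_sequentially] filterlim_compose[OF filterlim_floor_sequentially]
          filterlim_compose[OF sqrt_at_top filterlim_real_sequentially])
    have "(\<lambda>n. S n x / real n) \<longlonglongrightarrow> 0"
    proof (rule Lim_null_comparison)
      show "eventually (\<lambda>n. norm (S n x / real n) \<le> \<bar>S ((Suc (r n))\<^sup>2) x\<bar> / real ((Suc (r n))\<^sup>2) + 3 * K / real (Suc (r n))) sequentially"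
        using eventually_ge_at_top[of 1]
      proof eventually_elim
        case (elim n)
        let ?k = "Suc (r n)"
        have kn: "?k\<^sup>2 \<le> n" "n < (Suc ?k)\<^sup>2" using r[OF elim] by auto
        have "S n x = S (?k\<^sup>2) x + (\<Sum>i\<in>{?k\<^sup>2..<n}. h ((T ^^ i) x))"
          unfolding S_def lessThan_atLeast0 using kn(1) by (intro sum.atLeastLessThan_concat[symmetric]) auto
        moreover have "\<bar>\<Sum>i\<in>{?k\<^sup>2..<n}. h ((T ^^ i) x)\<bar> \<le> real (n - ?k\<^sup>2) * K"
        proof (rule order_trans[OF sum_abs])
          have "(\<Sum>i\<in>{?k\<^sup>2..<n}. \<bar>h ((T ^^ i) x)\<bar>) \<le> (\<Sum>i\<in>{?k\<^sup>2..<n}. K)"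
            by (rule sum_mono) (rule hb)
          then show "(\<Sum>i\<in>{?k\<^sup>2..<n}. \<bar>h ((T ^^ i) x)\<bar>) \<le> real (n - ?k\<^sup>2) * K" by simp
        qed
        moreover have "real (n - ?k\<^sup>2) * K \<le> (3 * real ?k) * K"
        proof (intro mult_right_mono K)
          have "(Suc ?k)\<^sup>2 = ?k\<^sup>2 + 2 * ?k + 1" by (simp add: power2_eq_square)
          then have "n - ?k\<^sup>2 \<le> 3 * ?k" using kn by linarith
          then show "real (n - ?k\<^sup>2) \<le> 3 * real ?k" by (metis of_nat_le_iff of_nat_mult of_nat_numeral)
        qed
        ultimately have Sn: "\<bar>S n x\<bar> \<le> \<bar>S (?k\<^sup>2) x\<bar> + 3 * real ?k * K" by linarith
        have kpos: "real (?k\<^sup>2) > 0" by simp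
        have "\<bar>S n x\<bar> / real n \<le> \<bar>S n x\<bar> / real (?k\<^sup>2)"
          using kn(1) kpos elim by (intro divide_left_mono mult_pos_pos) (auto simp del: of_nat_power)
        also have "\<dots> \<le> (\<bar>S (?k\<^sup>2) x\<bar> + 3 * real ?k * K) / real (?k\<^sup>2)"
          by (intro divide_right_mono Sn) simp
        also have "\<dots> = \<bar>S (?k\<^sup>2) x\<bar> / real (?k\<^sup>2) + 3 * K / real ?k"
          unfolding of_nat_power by (simp add: add_divide_distrib power2_eq_square del: of_nat_Suc)
        finally show ?case by simp
      qed
      have "(\<lambda>k. 3 * K / real (Suc k)) \<longlonglongrightarrow> 0"
        using LIMSEQ_Suc[OF lim_const_over_n[of "3 * K"]] by simp
      then have "(\<lambda>k. \<bar>S ((Suc k)\<^sup>2) x\<bar> / real ((Suc k)\<^sup>2) + 3 * K / real (Suc k)) \<longlonglongrightarrow> 0"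
        using tendsto_add[OF sq] by fastforce
      from filterlim_compose[OF this r_lim]
      show "(\<lambda>n. \<bar>S ((Suc (r n))\<^sup>2) x\<bar> / real ((Suc (r n))\<^sup>2) + 3 * K / real (Suc (r n))) \<longlonglongrightarrow> 0" .
    qed
    then have "(\<lambda>n. S n x / real n + e) \<longlonglongrightarrow> 0 + e"
      by (intro tendsto_add tendsto_const)
    moreover have "eventually (\<lambda>n. S n x / real n + e = (\<Sum>i<n. g ((T ^^ i) x)) / real n) sequentially"
      using eventually_ge_at_top[of 1]
      by eventually_elim (simp add: S_def h_def sum_subtractf diff_divide_distrib)
    ultimately have "(\<lambda>n. (\<Sum>i<n. g ((T ^^ i) x)) / real n) \<longlonglongrightarrow> 0 + e"
      by (rule Lim_transform_eventually)
    then show ?case by (simp add: e_def)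
  qed
qed

text \<open>The maximum of 0 and the first \<open>n\<close> partial sums along the orbit. The
  recursion splits off the first term, the form in which the maximal inequality telescopes.\<close>

fun max_sum :: "('a \<Rightarrow> real) \<Rightarrow> nat \<Rightarrow> 'a \<Rightarrow> real" where
  "max_sum Y 0 x = 0"
| "max_sum Y (Suc n) x = max 0 (Y x + max_sum Y n (T x))"

lemma max_sum_nonneg: "0 \<le> max_sum Y n x"
  by (cases n) auto

lemma max_sum_mono: "max_sum Y n x \<le> max_sum Y (Suc n) x"
proof (induction n arbitrary: x)
  case (Suc n)
  from Suc[of "T x"] show ?case by simp
qed (simp add: max_sum_nonneg)

lemma sum_le_max_sum: "(\<Sum>i<n. Y ((T ^^ i) x)) \<le> max_sum Y n x"
proof (induction n arbitrary: x)
  case (Suc n)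
  have "(\<Sum>i<Suc n. Y ((T ^^ i) x)) = Y x + (\<Sum>i<n. Y ((T ^^ i) (T x)))"
    by (subst sum.lessThan_Suc_shift) (simp add: funpow_swap1)
  with Suc[of "T x"] show ?case by simp
qed simp

lemma integrable_max_sum: "integrable M Y \<Longrightarrow> integrable M (max_sum Y n)"
proof (induction n)
  case 0
  have "max_sum Y 0 = (\<lambda>_. 0)" by (rule ext) simp
  then show ?case by simp
next
  case (Suc n)
  have "integrable M (\<lambda>x. max_sum Y n (T x))"
    using integrable_funpow[OF Suc.IH[OF Suc.prems], of 1] by simp
  moreover have "max_sum Y (Suc n) = (\<lambda>x. max 0 (Y x + max_sum Y n (T x)))" by (rule ext) simp
  ultimately show ?case using Suc.prems by (simp add: integrable_max)
qed

text \<open>The maximal ergodic inequality, by the telescoping bound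
  \<open>max_sum Y (n + 1) - max_sum Y n \<circ> T \<le> Y\<close> on the set where \<open>max_sum Y (n + 1)\<close> is positive.\<close>

lemma maximal_inequality:
  assumes g: "integrable M g" "\<And>x. 0 \<le> g x" and "c > 0"
  shows "c * prob {x \<in> space M. \<exists>n. c * real n < (\<Sum>i<n. g ((T ^^ i) x))} \<le> expectation g"
proof -
  let ?Y = "\<lambda>x. g x - c"
  let ?A = "\<lambda>n. {x \<in> space M. 0 < max_sum ?Y n x}"
  have Y: "integrable M ?Y" using g(1) by simp
  have iM: "integrable M (max_sum ?Y n)" for n by (rule integrable_max_sum[OF Y])
  have [measurable]: "max_sum ?Y n \<in> borel_measurable M" for n using iM by auto
  have A: "?A n \<in> events" for n by measurable
  have le: "c * prob (?A n) \<le> expectation g" for n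
  proof (cases n)
    case (Suc m)
    have iMT: "integrable M (\<lambda>x. max_sum ?Y m (T x))"
      using integrable_funpow[OF iM, of m 1] by simp
    have "0 \<le> expectation (max_sum ?Y (Suc m)) - expectation (max_sum ?Y m)"
      using max_sum_mono by (simp add: integral_mono[OF iM iM] del: max_sum.simps)
    also have "expectation (max_sum ?Y m) = expectation (\<lambda>x. max_sum ?Y m (T x))"
      using expectation_funpow[of "max_sum ?Y m" 1] by simp
    also have "expectation (max_sum ?Y (Suc m)) - expectation (\<lambda>x. max_sum ?Y m (T x)) =
        expectation (\<lambda>x. max_sum ?Y (Suc m) x - max_sum ?Y m (T x))"
      by (rule Bochner_Integration.integral_diff[symmetric, OF iM iMT])
    also have "\<dots> \<le> expectation (\<lambda>x. ?Y x * indicator (?A (Suc m)) x)"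
    proof (rule integral_mono)
      show "integrable M (\<lambda>x. max_sum ?Y (Suc m) x - max_sum ?Y m (T x))"
        by (rule Bochner_Integration.integrable_diff[OF iM iMT])
      show "integrable M (\<lambda>x. ?Y x * indicator (?A (Suc m)) x)"
        by (rule integrable_real_mult_indicator[OF A Y])
      fix x assume "x \<in> space M"
      then show "max_sum ?Y (Suc m) x - max_sum ?Y m (T x) \<le> ?Y x * indicator (?A (Suc m)) x"
        using max_sum_nonneg[of ?Y m "T x"] by (auto simp: indicator_def max_def)
    qed
    also have "\<dots> \<le> expectation (\<lambda>x. g x - c * indicator (?A (Suc m)) x)"
    proof (rule integral_mono)
      show "integrable M (\<lambda>x. ?Y x * indicator (?A (Suc m)) x)"
        by (rule integrable_real_mult_indicator[OF A Y])
      show "integrable M (\<lambda>x. g x - c * indicator (?A (Suc m)) x)"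
        using g(1) A by (intro Bochner_Integration.integrable_diff integrable_mult_right integrable_real_indicator)
          (auto simp: emeasure_eq_measure)
      show "?Y x * indicator (?A (Suc m)) x \<le> g x - c * indicator (?A (Suc m)) x" for x
        using g(2)[of x] by (auto simp: indicator_def)
    qed
    also have "\<dots> = expectation g - c * prob (?A (Suc m))"
      using g(1) A by (subst Bochner_Integration.integral_diff)
        (auto simp: emeasure_eq_measure intro!: integrable_mult_right integrable_real_indicator)
    finally show ?thesis unfolding Suc by linarith
  qed (use g in \<open>auto intro: integral_nonneg\<close>)
  have "incseq ?A"
    by (rule incseq_SucI) (use max_sum_mono in \<open>auto simp del: max_sum.simps intro: less_le_trans\<close>)
  then have "(\<lambda>n. prob (?A n)) \<longlonglongrightarrow> prob (\<Union>n. ?A n)"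
    using A by (intro finite_Lim_measure_incseq) auto
  then have "(\<lambda>n. c * prob (?A n)) \<longlonglongrightarrow> c * prob (\<Union>n. ?A n)"
    by (intro tendsto_mult tendsto_const)
  then have "c * prob (\<Union>n. ?A n) \<le> expectation g"
    by (rule LIMSEQ_le_const2) (use le in blast)
  moreover have "prob {x \<in> space M. \<exists>n. c * real n < (\<Sum>i<n. g ((T ^^ i) x))} \<le> prob (\<Union>n. ?A n)"
  proof (rule finite_measure_mono)
    show "{x \<in> space M. \<exists>n. c * real n < (\<Sum>i<n. g ((T ^^ i) x))} \<subseteq> (\<Union>n. ?A n)"
    proof safe
      fix x n assume x: "x \<in> space M" "c * real n < (\<Sum>i<n. g ((T ^^ i) x))"
      then have "0 < (\<Sum>i<n. ?Y ((T ^^ i) x))" by (simp add: sum_subtractf mult.commute)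
      also have "\<dots> \<le> max_sum ?Y n x" by (rule sum_le_max_sum)
      finally show "x \<in> (\<Union>n. ?A n)" using x(1) by blast
    qed
  qed (use A in auto)
  then have "c * prob {x \<in> space M. \<exists>n. c * real n < (\<Sum>i<n. g ((T ^^ i) x))} \<le> c * prob (\<Union>n. ?A n)"
    using \<open>c > 0\<close> by (intro mult_left_mono) auto
  ultimately show ?thesis by linarith
qed

section \<open>Averages of integer observables with pairwise independence\<close>

context
  fixes f :: "'a \<Rightarrow> nat"
  assumes f [measurable]: "f \<in> M \<rightarrow>\<^sub>M count_space UNIV"
    and indep: "\<And>i A B. i \<ge> 1 \<Longrightarrow> prob {x \<in> space M. f x \<in> A \<and> f ((T ^^ i) x) \<in> B} =
      prob {x \<in> space M. f x \<in> A} * prob {x \<in> space M. f x \<in> B}"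
begin

text \<open>A truncated natural number is the sum of the indicators of f x \<ge> c for
  \<open>c\<close> in \<open>{1..K}\<close>. This turns independence of events into the product
  formula for expectations that \<open>average_bounded\<close> asks for.\<close>

lemma average_min:
  "AE x in M. (\<lambda>n. (\<Sum>i<n. real (min (f ((T ^^ i) x)) K)) / real n) \<longlonglongrightarrow> expectation (\<lambda>x. real (min (f x) K))"
proof (rule average_bounded[of "\<lambda>x. real (min (f x) K)" "real K"])
  fix i :: nat assume i: "i \<ge> 1"
  let ?I = "\<lambda>c x. indicator {x \<in> space M. f x \<in> {c..}} x :: real"
  let ?J = "\<lambda>c d x. indicator {x \<in> space M. f x \<in> {c..} \<and> f ((T ^^ i) x) \<in> {d..}} x :: real"
  have min: "real (min (f x) K) = (\<Sum>c\<in>{1..K}. ?I c x)" if "x \<in> space M" for x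
  proof -
    have "(\<Sum>c\<in>{1..K}. ?I c x) = (\<Sum>c\<in>{1..K}. if c \<in> {..f x} then 1 else 0)"
      using that by (intro sum.cong) auto
    also have "\<dots> = (\<Sum>c\<in>{1..K} \<inter> {..f x}. 1)" by (rule sum.inter_restrict[symmetric]) simp
    also have "{1..K} \<inter> {..f x} = {1..min (f x) K}" by auto
    finally show ?thesis by simp
  qed
  have iI: "integrable M (?I c)" and iJ: "integrable M (?J c d)" for c d
    by (auto intro!: integrable_real_indicator simp: emeasure_eq_measure)
  have "expectation (\<lambda>x. real (min (f x) K) * real (min (f ((T ^^ i) x)) K)) =
      expectation (\<lambda>x. \<Sum>c\<in>{1..K}. \<Sum>d\<in>{1..K}. ?J c d x)"
  proof (rule Bochner_Integration.integral_cong[OF refl])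
    fix x assume x: "x \<in> space M"
    then have "(T ^^ i) x \<in> space M" using measurable_space[OF measurable_funpow] by blast
    then show "real (min (f x) K) * real (min (f ((T ^^ i) x)) K) = (\<Sum>c\<in>{1..K}. \<Sum>d\<in>{1..K}. ?J c d x)"
      using x unfolding min[OF x] min[OF \<open>(T ^^ i) x \<in> space M\<close>] sum_product
      by (intro sum.cong refl) (auto simp: indicator_def)
  qed
  also have "\<dots> = (\<Sum>c\<in>{1..K}. \<Sum>d\<in>{1..K}. expectation (?J c d))"
    by (subst Bochner_Integration.integral_sum, (intro Bochner_Integration.integrable_sum iJ)[1])
      (intro sum.cong refl Bochner_Integration.integral_sum iJ)
  also have "\<dots> = (\<Sum>c\<in>{1..K}. \<Sum>d\<in>{1..K}. expectation (?I c) * expectation (?I d))"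
  proof (intro sum.cong refl)
    fix c d
    have "expectation (?J c d) = prob {x \<in> space M. f x \<in> {c..} \<and> f ((T ^^ i) x) \<in> {d..}}"
      by (subst Bochner_Integration.integral_indicator) (auto intro!: arg_cong[where f = prob])
    also have "\<dots> = prob {x \<in> space M. f x \<in> {c..}} * prob {x \<in> space M. f x \<in> {d..}}"
      by (rule indep[OF i])
    also have "\<dots> = expectation (?I c) * expectation (?I d)"
      by (subst (1 2) Bochner_Integration.integral_indicator) (auto intro!: arg_cong2[where f = "(*)"] arg_cong[where f = prob])
    finally show "expectation (?J c d) = expectation (?I c) * expectation (?I d)" .
  qed
  also have "\<dots> = (\<Sum>c\<in>{1..K}. expectation (?I c)) * (\<Sum>c\<in>{1..K}. expectation (?I c))"
    by (rule sum_product[symmetric])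
  also have "(\<Sum>c\<in>{1..K}. expectation (?I c)) = expectation (\<lambda>x. \<Sum>c\<in>{1..K}. ?I c x)"
    by (rule Bochner_Integration.integral_sum[symmetric, OF iI])
  also have "\<dots> = expectation (\<lambda>x. real (min (f x) K))"
    by (rule Bochner_Integration.integral_cong[OF refl]) (simp only: min)
  finally show "expectation (\<lambda>x. real (min (f x) K) * real (min (f ((T ^^ i) x)) K)) =
     expectation (\<lambda>x. real (min (f x) K)) * expectation (\<lambda>x. real (min (f x) K))" .
qed auto

text \<open>The averages dominate those of the truncations, whose means are unbounded by monotone
  convergence.\<close>

lemma average_infinite:
  assumes inf: "\<not> integrable M (\<lambda>x. real (f x))"
  shows "AE x in M. filterlim (\<lambda>n. (\<Sum>i<n. real (f ((T ^^ i) x))) / real n) at_top sequentially"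
proof -
  have iK: "integrable M (\<lambda>x. real (min (f x) K))" for K
    by (rule integrable_const_bound[of _ "real K"]) auto
  have "\<exists>K. C < expectation (\<lambda>x. real (min (f x) K))" for C
  proof (rule ccontr)
    assume "\<not> ?thesis"
    then have le: "expectation (\<lambda>x. real (min (f x) K)) \<le> C" for K by (simp add: not_less)
    have "(\<integral>\<^sup>+x. ennreal (real (f x)) \<partial>M) = (\<integral>\<^sup>+x. (SUP K. ennreal (real (min (f x) K))) \<partial>M)"
    proof (rule nn_integral_cong)
      fix x
      show "ennreal (real (f x)) = (SUP K. ennreal (real (min (f x) K)))"
      proof (rule antisym)
        show "ennreal (real (f x)) \<le> (SUP K. ennreal (real (min (f x) K)))"
          by (rule SUP_upper2[of "f x"]) auto
        show "(SUP K. ennreal (real (min (f x) K))) \<le> ennreal (real (f x))"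
          by (rule SUP_least) (auto intro: ennreal_leI)
      qed
    qed
    also have "\<dots> = (SUP K. \<integral>\<^sup>+x. ennreal (real (min (f x) K)) \<partial>M)"
      by (rule nn_integral_monotone_convergence_SUP) (auto simp: incseq_def le_fun_def intro!: ennreal_leI)
    also have "\<dots> \<le> ennreal C"
    proof (rule SUP_least)
      fix K
      show "(\<integral>\<^sup>+x. ennreal (real (min (f x) K)) \<partial>M) \<le> ennreal C"
        using le[of K] by (subst nn_integral_eq_integral[OF iK]) (auto intro: ennreal_leI)
    qed
    also have "\<dots> < \<infinity>" by simp
    finally have "integrable M (\<lambda>x. real (f x))"
      by (intro integrableI_nonneg) auto
    with inf show False by simp
  qed
  then obtain K where K: "\<And>C. C < expectation (\<lambda>x. real (min (f x) (K C)))" by metis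
  have "AE x in M. \<forall>c::nat. (\<lambda>n. (\<Sum>i<n. real (min (f ((T ^^ i) x)) (K (real c)))) / real n)
      \<longlonglongrightarrow> expectation (\<lambda>x. real (min (f x) (K (real c))))"
    by (rule AE_all_countable[THEN iffD2, rule_format]) (rule average_min)
  then show ?thesis
  proof eventually_elim
    case (elim x)
    show ?case
      unfolding filterlim_at_top
    proof
      fix Z :: real
      define c where "c = nat \<lceil>Z\<rceil>"
      have c: "Z \<le> real c" unfolding c_def by linarith
      have "eventually (\<lambda>n. real c < (\<Sum>i<n. real (min (f ((T ^^ i) x)) (K (real c)))) / real n) sequentially"
        using elim[rule_format, of c] K[of "real c"] by (rule order_tendstoD(1))
      then show "eventually (\<lambda>n. Z \<le> (\<Sum>i<n. real (f ((T ^^ i) x))) / real n) sequentially"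
      proof eventually_elim
        case (elim n)
        have "(\<Sum>i<n. real (min (f ((T ^^ i) x)) (K (real c)))) / real n \<le> (\<Sum>i<n. real (f ((T ^^ i) x))) / real n"
          by (intro divide_right_mono sum_mono) auto
        with elim c show ?case by linarith
      qed
    qed
  qed
qed

text \<open>Truncation gives the lower bound. For the upper bound the maximal inequality is applied
  to the excess over the truncation, whose mean tends to 0: almost surely some truncation level
  keeps the averages of the excess below 1/(l + 1) at all times.\<close>

lemma average_finite:
  assumes int: "integrable M (\<lambda>x. real (f x))"
  shows "AE x in M. (\<lambda>n. (\<Sum>i<n. real (f ((T ^^ i) x))) / real n) \<longlonglongrightarrow> expectation (\<lambda>x. real (f x))"
proof -
  let ?e = "expectation (\<lambda>x. real (f x))"
  let ?eK = "\<lambda>K. expectation (\<lambda>x. real (min (f x) K))"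
  let ?A = "\<lambda>x n. (\<Sum>i<n. real (f ((T ^^ i) x))) / real n"
  let ?AK = "\<lambda>K x n. (\<Sum>i<n. real (min (f ((T ^^ i) x)) K)) / real n"
  have iK: "integrable M (\<lambda>x. real (min (f x) K))" for K
    by (rule integrable_const_bound[of _ "real K"]) auto
  have lim: "?eK \<longlonglongrightarrow> ?e"
  proof (rule integral_dominated_convergence[where w = "\<lambda>x. real (f x)"])
    show "AE x in M. (\<lambda>K. real (min (f x) K)) \<longlonglongrightarrow> real (f x)"
    proof (rule AE_I2)
      fix x
      have "eventually (\<lambda>K. real (min (f x) K) = real (f x)) sequentially"
        using eventually_ge_at_top[of "f x"] by eventually_elim simp
      then show "(\<lambda>K. real (min (f x) K)) \<longlonglongrightarrow> real (f x)" by (rule tendsto_eventually)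
    qed
  qed (use int in auto)
  have eK_le: "?eK K \<le> ?e" for K
    by (rule integral_mono[OF iK int]) auto
  have conv: "AE x in M. \<forall>K. ?AK K x \<longlonglongrightarrow> ?eK K"
    by (rule AE_all_countable[THEN iffD2, rule_format]) (rule average_min)
  have upper: "AE x in M. \<forall>l::nat. eventually (\<lambda>n. ?A x n \<le> ?e + 2 / real (Suc l)) sequentially"
  proof (rule AE_all_countable[THEN iffD2, rule_format])
    fix l :: nat
    let ?c = "1 / real (Suc l)"
    \<comment> \<open>The points at which the accumulated excess over level \<open>K\<close> is ever
      above 1/(l + 1) per step; the probability of this set is at most (l + 1) times the mean
      excess.\<close>
    let ?B = "\<lambda>K. {x \<in> space M. \<exists>n. ?c * real n < (\<Sum>i<n. real (f ((T ^^ i) x)) - real (min (f ((T ^^ i) x)) K))}"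
    have B: "?B K \<in> events" for K by measurable
    have "prob (\<Inter>K. ?B K) \<le> 0"
    proof (rule LIMSEQ_le_const)
      have "(\<lambda>K. (?e - ?eK K) / ?c) \<longlonglongrightarrow> (?e - ?e) / ?c"
        by (intro tendsto_divide tendsto_diff tendsto_const lim) auto
      then show "(\<lambda>K. (?e - ?eK K) / ?c) \<longlonglongrightarrow> 0" by simp
      show "\<exists>N. \<forall>K\<ge>N. prob (\<Inter>K. ?B K) \<le> (?e - ?eK K) / ?c"
      proof (intro exI allI impI)
        fix K
        have "?c * prob (?B K) \<le> expectation (\<lambda>x. real (f x) - real (min (f x) K))"
          by (rule maximal_inequality[of "\<lambda>x. real (f x) - real (min (f x) K)"]) (use int iK in auto)
        also have "\<dots> = ?e - ?eK K"
          by (rule Bochner_Integration.integral_diff[OF int iK])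
        finally have "prob (?B K) \<le> (?e - ?eK K) / ?c"
          by (subst pos_le_divide_eq) (auto simp: mult.commute)
        moreover have "prob (\<Inter>K. ?B K) \<le> prob (?B K)"
          by (intro finite_measure_mono B) auto
        ultimately show "prob (\<Inter>K. ?B K) \<le> (?e - ?eK K) / ?c" by linarith
      qed
    qed
    then have "prob (\<Inter>K. ?B K) = 0" by (simp add: measure_le_0_iff)
    moreover have "(\<Inter>K. ?B K) \<in> events" using B by auto
    ultimately have "AE x in M. x \<notin> (\<Inter>K. ?B K)"
      using prob_eq_0 by blast
    with conv AE_space show "AE x in M. eventually (\<lambda>n. ?A x n \<le> ?e + 2 / real (Suc l)) sequentially"
    proof eventually_elim
      case (elim x)
      then obtain K where K: "x \<notin> ?B K" by blast
      have "eventually (\<lambda>n. ?AK K x n < ?e + ?c) sequentially"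
      proof (rule order_tendstoD(2))
        show "?AK K x \<longlonglongrightarrow> ?eK K" using elim by blast
        show "?eK K < ?e + ?c" using eK_le[of K] by (rule le_less_trans) simp
      qed
      then show ?case
        using eventually_ge_at_top[of 1]
      proof eventually_elim
        case (elim n)
        have "(\<Sum>i<n. real (f ((T ^^ i) x)) - real (min (f ((T ^^ i) x)) K)) \<le> ?c * real n"
          using K \<open>x \<in> space M\<close> by (auto simp: not_less)
        then have "?A x n - ?AK K x n \<le> ?c"
          using \<open>1 \<le> n\<close> by (simp add: sum_subtractf diff_divide_distrib[symmetric] pos_divide_le_eq del: of_nat_Suc)
        moreover have "2 / real (Suc l) = ?c + ?c" by (simp flip: add_divide_distrib del: of_nat_Suc)
        ultimately show ?case using elim(1) by linarith
      qed
    qed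
  qed
  show ?thesis
    using conv upper
  proof eventually_elim
    case (elim x)
    show ?case
    proof (rule order_tendstoI)
      fix a assume "a < ?e"
      then have "eventually (\<lambda>K. a < ?eK K) sequentially" by (rule order_tendstoD(1)[OF lim])
      then obtain K where "a < ?eK K" by (auto simp: eventually_sequentially)
      with elim(1) have "eventually (\<lambda>n. a < ?AK K x n) sequentially"
        by (intro order_tendstoD(1)) auto
      then show "eventually (\<lambda>n. a < ?A x n) sequentially"
      proof eventually_elim
        case (elim n)
        have "?AK K x n \<le> ?A x n" by (intro divide_right_mono sum_mono) auto
        with elim show ?case by linarith
      qed
    next
      fix a assume "?e < a"
      then obtain l where l: "inverse (real (Suc l)) < (a - ?e) / 2"
        using reals_Archimedean[of "(a - ?e) / 2"] by auto
      have "2 / real (Suc l) = 2 * inverse (real (Suc l))" by (rule divide_inverse)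
      moreover have "2 * inverse (real (Suc l)) < 2 * ((a - ?e) / 2)"
        by (rule mult_strict_left_mono[OF l]) simp
      ultimately have l2: "?e + 2 / real (Suc l) < a" by simp
      show "eventually (\<lambda>n. ?A x n < a) sequentially"
        using elim(2)[rule_format, of l] by eventually_elim (use l2 in linarith)
    qed
  qed
qed

end

end

section \<open>Regeneration\<close>

definition recentre :: "nat \<Rightarrow> path \<Rightarrow> path" where
  "recentre n X = (\<lambda>i. X (n + i) - X n)"

definition is_record :: "nat \<Rightarrow> path \<Rightarrow> bool" where
  "is_record n X \<longleftrightarrow> (\<forall>i<n. X i < X n)"

definition regen :: "nat \<Rightarrow> path \<Rightarrow> bool" where
  "regen n X \<longleftrightarrow> is_record n X \<and> (\<forall>i\<ge>n. X n \<le> X i)"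

lemma adapted_is_record: "adapted n (is_record n)"
  by (simp add: adapted_def is_record_def)

lemma is_record_pred [measurable]: "Measurable.pred path_space (is_record n)"
  by (rule adapted_imp_pred[OF adapted_is_record])

lemma regen_pred [measurable]: "Measurable.pred path_space (regen n)"
  unfolding regen_def[abs_def] by measurable

lemma recentre_0 [simp]: "recentre n X 0 = 0"
  by (simp add: recentre_def)

lemma recentre_recentre: "recentre m (recentre n X) = recentre (n + m) X"
  by (simp add: recentre_def add.assoc)

lemma measurable_recentre [measurable]: "recentre n \<in> path_space \<rightarrow>\<^sub>M path_space"
  unfolding recentre_def[abs_def] by (rule measurable_to_path_space) measurable

lemma recentre_stay_right: "recentre n X \<in> stay_right \<longleftrightarrow> (\<forall>i\<ge>n. X n \<le> X i)"
proof
  assume *: "recentre n X \<in> stay_right"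
  show "\<forall>i\<ge>n. X n \<le> X i"
  proof (intro allI impI)
    fix i assume "n \<le> i"
    moreover have "0 \<le> recentre n X (i - n)" using * unfolding stay_right_def by (metis recentre_0 mem_Collect_eq)
    ultimately show "X n \<le> X i" by (simp add: recentre_def)
  qed
qed (auto simp: stay_right_def recentre_def)

lemma regen_iff: "regen n X \<longleftrightarrow> is_record n X \<and> recentre n X \<in> stay_right"
  by (simp add: regen_def recentre_stay_right)

lemma recentre_vimage_sets: "B \<in> sets path_space \<Longrightarrow> {X. recentre n X \<in> B} \<in> sets path_space"
  using measurable_sets[OF measurable_recentre, of B n] by (simp add: vimage_def)

lemma adapted_recentre_sets:
  assumes "adapted n N" "B \<in> sets path_space"
  shows "{X. N X \<and> recentre n X \<in> B} \<in> sets path_space"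
proof -
  have "{X. N X \<and> recentre n X \<in> B} = {X. N X} \<inter> {X. recentre n X \<in> B}" by auto
  then show ?thesis
    using adapted_sets[OF assms(1)] recentre_vimage_sets[OF assms(2), of n] by simp
qed

text \<open>Up to a record time the walk has only used the environment strictly to the left of its
  position, and a path that stays to the right only uses the complementary part.\<close>

lemma (in iid_environment) law_renewal:
  assumes N: "adapted n N" and rec: "\<And>X. N X \<Longrightarrow> is_record n X"
    and B: "B \<in> sets path_space" "B \<subseteq> stay_right"
  shows "emeasure (law 0) {X. N X \<and> recentre n X \<in> B} = emeasure (law 0) {X. N X} * emeasure (law 0) B"
proof -
  have state: "emeasure (law 0) {X. N X \<and> recentre n X \<in> B \<and> X n = y} =
    emeasure (law 0) {X. N X \<and> X n = y} * emeasure (law 0) B" for y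
  proof -
    let ?B = "{Z. (\<lambda>i. Z i - y) \<in> B}"
    have m: "(\<lambda>X i. X i - y) \<in> path_space \<rightarrow>\<^sub>M path_space"
      by (rule measurable_to_path_space) measurable
    have B': "?B \<in> sets path_space"
      using measurable_sets[OF m B(1)] by (simp add: vimage_def)
    have Ny: "adapted n (\<lambda>X. N X \<and> X n = y)"
      by (rule adapted_conj[OF N]) (simp add: adapted_def)
    have eq: "{X. N X \<and> recentre n X \<in> B \<and> X n = y} = {X. N X \<and> X n = y \<and> shift n X \<in> ?B}"
      by (auto simp: recentre_def)
    have sets1: "{X. N X \<and> X n = y \<and> shift n X \<in> ?B} \<in> sets path_space"
      using adapted_shift_sets[OF Ny B'] by (simp add: conj_assoc)
    have "emeasure (law 0) {X. N X \<and> recentre n X \<in> B \<and> X n = y} =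
      (\<integral>\<^sup>+\<omega>. emeasure (quenched \<omega> 0) {X. N X \<and> X n = y} * emeasure (quenched \<omega> y) ?B \<partial>env)"
      unfolding eq emeasure_law[OF sets1] by (simp only: quenched_markov[OF N B'])
    also have "\<dots> = (\<integral>\<^sup>+\<omega>. emeasure (quenched \<omega> 0) {X. N X \<and> X n = y} \<partial>env) *
        (\<integral>\<^sup>+\<omega>. emeasure (quenched \<omega> y) ?B \<partial>env)"
    proof (rule nn_integral_env_mult[where A = "{..<y}" and B = "{y..}"])
      show "emeasure (quenched \<omega> 0) {X. N X \<and> X n = y} = emeasure (quenched \<omega>' 0) {X. N X \<and> X n = y}"
        if "\<And>a. a \<in> {..<y} \<Longrightarrow> \<omega> a = \<omega>' a" for \<omega> \<omega>'
        using rec that by (intro quenched_local_adapted[OF Ny, of "{..<y}"]) (auto simp: is_record_def)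
      show "emeasure (quenched \<omega> y) ?B = emeasure (quenched \<omega>' y) ?B"
        if eq: "\<And>a. a \<in> {y..} \<Longrightarrow> \<omega> a = \<omega>' a" for \<omega> \<omega>'
      proof -
        let ?C = "{Z. (\<lambda>i. Z i - y) \<in> B \<and> Z 0 = y}"
        have [measurable]: "Measurable.pred path_space (\<lambda>Z. (\<lambda>i. Z i - y) \<in> B)" using B' by (simp add: pred_def)
        have C: "?C \<in> sets path_space" by (intro path_setsI) measurable
        have "emeasure (quenched \<omega> y) ?B = emeasure (quenched \<omega> y) ?C" for \<omega>
          using quenched_start[where \<omega> = \<omega> and x = y] B' C by (intro emeasure_eq_AE) auto
        moreover have "emeasure (quenched \<omega> y) ?C = emeasure (quenched \<omega>' y) ?C"
        proof (rule quenched_local[OF C, of "{y..}"])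
          fix Z i assume "Z \<in> ?C"
          then have "(\<lambda>i. Z i - y) \<in> stay_right" "Z 0 = y" using B(2) by auto
          then show "Z i \<in> {y..}" by (auto simp: stay_right_def)
        qed (rule eq)
        ultimately show ?thesis by simp
      qed
    qed (use adapted_sets[OF Ny] B' in auto)
    also have "(\<integral>\<^sup>+\<omega>. emeasure (quenched \<omega> 0) {X. N X \<and> X n = y} \<partial>env) = emeasure (law 0) {X. N X \<and> X n = y}"
      by (rule emeasure_law[OF adapted_sets[OF Ny], symmetric])
    also have "(\<integral>\<^sup>+\<omega>. emeasure (quenched \<omega> y) ?B \<partial>env) = emeasure (law y) ?B"
      by (rule emeasure_law[OF B', symmetric])
    also have "\<dots> = emeasure (law 0) B"
      using law_translate[OF B(1), of y y] by simp
    finally show ?thesis .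
  qed
  have "emeasure (law 0) {X. N X \<and> recentre n X \<in> B} =
      (\<integral>\<^sup>+y. emeasure (law 0) {X. (N X \<and> recentre n X \<in> B) \<and> X n = y} \<partial>count_space UNIV)"
    by (rule emeasure_split_state[OF sets_law adapted_recentre_sets[OF N B(1)]])
  also have "\<dots> = (\<integral>\<^sup>+y. emeasure (law 0) {X. N X \<and> X n = y} * emeasure (law 0) B \<partial>count_space UNIV)"
    by (simp only: conj_assoc state)
  also have "\<dots> = emeasure (law 0) {X. N X} * emeasure (law 0) B"
    by (simp add: nn_integral_multc emeasure_split_state[OF sets_law adapted_sets[OF N], of 0 n])
  finally show ?thesis .
qed

section \<open>Almost sure existence of regenerations\<close>

locale transient_environment = irreducible_environment +
  assumes escape_pos: "emeasure (law 0) stay_right > 0"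
begin

definition p :: real where
  "p = measure (law 0) stay_right"

lemma law_eq: "emeasure (law 0) B = ennreal (measure (law 0) B)"
  by (rule finite_measure.emeasure_eq_measure[OF prob_space.finite_measure[OF prob_space_law]])

lemma p_pos: "p > 0"
  using escape_pos by (simp add: p_def law_eq)

lemma p_le_1: "p \<le> 1"
  unfolding p_def by (rule prob_space.prob_le_1[OF prob_space_law])

lemma renewal:
  assumes "adapted n N" "\<And>X. N X \<Longrightarrow> is_record n X" "B \<in> sets path_space" "B \<subseteq> stay_right"
  shows "measure (law 0) {X. N X \<and> recentre n X \<in> B} = measure (law 0) {X. N X} * measure (law 0) B"
  using law_renewal[OF assms] by (simp add: law_eq ennreal_mult'[symmetric])

text \<open>The first passage above the maximum up to time \<open>n\<close> is a record.\<close>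

lemma record_beyond:
  assumes "X \<in> unbounded_right"
  shows "\<exists>m>n. is_record m X"
proof -
  define b where "b = Max (X ` {..n})"
  have ex: "\<exists>m. b + 1 \<le> X m" using assms by (simp add: unbounded_right_def)
  define m where "m = (LEAST m. b + 1 \<le> X m)"
  have m: "b + 1 \<le> X m" unfolding m_def using ex by (rule LeastI_ex)
  have less: "X i \<le> b" if "i < m" for i
    using not_less_Least[of i "\<lambda>m. b + 1 \<le> X m"] that by (simp add: m_def)
  have "X i \<le> b" if "i \<le> n" for i
    unfolding b_def using that by (intro Max_ge) auto
  with m have "n < m" by (metis not_less not_le zless_add1_eq add.commute linorder_not_le less_irrefl order_trans zle_add1_eq_le)
  moreover have "is_record m X"
    unfolding is_record_def using less m by fastforce
  ultimately show ?thesis by blast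
qed

lemma no_regen_sets: "{X. \<forall>m\<ge>n. \<not> regen m X} \<in> sets path_space"
  by (rule path_setsI) measurable

text \<open>A record fails to be a regeneration with probability 1 - p, independently of its past.
  After a failure the walk sets a first record beyond the undershoot, and the induction hypothesis
  applies there. Allowing an arbitrary adapted event \<open>N\<close> is what lets the induction
  restart.\<close>

lemma no_regen_bound:
  assumes "adapted n N" "\<And>X. N X \<Longrightarrow> is_record n X"
  shows "measure (law 0) {X. N X \<and> (\<forall>m\<ge>n. \<not> regen m X)} \<le> (1 - p) ^ k * measure (law 0) {X. N X}"
  using assms
proof (induction k arbitrary: n N)
  case 0
  interpret L: prob_space "law 0" by (rule prob_space_law)
  show ?case using adapted_sets[OF "0.prems"(1)] by (auto intro!: L.finite_measure_mono)
next
  case (Suc k)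
  interpret L: prob_space "law 0" by (rule prob_space_law)
  note N = Suc.prems
  have [measurable]: "Measurable.pred path_space N" by (rule adapted_imp_pred[OF N(1)])
  \<comment> \<open>A record set after \<open>X n\<close> has been undershot: at its time the
    failure at \<open>n\<close> is part of the past, so the first such record again defines an
    adapted event.\<close>
  let ?R = "\<lambda>m X. n < m \<and> is_record m X \<and> (\<exists>i. n < i \<and> i < m \<and> X i < X n)"
  let ?N = "\<lambda>m X. N X \<and> ?R m X \<and> (\<forall>l<m. \<not> ?R l X)"
  let ?F = "{X. N X \<and> \<not> (recentre n X \<in> stay_right)}"
  have ad: "adapted m (?N m)" for m
  proof (cases "n < m")
    case True
    show ?thesis
      unfolding adapted_def
    proof (intro allI impI)
      fix X Y :: path assume eq: "\<forall>i\<le>m. X i = Y i" and X: "?N m X"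
      have "N X = N Y" using eq True by (intro adapted_cong[OF N(1)]) auto
      moreover have "?R l X = ?R l Y" if "l \<le> m" for l
      proof -
        have "is_record l X = is_record l Y"
          using eq that by (intro adapted_cong[OF adapted_is_record]) auto
        moreover have "(\<exists>i. n < i \<and> i < l \<and> X i < X n) = (\<exists>i. n < i \<and> i < l \<and> Y i < Y n)"
          using eq that True by (intro ex_cong1) auto
        ultimately show ?thesis by simp
      qed
      ultimately show "?N m Y" using X by (metis le_less)
    qed
  qed (simp add: adapted_def)
  have sN: "{X. ?N m X} \<in> L.events" for m using adapted_sets[OF ad] by simp
  have disj: "disjoint_family (\<lambda>m. {X. ?N m X})"
    unfolding disjoint_family_on_def
  proof (intro ballI impI)
    fix m m' :: nat assume "m \<noteq> m'"
    then show "{X. ?N m X} \<inter> {X. ?N m' X} = {}"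
      by (cases m m' rule: linorder_cases) blast+
  qed
  have sNR: "{X. ?N m X \<and> (\<forall>l\<ge>m. \<not> regen l X)} \<in> L.events" for m
  proof -
    have "{X. ?N m X \<and> (\<forall>l\<ge>m. \<not> regen l X)} = {X. ?N m X} \<inter> {X. \<forall>l\<ge>m. \<not> regen l X}" by blast
    also have "\<dots> \<in> sets path_space" by (intro sets.Int adapted_sets[OF ad] no_regen_sets)
    finally show ?thesis by simp
  qed
  have "L.prob {X. N X \<and> (\<forall>m\<ge>n. \<not> regen m X)} \<le> L.prob (\<Union>m. {X. ?N m X \<and> (\<forall>l\<ge>m. \<not> regen l X)})"
  proof (rule L.finite_measure_mono_AE)
    show "AE X in law 0. X \<in> {X. N X \<and> (\<forall>m\<ge>n. \<not> regen m X)} \<longrightarrow>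
        X \<in> (\<Union>m. {X. ?N m X \<and> (\<forall>l\<ge>m. \<not> regen l X)})"
      using AE_unbounded_right[OF escape_pos, of 0]
    proof eventually_elim
      case (elim X)
      show ?case
      proof
        assume X: "X \<in> {X. N X \<and> (\<forall>m\<ge>n. \<not> regen m X)}"
        then have "\<not> regen n X" "is_record n X" using N(2) by auto
        then obtain i where i: "n \<le> i" "X i < X n" by (auto simp: regen_def not_le)
        then have "n < i" by (cases "n = i") auto
        obtain m where m: "i < m" "is_record m X" using record_beyond[OF elim, of i] by blast
        with i \<open>n < i\<close> have ex: "\<exists>m. ?R m X" by (intro exI[of _ m]) auto
        define m' where "m' = (LEAST m. ?R m X)"
        have "?R m' X" unfolding m'_def using ex by (rule LeastI_ex)
        moreover have "\<not> ?R l X" if "l < m'" for l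
          using not_less_Least[of l "\<lambda>m. ?R m X"] that unfolding m'_def by blast
        ultimately have "?N m' X" using X by blast
        moreover have "\<forall>l\<ge>m'. \<not> regen l X" using X \<open>?R m' X\<close> by auto
        ultimately show "X \<in> (\<Union>m. {X. ?N m X \<and> (\<forall>l\<ge>m. \<not> regen l X)})" by blast
      qed
    qed
  qed (use sNR in blast)
  also have "\<dots> = (\<Sum>m. L.prob {X. ?N m X \<and> (\<forall>l\<ge>m. \<not> regen l X)})"
    using disj by (intro L.finite_measure_UNION[THEN sums_unique]) (use sNR in \<open>auto simp: disjoint_family_on_def\<close>)
  also have "\<dots> \<le> (\<Sum>m. (1 - p) ^ k * L.prob {X. ?N m X})"
  proof (rule suminf_le)
    show "L.prob {X. ?N m X \<and> (\<forall>l\<ge>m. \<not> regen l X)} \<le> (1 - p) ^ k * L.prob {X. ?N m X}" for m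
      by (rule Suc.IH[OF ad]) blast
    show "summable (\<lambda>m. L.prob {X. ?N m X \<and> (\<forall>l\<ge>m. \<not> regen l X)})"
      using disj by (intro L.finite_measure_UNION[THEN sums_summable]) (use sNR in \<open>auto simp: disjoint_family_on_def\<close>)
    show "summable (\<lambda>m. (1 - p) ^ k * L.prob {X. ?N m X})"
      using disj sN by (intro summable_mult L.finite_measure_UNION[THEN sums_summable]) auto
  qed
  also have "\<dots> = (1 - p) ^ k * (\<Sum>m. L.prob {X. ?N m X})"
    using disj sN by (intro suminf_mult L.finite_measure_UNION[THEN sums_summable]) auto
  also have "(\<Sum>m. L.prob {X. ?N m X}) = L.prob (\<Union>m. {X. ?N m X})"
    using disj sN by (intro L.finite_measure_UNION[THEN sums_unique, symmetric]) auto
  \<comment> \<open>A restart occurs only after a failure at \<open>n\<close>, which supplies the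
    additional factor 1 - p.\<close>
  also have "(1 - p) ^ k * L.prob (\<Union>m. {X. ?N m X}) \<le> (1 - p) ^ k * ((1 - p) * L.prob {X. N X})"
  proof (rule mult_left_mono)
    have sF: "?F \<in> L.events"
    proof -
      have "?F = {X. N X} - {X. N X \<and> recentre n X \<in> stay_right}" by auto
      then show ?thesis
        using adapted_sets[OF N(1)] adapted_recentre_sets[OF N(1) stay_right_sets] by simp
    qed
    have "L.prob (\<Union>m. {X. ?N m X}) \<le> L.prob ?F"
    proof (rule L.finite_measure_mono[OF _ sF], safe)
      fix X i assume "recentre n X \<in> stay_right" "n < i" "X i < X n"
      then show False by (auto simp: recentre_stay_right dest!: spec[of _ i])
    qed
    also have "?F = {X. N X} - {X. N X \<and> recentre n X \<in> stay_right}" by auto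
    also have "L.prob \<dots> = L.prob {X. N X} - L.prob {X. N X \<and> recentre n X \<in> stay_right}"
      by (rule L.finite_measure_Diff) (use adapted_sets[OF N(1)] adapted_recentre_sets[OF N(1) stay_right_sets] in auto)
    also have "L.prob {X. N X \<and> recentre n X \<in> stay_right} = L.prob {X. N X} * p"
      unfolding p_def by (rule renewal[OF N]) auto
    finally show "L.prob (\<Union>m. {X. ?N m X}) \<le> (1 - p) * L.prob {X. N X}" by (simp add: algebra_simps)
  qed (use p_le_1 in simp)
  finally show ?case by (simp add: mult.assoc mult.left_commute)
qed

text \<open>As \<open>k\<close> grows in \<open>no_regen_bound\<close>, almost surely every record
  has a regeneration at or after it, and records occur arbitrarily late.\<close>

lemma AE_regen: "AE X in law 0. \<exists>\<^sub>\<infinity>n. regen n X"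
proof -
  interpret L: prob_space "law 0" by (rule prob_space_law)
  have "AE X in law 0. \<forall>n. \<not> (is_record n X \<and> (\<forall>m\<ge>n. \<not> regen m X))"
  proof (rule AE_all_countable[THEN iffD2, rule_format])
    fix n
    let ?E = "{X. is_record n X \<and> (\<forall>m\<ge>n. \<not> regen m X)}"
    have "(\<lambda>k. (1 - p) ^ k * L.prob {X. is_record n X}) \<longlonglongrightarrow> 0 * L.prob {X. is_record n X}"
      using p_pos p_le_1 by (intro tendsto_mult tendsto_const LIMSEQ_realpow_zero) auto
    then have "L.prob ?E \<le> 0 * L.prob {X. is_record n X}"
      by (rule LIMSEQ_le_const) (use no_regen_bound[OF adapted_is_record] in auto)
    then have "L.prob ?E = 0" by (simp add: measure_le_0_iff)
    moreover have "?E \<in> L.events"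
      unfolding sets_law by (rule path_setsI) measurable
    ultimately show "AE X in law 0. \<not> (is_record n X \<and> (\<forall>m\<ge>n. \<not> regen m X))"
      using L.prob_eq_0[of ?E] by simp
  qed
  then show ?thesis
    using AE_unbounded_right[OF escape_pos, of 0]
  proof eventually_elim
    case (elim X)
    show ?case
      unfolding INFM_nat
    proof
      fix n
      obtain m where m: "n < m" "is_record m X" using record_beyond[OF elim(2)] by blast
      with elim(1) obtain l where "m \<le> l" "regen l X" by blast
      with m show "\<exists>l>n. regen l X" by (intro exI[of _ l]) auto
    qed
  qed
qed

end

text \<open>Before a regeneration the path lies strictly below it, afterwards weakly above, so later
  records and later minima can be tested on the recentred path alone.\<close>

lemma regen_recentre:
  assumes "regen n X"
  shows "regen m (recentre n X) \<longleftrightarrow> regen (n + m) X"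
proof -
  have n: "X i < X n" if "i < n" for i
    using assms that by (simp add: regen_def is_record_def)
  have n': "X n \<le> X i" if "n \<le> i" for i
    using assms that by (simp add: regen_def)
  have "is_record m (recentre n X) \<longleftrightarrow> is_record (n + m) X"
  proof
    assume *: "is_record m (recentre n X)"
    show "is_record (n + m) X"
      unfolding is_record_def
    proof (intro allI impI)
      fix j assume j: "j < n + m"
      show "X j < X (n + m)"
      proof (cases "j < n")
        case True
        then have "X j < X n" by (rule n)
        also have "X n \<le> X (n + m)" by (rule n') simp
        finally show ?thesis .
      next
        case False
        with j have "j - n < m" by simp
        with * have "recentre n X (j - n) < recentre n X m" by (simp add: is_record_def)
        with False show ?thesis by (simp add: recentre_def)
      qed
    qed
  qed (auto simp: is_record_def recentre_def)
  moreover have "(\<forall>i\<ge>m. recentre n X m \<le> recentre n X i) \<longleftrightarrow> (\<forall>i\<ge>n + m. X (n + m) \<le> X i)"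
  proof
    assume *: "\<forall>i\<ge>m. recentre n X m \<le> recentre n X i"
    show "\<forall>i\<ge>n + m. X (n + m) \<le> X i"
    proof (intro allI impI)
      fix i assume "n + m \<le> i"
      then have "recentre n X m \<le> recentre n X (i - n)" "n + (i - n) = i" using * by auto
      then show "X (n + m) \<le> X i" by (simp add: recentre_def)
    qed
  qed (auto simp: recentre_def)
  ultimately show ?thesis by (simp add: regen_def)
qed

section \<open>The sequence of regenerations of a path\<close>

definition good_path :: "path \<Rightarrow> bool" where
  "good_path X \<longleftrightarrow> X \<in> stay_right \<and> (\<exists>\<^sub>\<infinity>n. regen n X)"

text \<open>Time 0 is a regeneration of every good path and has to be excluded. On a path without
  positive regeneration time the value is arbitrary; such paths have probability 0 in the transient
  case.\<close>

definition regen_time :: "path \<Rightarrow> nat" where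
  "regen_time X = (LEAST n. 0 < n \<and> regen n X)"

text \<open>The walk seen from its next regeneration. This is the map to which the law of large
  numbers is applied; it preserves the law of the walk conditioned to stay to the right.\<close>

definition renew :: "path \<Rightarrow> path" where
  "renew X = recentre (regen_time X) X"

lemma measurable_regen_time [measurable]: "regen_time \<in> path_space \<rightarrow>\<^sub>M count_space UNIV"
  unfolding regen_time_def[abs_def] by measurable

lemma measurable_renew [measurable]: "renew \<in> path_space \<rightarrow>\<^sub>M path_space"
  unfolding renew_def[abs_def]
  by (rule measurable_compose_countable[OF measurable_recentre measurable_regen_time])

lemma good_pathD:
  assumes "good_path X"
  shows "0 < regen_time X" "regen (regen_time X) X" "good_path (renew X)"
    and "\<And>n. 0 < n \<Longrightarrow> n < regen_time X \<Longrightarrow> \<not> regen n X"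
proof -
  have "\<exists>n>0. regen n X" using assms by (auto simp: good_path_def INFM_nat)
  then have *: "0 < regen_time X \<and> regen (regen_time X) X"
    unfolding regen_time_def by (rule LeastI_ex)
  then show "0 < regen_time X" "regen (regen_time X) X" by auto
  show "\<not> regen n X" if "0 < n" "n < regen_time X" for n
    using not_less_Least[of n "\<lambda>n. 0 < n \<and> regen n X"] that by (auto simp: regen_time_def)
  have "\<exists>m>n. regen m (renew X)" for n
  proof -
    obtain m where m: "n + regen_time X < m" "regen m X"
      using assms by (auto simp: good_path_def INFM_nat)
    then have "regen (m - regen_time X) (renew X)"
      unfolding renew_def using * by (simp add: regen_recentre)
    with m show ?thesis by (intro exI[of _ "m - regen_time X"]) auto
  qed
  moreover have "renew X \<in> stay_right" using * by (simp add: renew_def regen_iff)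
  ultimately show "good_path (renew X)" by (simp add: good_path_def INFM_nat)
qed

text \<open>Written as a sum along the orbit of \<open>renew\<close>, so that averages over the
  orbit are averages of regeneration times.\<close>

definition nth_regen :: "path \<Rightarrow> nat \<Rightarrow> nat" where
  "nth_regen X k = (\<Sum>i<k. regen_time ((renew ^^ i) X))"

text \<open>A positive regeneration time lies above the start, so nothing is lost by
  \<open>nat\<close>, and the law of large numbers is for natural-number observables.\<close>

definition step_height :: "path \<Rightarrow> nat" where
  "step_height X = nat (X (regen_time X) - X 0)"

lemma good_path_start: "good_path X \<Longrightarrow> regen 0 X"
  by (auto simp: good_path_def regen_def is_record_def stay_right_def)

text \<open>The iterates of \<open>renew\<close> are recentred versions of one path, so the heights
  of the blocks telescope to the position at a regeneration.\<close>

lemma nth_regen_props: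
  assumes "good_path X" "X 0 = 0"
  shows "(renew ^^ k) X = recentre (nth_regen X k) X" "good_path ((renew ^^ k) X)" "regen (nth_regen X k) X"
    and "int (\<Sum>i<k. step_height ((renew ^^ i) X)) = X (nth_regen X k)"
proof -
  have "(renew ^^ k) X = recentre (nth_regen X k) X \<and> good_path ((renew ^^ k) X) \<and> regen (nth_regen X k) X \<and>
    int (\<Sum>i<k. step_height ((renew ^^ i) X)) = X (nth_regen X k)"
  proof (induction k)
    case 0
    then show ?case using assms good_path_start[OF assms(1)]
      by (simp add: nth_regen_def recentre_def)
  next
    case (Suc k)
    let ?Y = "(renew ^^ k) X"
    have Y: "good_path ?Y" "regen (nth_regen X k) X" "?Y = recentre (nth_regen X k) X" using Suc by auto
    have nS: "nth_regen X (Suc k) = nth_regen X k + regen_time ?Y" by (simp add: nth_regen_def)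
    have "regen (regen_time ?Y) (recentre (nth_regen X k) X)"
      using good_pathD(2)[OF Y(1)] by (simp only: Y(3)[symmetric])
    then have rS: "regen (nth_regen X (Suc k)) X"
      unfolding nS by (simp only: regen_recentre[OF Y(2)])
    have "(renew ^^ Suc k) X = recentre (regen_time ?Y) ?Y" by (simp add: renew_def)
    also have "\<dots> = recentre (regen_time ?Y) (recentre (nth_regen X k) X)" using Y(3) by simp
    finally have "(renew ^^ Suc k) X = recentre (nth_regen X (Suc k)) X"
      by (simp only: recentre_recentre nS)
    moreover have "good_path ((renew ^^ Suc k) X)" using good_pathD(3)[OF Y(1)] by simp
    moreover have "int (step_height ?Y) = X (nth_regen X (Suc k)) - X (nth_regen X k)"
    proof -
      have "int (step_height ?Y) = ?Y (regen_time ?Y) - ?Y 0"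
        using good_pathD(1,2)[OF Y(1)] by (auto simp: step_height_def regen_def is_record_def less_imp_le)
      also have "\<dots> = recentre (nth_regen X k) X (regen_time ?Y) - recentre (nth_regen X k) X 0"
        using Y(3) by metis
      also have "\<dots> = X (nth_regen X (Suc k)) - X (nth_regen X k)"
        by (simp add: nS recentre_def)
      finally show ?thesis .
    qed
    ultimately show ?case using rS Suc by simp
  qed
  then show "(renew ^^ k) X = recentre (nth_regen X k) X" "good_path ((renew ^^ k) X)" "regen (nth_regen X k) X"
    "int (\<Sum>i<k. step_height ((renew ^^ i) X)) = X (nth_regen X k)" by auto
qed

lemma nth_regen_Suc: "nth_regen X (Suc k) = nth_regen X k + regen_time ((renew ^^ k) X)"
  by (simp add: nth_regen_def)

lemma strict_mono_nth_regen:
  assumes "good_path X" "X 0 = 0"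
  shows "strict_mono (nth_regen X)"
  using good_pathD(1)[OF nth_regen_props(2)[OF assms]] by (auto simp: strict_mono_Suc_iff nth_regen_Suc)

lemma strict_mono_bracket:
  fixes t :: "nat \<Rightarrow> nat"
  assumes "strict_mono t" "t 0 = 0"
  shows "\<exists>k. t k \<le> n \<and> n < t (Suc k)"
proof -
  have le: "k \<le> t k" for k using assms(1) by (rule strict_mono_imp_increasing)
  have bound: "k \<le> n" if "t k \<le> n" for k using le[of k] that by simp
  define k where "k = (GREATEST k. t k \<le> n)"
  have "t 0 \<le> n" using assms(2) by simp
  then have "t k \<le> n"
    unfolding k_def by (rule GreatestI_nat[where b = n]) (auto intro: bound)
  moreover have "\<not> t (Suc k) \<le> n"
  proof
    assume "t (Suc k) \<le> n"
    then have "Suc k \<le> k"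
      unfolding k_def by (rule Greatest_le_nat[where b = n]) (auto intro: bound)
    then show False by simp
  qed
  ultimately show ?thesis by (auto simp: not_le)
qed

text \<open>A further regeneration between two consecutive members would give the recentred path a
  positive regeneration time below its least one. This allows regeneration levels to be counted
  through the sequence of block heights.\<close>

lemma regen_is_nth_regen:
  assumes X: "good_path X" "X 0 = 0" and n: "regen n X"
  shows "\<exists>k. n = nth_regen X k"
proof -
  have "nth_regen X 0 = 0" by (simp add: nth_regen_def)
  then obtain k where k: "nth_regen X k \<le> n" "n < nth_regen X (Suc k)"
    using strict_mono_bracket[OF strict_mono_nth_regen[OF X]] by blast
  let ?Y = "(renew ^^ k) X"
  have "n = nth_regen X k"
  proof (rule ccontr)
    assume "n \<noteq> nth_regen X k"
    with k have m: "0 < n - nth_regen X k" "n - nth_regen X k < regen_time ?Y"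
      by (auto simp: nth_regen_Suc)
    have "regen (n - nth_regen X k) (recentre (nth_regen X k) X)"
      using n k(1) by (simp add: regen_recentre[OF nth_regen_props(3)[OF X]])
    then have "regen (n - nth_regen X k) ?Y" by (simp only: nth_regen_props(1)[OF X])
    with good_pathD(4)[OF nth_regen_props(2)[OF X] m] show False by simp
  qed
  then show ?thesis ..
qed

text \<open>Between consecutive regenerations the position is squeezed between their heights, and
  the ratio of consecutive indices tends to 1. Using \<open>k / nth_regen X k\<close> rather than
  its inverse includes times of infinite mean, where \<rho> = 0.\<close>

lemma speed_from_regenerations:
  fixes X :: path
  assumes X: "good_path X" "X 0 = 0"
    and a: "(\<lambda>k. real (\<Sum>i<k. step_height ((renew ^^ i) X)) / real k) \<longlonglongrightarrow> \<alpha>"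
    and t: "(\<lambda>k. real k / real (nth_regen X k)) \<longlonglongrightarrow> \<rho>"
  shows "(\<lambda>n. real_of_int (X n) / real n) \<longlonglongrightarrow> \<alpha> * \<rho>"
proof -
  let ?t = "nth_regen X"
  have mono: "strict_mono ?t" by (rule strict_mono_nth_regen[OF X])
  have t0: "?t 0 = 0" by (simp add: nth_regen_def)
  have le: "k \<le> ?t k" for k using mono by (rule strict_mono_imp_increasing)
  define A where "A k = real_of_int (X (?t k))" for k
  have A_eq: "A k = real (\<Sum>i<k. step_height ((renew ^^ i) X))" for k
    unfolding A_def nth_regen_props(4)[OF X, symmetric] by simp
  have a': "(\<lambda>k. A k / real k) \<longlonglongrightarrow> \<alpha>" using a by (simp only: A_eq)
  define k where "k n = (SOME k. ?t k \<le> n \<and> n < ?t (Suc k))" for n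
  have k: "?t (k n) \<le> n" "n < ?t (Suc (k n))" for n
    using someI_ex[OF strict_mono_bracket[OF mono t0], of n] by (auto simp: k_def)
  have k_lim: "filterlim k at_top sequentially"
    unfolding filterlim_at_top
  proof
    fix K
    show "eventually (\<lambda>n. K \<le> k n) sequentially"
      unfolding eventually_sequentially
    proof (intro exI allI impI)
      fix n assume "?t K \<le> n"
      also have "n < ?t (Suc (k n))" by (rule k)
      finally have "K < Suc (k n)" using mono by (simp add: strict_mono_less)
      then show "K \<le> k n" by simp
    qed
  qed
  have ratio: "(\<lambda>k. real k / real (Suc k)) \<longlonglongrightarrow> 1"
    by (rule LIMSEQ_n_over_Suc_n)
  have ratio': "(\<lambda>k. real (Suc k) / real k) \<longlonglongrightarrow> 1"
    by (rule LIMSEQ_Suc_n_over_n)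
  have up: "(\<lambda>k. A (Suc k) / real (Suc k) * (real (Suc k) / real k * (real k / real (?t k)))) \<longlonglongrightarrow> \<alpha> * (1 * \<rho>)"
    by (intro tendsto_mult LIMSEQ_Suc[OF a'] ratio' t)
  have low: "(\<lambda>k. A k / real k * (real k / real (Suc k) * (real (Suc k) / real (?t (Suc k))))) \<longlonglongrightarrow> \<alpha> * (1 * \<rho>)"
    by (intro tendsto_mult a' ratio LIMSEQ_Suc[OF t])
  have conv_up: "(\<lambda>n. A (Suc (k n)) / real (Suc (k n)) * (real (Suc (k n)) / real (k n) * (real (k n) / real (?t (k n))))) \<longlonglongrightarrow> \<alpha> * (1 * \<rho>)"
    by (rule filterlim_compose[OF up k_lim])
  have conv_low: "(\<lambda>n. A (k n) / real (k n) * (real (k n) / real (Suc (k n)) * (real (Suc (k n)) / real (?t (Suc (k n)))))) \<longlonglongrightarrow> \<alpha> * (1 * \<rho>)"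
    by (rule filterlim_compose[OF low k_lim])
  have ev: "eventually (\<lambda>n. 1 \<le> k n) sequentially"
    using k_lim by (simp add: filterlim_at_top)
  have nonneg: "0 \<le> X n" for n
    using X by (auto simp: good_path_def stay_right_def)
  have ev_low: "eventually (\<lambda>n. A (k n) / real (k n) * (real (k n) / real (Suc (k n)) * (real (Suc (k n)) / real (?t (Suc (k n))))) \<le> real_of_int (X n) / real n) sequentially"
    using ev
  proof eventually_elim
    case (elim n)
    have "A (k n) \<le> real_of_int (X n)"
      using nth_regen_props(3)[OF X, of "k n"] k(1)[of n] by (simp add: A_def regen_def)
    moreover have "0 < n" using elim k(1)[of n] le[of "k n"] by linarith
    ultimately have "A (k n) / real (?t (Suc (k n))) \<le> real_of_int (X n) / real n"
      using k(2)[of n] nonneg[of n] by (intro frac_le) auto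
    then show ?case using elim by simp
  qed
  have ev_up: "eventually (\<lambda>n. real_of_int (X n) / real n \<le> A (Suc (k n)) / real (Suc (k n)) * (real (Suc (k n)) / real (k n) * (real (k n) / real (?t (k n))))) sequentially"
    using ev
  proof eventually_elim
    case (elim n)
    have "X n < X (?t (Suc (k n)))"
      using nth_regen_props(3)[OF X, of "Suc (k n)"] k(2)[of n] by (simp add: regen_def is_record_def)
    then have "real_of_int (X n) \<le> A (Suc (k n))" by (simp add: A_def)
    moreover have "0 < ?t (k n)" using elim le[of "k n"] by linarith
    ultimately have "real_of_int (X n) / real n \<le> A (Suc (k n)) / real (?t (k n))"
      using k(1)[of n] nonneg[of n] nonneg[of "?t (Suc (k n))"] by (intro frac_le) (auto simp: A_def)
    then show ?case using elim by simp
  qed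
  from tendsto_sandwich[OF ev_low ev_up conv_low conv_up] show ?thesis by simp
qed

text \<open>What can be read off at time \<open>b\<close> of the statement
  \<open>regen_time X = b\<close>: every earlier candidate must have been undershot by then.\<close>

definition first_regen_at :: "nat \<Rightarrow> path \<Rightarrow> bool" where
  "first_regen_at b X \<longleftrightarrow> 0 < b \<and> is_record b X \<and> (\<forall>i\<le>b. X 0 \<le> X i) \<and>
     (\<forall>i. 0 < i \<and> i < b \<longrightarrow> \<not> (is_record i X \<and> (\<forall>j. i \<le> j \<and> j \<le> b \<longrightarrow> X i \<le> X j)))"

lemma adapted_first_regen_at: "adapted b (first_regen_at b)"
  unfolding adapted_def
proof (intro allI impI)
  fix X Y :: path assume eq: "\<forall>i\<le>b. X i = Y i" and X: "first_regen_at b X"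
  have rec: "is_record i X = is_record i Y" if "i \<le> b" for i
    using eq that by (intro adapted_cong[OF adapted_is_record]) auto
  show "first_regen_at b Y"
    unfolding first_regen_at_def
  proof (intro conjI allI impI)
    show "0 < b" "is_record b Y" using X rec[of b] by (auto simp: first_regen_at_def)
    show "Y 0 \<le> Y i" if "i \<le> b" for i
      using X eq that by (auto simp: first_regen_at_def)
    fix i assume i: "0 < i \<and> i < b"
    show "\<not> (is_record i Y \<and> (\<forall>j. i \<le> j \<and> j \<le> b \<longrightarrow> Y i \<le> Y j))"
    proof
      assume *: "is_record i Y \<and> (\<forall>j. i \<le> j \<and> j \<le> b \<longrightarrow> Y i \<le> Y j)"
      then have "is_record i X" using rec[of i] i by simp
      moreover have "X i \<le> X j" if "i \<le> j" "j \<le> b" for j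
        using * eq i that by auto
      ultimately show False using X i by (auto simp: first_regen_at_def)
    qed
  qed
qed

text \<open>If the path never falls below \<open>X b\<close> after time \<open>b\<close>, an earlier
  record that was not undershot up to \<open>b\<close> is never undershot, as \<open>X b\<close> is
  above it. So the future enters only through \<open>recentre b X \<in> stay_right\<close>, and the
  renewal formula applies.\<close>

lemma first_regen_at_iff:
  "first_regen_at b X \<and> recentre b X \<in> stay_right \<longleftrightarrow>
   X \<in> stay_right \<and> (\<exists>n>0. regen n X) \<and> regen_time X = b"
proof
  assume *: "first_regen_at b X \<and> recentre b X \<in> stay_right"
  then have b: "regen b X" "0 < b" by (auto simp: regen_iff first_regen_at_def)
  have 0: "X 0 \<le> X i" for i
  proof (cases "i \<le> b")
    case True
    with * show ?thesis by (auto simp: first_regen_at_def)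
  next
    case False
    then have "X b \<le> X i" using b by (simp add: regen_def)
    moreover have "X 0 \<le> X b" using * by (auto simp: first_regen_at_def)
    ultimately show ?thesis by linarith
  qed
  have "regen_time X = b"
    unfolding regen_time_def
  proof (rule Least_equality)
    show "0 < b \<and> regen b X" using b by simp
    fix i assume i: "0 < i \<and> regen i X"
    show "b \<le> i"
    proof (rule ccontr)
      assume "\<not> b \<le> i"
      with i * show False by (auto simp: first_regen_at_def regen_def)
    qed
  qed
  with 0 b show "X \<in> stay_right \<and> (\<exists>n>0. regen n X) \<and> regen_time X = b"
    by (auto simp: stay_right_def)
next
  assume *: "X \<in> stay_right \<and> (\<exists>n>0. regen n X) \<and> regen_time X = b"
  then have ex: "\<exists>n>0. regen n X" by blast
  have b: "0 < b \<and> regen b X"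
    using LeastI_ex[OF ex] * by (simp add: regen_time_def)
  have "\<not> (is_record i X \<and> (\<forall>j. i \<le> j \<and> j \<le> b \<longrightarrow> X i \<le> X j))" if i: "0 < i" "i < b" for i
  proof
    assume r: "is_record i X \<and> (\<forall>j. i \<le> j \<and> j \<le> b \<longrightarrow> X i \<le> X j)"
    have "X i \<le> X j" if "i \<le> j" for j
    proof (cases "j \<le> b")
      case False
      then have "X b \<le> X j" using b by (simp add: regen_def)
      moreover have "X i \<le> X b" using r i by auto
      ultimately show ?thesis by linarith
    qed (use r that in blast)
    then have "regen i X" using r by (simp add: regen_def)
    moreover have "\<not> regen i X"
      using not_less_Least[of i "\<lambda>n. 0 < n \<and> regen n X"] i * by (auto simp: regen_time_def)
    ultimately show False by simp
  qed
  with b * show "first_regen_at b X \<and> recentre b X \<in> stay_right"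
    by (auto simp: first_regen_at_def regen_iff stay_right_def)
qed


text \<open>From some \<open>k0\<close> on, \<open>A k\<close> is at least 2 k / r, so A k \<le> n
  leaves at most k0 + r n / 2 indices; the other half of \<open>r\<close> absorbs
  \<open>k0\<close>.\<close>

lemma count_below_sublinear:
  fixes A :: "nat \<Rightarrow> nat"
  assumes A: "filterlim (\<lambda>k. real (A k) / real k) at_top sequentially"
  shows "(\<lambda>n. real (card {k. 1 \<le> k \<and> A k \<le> n}) / real n) \<longlonglongrightarrow> 0"
proof (rule LIMSEQ_I)
  fix r :: real assume r: "r > 0"
  have "eventually (\<lambda>k. 2 / r \<le> real (A k) / real k) sequentially"
    using A by (simp add: filterlim_at_top)
  then obtain k0 where k0: "\<And>k. k \<ge> k0 \<Longrightarrow> 2 / r \<le> real (A k) / real k"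
    by (auto simp: eventually_sequentially)
  obtain n0 :: nat where n0: "2 * (real k0 + 1) / r < real n0" using reals_Archimedean2 by blast
  show "\<exists>n0. \<forall>n\<ge>n0. norm (real (card {k. 1 \<le> k \<and> A k \<le> n}) / real n - 0) < r"
  proof (intro exI[of _ "max 1 n0"] allI impI)
    fix n assume n: "max 1 n0 \<le> n"
    let ?m = "nat \<lfloor>r / 2 * real n\<rfloor>"
    have "{k. 1 \<le> k \<and> A k \<le> n} \<subseteq> {..<k0} \<union> {1..?m}"
    proof
      fix k assume k: "k \<in> {k. 1 \<le> k \<and> A k \<le> n}"
      show "k \<in> {..<k0} \<union> {1..?m}"
      proof (cases "k < k0")
        case False
        then have "2 / r \<le> real (A k) / real k" using k0 by simp
        then have "real k \<le> r / 2 * real (A k)" using k r by (simp add: field_simps)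
        also have "\<dots> \<le> r / 2 * real n" using k r by (intro mult_left_mono) auto
        finally have "k \<le> ?m" by (simp add: le_nat_floor)
        with k show ?thesis by simp
      qed simp
    qed
    then have "card {k. 1 \<le> k \<and> A k \<le> n} \<le> card ({..<k0} \<union> {1..?m})"
      by (intro card_mono) auto
    also have "\<dots> \<le> card {..<k0} + card {1..?m}" by (rule card_Un_le)
    finally have "real (card {k. 1 \<le> k \<and> A k \<le> n}) \<le> real k0 + real ?m" by simp
    also have "real ?m \<le> r / 2 * real n" using r by (intro of_nat_floor) simp
    also have "real k0 + r / 2 * real n < r * real n"
    proof -
      have "2 * (real k0 + 1) < r * real n0" using n0 r by (simp add: field_simps)
      also have "\<dots> \<le> r * real n" using n r by simp
      finally show ?thesis by simp
    qed
    finally have "real (card {k. 1 \<le> k \<and> A k \<le> n}) < r * real n" by simp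
    then show "norm (real (card {k. 1 \<le> k \<and> A k \<le> n}) / real n - 0) < r"
      using n by (simp add: pos_divide_less_eq)
  qed
qed

section \<open>Stationarity and independence of the blocks under the conditioned law\<close>

context transient_environment
begin

text \<open>Conditioning on \<open>stay_right\<close> makes time 0 a regeneration, so that the first
  block has the same law as the later ones.\<close>

definition renewal_law :: "path measure" where
  "renewal_law = uniform_measure (law 0) stay_right"

lemma sets_renewal_law [simp, measurable_cong]: "sets renewal_law = sets path_space"
  by (simp add: renewal_law_def)

lemma space_renewal_law [simp]: "space renewal_law = UNIV"
  using sets_eq_imp_space_eq[OF sets_renewal_law] by simp

lemma prob_space_renewal_law: "prob_space renewal_law"
  unfolding renewal_law_def
  by (rule prob_space_uniform_measure) (use escape_pos law_eq[of stay_right] in auto)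

lemma renewal_law_eq: "B \<in> sets path_space \<Longrightarrow>
    measure renewal_law B = measure (law 0) (stay_right \<inter> B) / p"
  unfolding renewal_law_def p_def
  by (rule measure_uniform_measure) (use escape_pos law_eq[of stay_right] in auto)

lemma AE_renewal_law: "AE X in law 0. P X \<Longrightarrow> AE X in renewal_law. P X"
  unfolding renewal_law_def by (rule AE_uniform_measureI) auto

lemma AE_renewal_law_stay_right: "AE X in renewal_law. X \<in> stay_right"
  unfolding renewal_law_def by (rule AE_uniform_measureI) auto

lemma AE_good_path: "AE X in renewal_law. good_path X"
  using AE_renewal_law_stay_right AE_renewal_law[OF AE_regen]
  by eventually_elim (simp add: good_path_def)

context
  fixes \<phi> :: "nat \<Rightarrow> path \<Rightarrow> nat"
  assumes \<phi>: "\<And>b C. adapted b (\<lambda>X. \<phi> b X \<in> C)"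
begin

lemma measurable_block [measurable]: "(\<lambda>X. \<phi> (regen_time X) X) \<in> path_space \<rightarrow>\<^sub>M count_space UNIV"
proof (rule measurable_compose_countable[OF _ measurable_regen_time])
  fix b
  show "\<phi> b \<in> path_space \<rightarrow>\<^sub>M count_space UNIV"
  proof (rule measurableI)
    fix C
    have "\<phi> b -` C \<inter> space path_space = {X. \<phi> b X \<in> C}" by auto
    then show "\<phi> b -` C \<inter> space path_space \<in> sets path_space" using adapted_sets[OF \<phi>] by simp
  qed simp
qed

text \<open>Sum over the value \<open>b\<close> of the regeneration time: each term is an adapted
  record event followed by a path in \<open>B\<close>, to which \<open>renewal\<close>
  applies.\<close>

lemma block_renewal_aux:
  assumes B: "B \<in> sets path_space" "B \<subseteq> stay_right"
  shows "measure (law 0) {X. X \<in> stay_right \<and> \<phi> (regen_time X) X \<in> C \<and> renew X \<in> B} =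
    (\<Sum>b. measure (law 0) {X. first_regen_at b X \<and> \<phi> b X \<in> C}) * measure (law 0) B"
proof -
  interpret L: prob_space "law 0" by (rule prob_space_law)
  let ?N = "\<lambda>b X. first_regen_at b X \<and> \<phi> b X \<in> C"
  let ?E = "\<lambda>b. {X. ?N b X \<and> recentre b X \<in> B}"
  let ?F = "\<lambda>b. {X. ?N b X \<and> recentre b X \<in> stay_right}"
  have ad: "adapted b (?N b)" for b
    by (rule adapted_conj[OF adapted_first_regen_at \<phi>])
  have E_iff: "X \<in> ?E b \<longleftrightarrow> X \<in> stay_right \<and> (\<exists>n>0. regen n X) \<and> regen_time X = b \<and> \<phi> b X \<in> C \<and> recentre b X \<in> B" for X b
    using first_regen_at_iff[of b X] B(2) by blast
  have disj: "disjoint_family ?E"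
    unfolding disjoint_family_on_def
  proof (intro ballI impI equals0I)
    fix m n X assume "m \<noteq> n" "X \<in> ?E m \<inter> ?E n"
    then have "regen_time X = m" "regen_time X = n"
      using E_iff[of X m] E_iff[of X n] by blast+
    with \<open>m \<noteq> n\<close> show False by simp
  qed
  have sE: "?E b \<in> L.events" for b
    using adapted_recentre_sets[OF ad B(1)] by simp
  have disjF: "disjoint_family ?F"
    unfolding disjoint_family_on_def
  proof (intro ballI impI equals0I)
    fix m n X assume "m \<noteq> n" "X \<in> ?F m \<inter> ?F n"
    with first_regen_at_iff[of m X] first_regen_at_iff[of n X] show False by auto
  qed
  have sF: "?F b \<in> L.events" for b
    using adapted_recentre_sets[OF ad stay_right_sets] by simp
  \<comment> \<open>The events \<open>first_regen_at b\<close> need not be disjoint. Summability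
    comes from the disjoint events in which the path stays to the right afterwards; these have
    \<open>p\<close> times the probability.\<close>
  have renF: "L.prob (?F b) = L.prob {X. ?N b X} * p" for b
    unfolding p_def by (rule renewal[OF ad]) (auto simp: first_regen_at_def)
  have "summable (\<lambda>b. L.prob (?F b))"
    using disjF sF by (intro L.finite_measure_UNION[THEN sums_summable]) auto
  then have "summable (\<lambda>b. L.prob {X. ?N b X} * p)" by (simp only: renF)
  then have summ: "summable (\<lambda>b. L.prob {X. ?N b X})"
    using summable_mult2[of "\<lambda>b. L.prob {X. ?N b X} * p" "1 / p"] p_pos by simp
  have sl: "{X. X \<in> stay_right \<and> \<phi> (regen_time X) X \<in> C \<and> renew X \<in> B} \<in> L.events"
    unfolding sets_law by (rule path_setsI) (use B(1) in measurable)
  have "L.prob {X. X \<in> stay_right \<and> \<phi> (regen_time X) X \<in> C \<and> renew X \<in> B} = L.prob (\<Union>b. ?E b)"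
  proof (rule L.finite_measure_eq_AE)
    show "AE X in law 0. (X \<in> {X. X \<in> stay_right \<and> \<phi> (regen_time X) X \<in> C \<and> renew X \<in> B}) = (X \<in> (\<Union>b. ?E b))"
      using AE_regen
    proof eventually_elim
      case (elim X)
      have "\<exists>n>0. regen n X" using elim by (auto simp: INFM_nat)
      then show ?case using E_iff[of X] by (auto simp: renew_def)
    qed
  qed (use sl sE in blast)+
  also have "\<dots> = (\<Sum>b. L.prob (?E b))"
    using disj sE by (intro L.finite_measure_UNION[THEN sums_unique]) auto
  also have "\<dots> = (\<Sum>b. L.prob {X. ?N b X} * L.prob B)"
    by (intro suminf_cong renewal[OF ad _ B]) (simp add: first_regen_at_def)
  also have "\<dots> = (\<Sum>b. L.prob {X. ?N b X}) * L.prob B"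
    by (rule suminf_mult2[symmetric, OF summ])
  finally show ?thesis .
qed

lemma AE_law_renew: "AE X in law 0. renew X \<in> stay_right"
  using AE_regen
proof eventually_elim
  case (elim X)
  then have ex: "\<exists>n>0. regen n X" by (auto simp: INFM_nat)
  have "regen (regen_time X) X" using LeastI_ex[OF ex] by (simp add: regen_time_def)
  then show ?case by (simp add: renew_def regen_iff)
qed

text \<open>Conditioning divides both sides by \<open>p\<close>. Restricting \<open>B\<close> to
  \<open>stay_right\<close> is free, because a path restarted at a regeneration never goes left of
  its start.\<close>

lemma block_renewal:
  assumes B: "B \<in> sets path_space"
  shows "measure renewal_law {X. \<phi> (regen_time X) X \<in> C \<and> renew X \<in> B} =
    (\<Sum>b. measure (law 0) {X. first_regen_at b X \<and> \<phi> b X \<in> C}) * measure renewal_law B"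
proof -
  interpret L: prob_space "law 0" by (rule prob_space_law)
  have B': "B \<inter> stay_right \<in> sets path_space" "B \<inter> stay_right \<subseteq> stay_right" using B by auto
  have s: "{X. \<phi> (regen_time X) X \<in> C \<and> renew X \<in> B} \<in> sets path_space" if "B \<in> sets path_space" for B
    by (rule path_setsI) (use that in measurable)
  have "L.prob (stay_right \<inter> {X. \<phi> (regen_time X) X \<in> C \<and> renew X \<in> B}) =
      L.prob {X. X \<in> stay_right \<and> \<phi> (regen_time X) X \<in> C \<and> renew X \<in> B \<inter> stay_right}"
  proof (rule L.finite_measure_eq_AE)
    show "AE X in law 0. (X \<in> stay_right \<inter> {X. \<phi> (regen_time X) X \<in> C \<and> renew X \<in> B}) =
        (X \<in> {X. X \<in> stay_right \<and> \<phi> (regen_time X) X \<in> C \<and> renew X \<in> B \<inter> stay_right})"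
      using AE_law_renew by eventually_elim auto
    show "stay_right \<inter> {X. \<phi> (regen_time X) X \<in> C \<and> renew X \<in> B} \<in> L.events"
      using s[OF B] by auto
    have "{X. X \<in> stay_right \<and> \<phi> (regen_time X) X \<in> C \<and> renew X \<in> B \<inter> stay_right} =
      stay_right \<inter> {X. \<phi> (regen_time X) X \<in> C \<and> renew X \<in> B \<inter> stay_right}" by auto
    then show "{X. X \<in> stay_right \<and> \<phi> (regen_time X) X \<in> C \<and> renew X \<in> B \<inter> stay_right} \<in> L.events"
      using s[OF B'(1)] by auto
  qed
  also have "\<dots> = (\<Sum>b. L.prob {X. first_regen_at b X \<and> \<phi> b X \<in> C}) * L.prob (B \<inter> stay_right)"
    by (rule block_renewal_aux[OF B'])
  finally show ?thesis
    by (simp add: renewal_law_eq[OF s[OF B]] renewal_law_eq[OF B] Int_commute)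
qed

end

text \<open>With no condition on the block, the renewal formula gives a multiple of the law; total
  mass 1 fixes the factor.\<close>

lemma renew_preserves: "distr renewal_law renewal_law renew = renewal_law"
proof (rule measure_eqI)
  interpret R: prob_space renewal_law by (rule prob_space_renewal_law)
  let ?r = "\<Sum>b. measure (law 0) {X. first_regen_at b X \<and> b \<in> UNIV}"
  have ad: "adapted b (\<lambda>X. b \<in> C)" for b C by (simp add: adapted_def)
  have ren: "R.prob {X. renew X \<in> B} = ?r * R.prob B" if "B \<in> sets path_space" for B
    using block_renewal[of "\<lambda>b X. b", OF ad that, of UNIV] by simp
  have top: "UNIV \<in> sets path_space" using sets.top[of path_space] by simp
  have "?r = 1" using ren[OF top] R.prob_space by simp
  fix A assume "A \<in> sets (distr renewal_law renewal_law renew)"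
  then have A: "A \<in> sets path_space" by simp
  have "emeasure (distr renewal_law renewal_law renew) A = emeasure renewal_law {X. renew X \<in> A}"
    using A by (subst emeasure_distr) (auto simp: vimage_def)
  then show "emeasure (distr renewal_law renewal_law renew) A = emeasure renewal_law A"
    using ren[OF A] \<open>?r = 1\<close> by (simp add: R.emeasure_eq_measure)
qed simp

lemma measure_preserving_renew: "measure_preserving renewal_law renew"
  unfolding measure_preserving_def measure_preserving_axioms_def
  using prob_space_renewal_law renew_preserves by simp

text \<open>For i \<ge> 1 the later block is a function of \<open>renew X\<close>, so
  \<open>block_renewal\<close> separates it from the first one; stationarity then moves it back to
  the first block.\<close>

lemma blocks_independent:
  assumes \<phi>: "\<And>b C. adapted b (\<lambda>X. \<phi> b X \<in> C)" and i: "i \<ge> 1"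
  defines "f \<equiv> \<lambda>X. \<phi> (regen_time X) X :: nat"
  shows "measure renewal_law {X \<in> space renewal_law. f X \<in> A \<and> f ((renew ^^ i) X) \<in> B} =
    measure renewal_law {X \<in> space renewal_law. f X \<in> A} * measure renewal_law {X \<in> space renewal_law. f X \<in> B}"
proof -
  interpret R: measure_preserving renewal_law renew by (rule measure_preserving_renew)
  have [measurable]: "f \<in> path_space \<rightarrow>\<^sub>M count_space UNIV"
    unfolding f_def by (rule measurable_block[OF \<phi>])
  have [measurable]: "(renew ^^ k) \<in> path_space \<rightarrow>\<^sub>M path_space" for k
    using R.measurable_funpow[of k] by simp
  let ?r = "\<Sum>b. measure (law 0) {X. first_regen_at b X \<and> \<phi> b X \<in> A}"
  obtain k where k: "i = Suc k" using i by (cases i) auto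
  let ?G = "{X. f ((renew ^^ k) X) \<in> B}"
  have G: "?G \<in> sets path_space"
    by (rule path_setsI) measurable
  have top: "UNIV \<in> sets path_space" using sets.top[of path_space] by simp
  have "R.prob {X. f X \<in> A} = ?r"
    using block_renewal[of \<phi>, OF \<phi> top, of A] R.prob_space by (simp add: f_def)
  moreover have "R.prob {X. f X \<in> A \<and> renew X \<in> ?G} = ?r * R.prob ?G"
    using block_renewal[of \<phi>, OF \<phi> G, of A] by (simp only: f_def)
  moreover have "{X. f X \<in> A \<and> f ((renew ^^ i) X) \<in> B} = {X. f X \<in> A \<and> renew X \<in> ?G}"
    by (simp add: k funpow_swap1)
  moreover have "R.prob ?G = R.prob {X. f X \<in> B}"
  proof -
    have fB: "{X. f X \<in> B} \<in> sets renewal_law"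
      unfolding sets_renewal_law by (rule path_setsI) measurable
    have "R.prob {X. f X \<in> B} = measure (distr renewal_law renewal_law (renew ^^ k)) {X. f X \<in> B}"
      by (simp only: R.distr_funpow)
    also have "\<dots> = R.prob ?G"
      using fB by (subst measure_distr) (auto simp: vimage_def)
    finally show ?thesis by simp
  qed
  ultimately show ?thesis by simp
qed

end

lemma velocity_sets: "{X. (\<lambda>n. real_of_int (X n) / real n) \<longlonglongrightarrow> v} \<in> sets path_space"
proof -
  have [measurable]: "Measurable.pred path_space (\<lambda>X. \<bar>real_of_int (X n) / real n - v\<bar> < inverse (real (Suc l)))" for n l
    by (rule adapted_imp_pred[of n]) (simp add: adapted_def)
  have "(\<lambda>n. real_of_int (X n) / real n) \<longlonglongrightarrow> v \<longleftrightarrow>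
    (\<forall>l. \<exists>N. \<forall>n\<ge>N. \<bar>real_of_int (X n) / real n - v\<bar> < inverse (real (Suc l)))" for X :: path
  proof
    assume "(\<lambda>n. real_of_int (X n) / real n) \<longlonglongrightarrow> v"
    from LIMSEQ_D[OF this] show "\<forall>l. \<exists>N. \<forall>n\<ge>N. \<bar>real_of_int (X n) / real n - v\<bar> < inverse (real (Suc l))"
      by (simp add: real_norm_def del: of_nat_Suc)
  next
    assume *: "\<forall>l. \<exists>N. \<forall>n\<ge>N. \<bar>real_of_int (X n) / real n - v\<bar> < inverse (real (Suc l))"
    show "(\<lambda>n. real_of_int (X n) / real n) \<longlonglongrightarrow> v"
    proof (rule LIMSEQ_I)
      fix r :: real assume "r > 0"
      then obtain l where l: "inverse (real (Suc l)) < r" using reals_Archimedean by blast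
      obtain N where N: "\<forall>n\<ge>N. \<bar>real_of_int (X n) / real n - v\<bar> < inverse (real (Suc l))" using * by blast
      show "\<exists>N. \<forall>n\<ge>N. norm (real_of_int (X n) / real n - v) < r"
        using N l by (intro exI[of _ N]) (auto simp del: of_nat_Suc intro: less_trans)
    qed
  qed
  then have "{X. (\<lambda>n. real_of_int (X n) / real n) \<longlonglongrightarrow> v} =
    {X \<in> space path_space. \<forall>l. \<exists>N. \<forall>n\<ge>N. \<bar>real_of_int (X n) / real n - v\<bar> < inverse (real (Suc l))}" by simp
  also have "\<dots> \<in> sets path_space" by measurable
  finally show ?thesis .
qed

text \<open>Dropping \<open>n\<close> steps changes the denominator by a factor tending to 1 and the
  numerator by a constant.\<close>

lemma velocity_recentre:
  assumes "(\<lambda>i. real_of_int (recentre n X i) / real i) \<longlonglongrightarrow> v"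
  shows "(\<lambda>i. real_of_int (X i) / real i) \<longlonglongrightarrow> v"
proof (rule LIMSEQ_offset[where k = n])
  have l1: "(\<lambda>i. real_of_int (X n) / real (i + n)) \<longlonglongrightarrow> 0"
    using LIMSEQ_ignore_initial_segment[OF lim_const_over_n[of "real_of_int (X n)"], of n] by simp
  have "(\<lambda>i. 1 - real n / real (i + n)) \<longlonglongrightarrow> 1 - 0"
    using LIMSEQ_ignore_initial_segment[OF lim_const_over_n[of "real n"], of n]
    by (intro tendsto_diff tendsto_const) simp
  then have "(\<lambda>i. real_of_int (recentre n X i) / real i * (1 - real n / real (i + n)) + real_of_int (X n) / real (i + n)) \<longlonglongrightarrow> v * 1 + 0"
    by (intro tendsto_add tendsto_mult assms l1) simp
  moreover have "eventually (\<lambda>i. real_of_int (recentre n X i) / real i * (1 - real n / real (i + n)) + real_of_int (X n) / real (i + n)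
    = real_of_int (X (i + n)) / real (i + n)) sequentially"
    using eventually_gt_at_top[of 0]
  proof eventually_elim
    case (elim i)
    have "1 - real n / real (i + n) = real i / real (i + n)"
      using elim by (simp add: field_simps)
    moreover have "real_of_int (recentre n X i) / real i * (real i / real (i + n)) = real_of_int (recentre n X i) / real (i + n)"
      using elim by simp
    ultimately have "real_of_int (recentre n X i) / real i * (1 - real n / real (i + n)) + real_of_int (X n) / real (i + n) =
        (real_of_int (recentre n X i) + real_of_int (X n)) / real (i + n)"
      by (simp only: add_divide_distrib)
    then show ?case by (simp only: recentre_def add.commute[of n]) simp
  qed
  ultimately show "(\<lambda>i. real_of_int (X (i + n)) / real (i + n)) \<longlonglongrightarrow> v"
    using Lim_transform_eventually by fastforce
qed

section \<open>Density of record levels and regeneration levels\<close>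

definition level_hit :: "(nat \<Rightarrow> path \<Rightarrow> bool) \<Rightarrow> nat \<Rightarrow> path set" where
  "level_hit R x = {X. \<exists>m. R m X \<and> X m = int x}"

lemma level_hit_sets:
  assumes "\<And>m. Measurable.pred path_space (R m)"
  shows "level_hit R x \<in> sets path_space"
proof -
  note assms [measurable]
  show ?thesis
    unfolding level_hit_def by (rule path_setsI) measurable
qed

text \<open>The first passage above \<open>(j - 1) W\<close> is a record and overshoots by at most
  \<open>W\<close>, so each of \<open>K\<close> consecutive intervals of length \<open>W\<close>
  contains a record level.\<close>

lemma records_dense:
  fixes X :: path
  assumes X0: "X 0 = 0" and jump: "\<And>n. \<bar>X (Suc n) - X n\<bar> \<le> int W" and ub: "X \<in> unbounded_right" and W: "W \<ge> 1"
  shows "K \<le> card {x \<in> {1..K * W}. X \<in> level_hit is_record x}"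
proof -
  have "\<exists>x. (j - 1) * W < x \<and> x \<le> j * W \<and> X \<in> level_hit is_record x" if j: "j \<in> {1..K}" for j
  proof -
    let ?c = "int ((j - 1) * W)"
    have ex: "\<exists>n. ?c < X n"
    proof -
      obtain n where "?c + 1 \<le> X n" using ub by (auto simp: unbounded_right_def)
      then show ?thesis by (intro exI[of _ n]) simp
    qed
    define n where "n = (LEAST n. ?c < X n)"
    have n: "?c < X n" unfolding n_def using ex by (rule LeastI_ex)
    have less: "X i \<le> ?c" if "i < n" for i
      using not_less_Least[of i "\<lambda>n. ?c < X n"] that by (simp add: n_def)
    have c: "0 \<le> ?c" by (rule of_nat_0_le_iff)
    have "n \<noteq> 0"
    proof
      assume "n = 0"
      with X0 have "X n = 0" by simp
      with n c show False by linarith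
    qed
    then obtain k where k: "n = Suc k" by (cases n) auto
    have up: "X n \<le> ?c + int W" using less[of k] jump[of k] k by auto
    have "?c + int W = int (j * W)" using j by (cases j) auto
    with up have "nat (X n) \<le> j * W" by linarith
    moreover have "(j - 1) * W < nat (X n)" using n c by linarith
    moreover have "is_record n X" using less n unfolding is_record_def by fastforce
    then have "X \<in> level_hit is_record (nat (X n))"
      using n c unfolding level_hit_def by (intro CollectI exI[of _ n] conjI) linarith+
    ultimately show ?thesis by blast
  qed
  then obtain f where f: "\<And>j. j \<in> {1..K} \<Longrightarrow> (j - 1) * W < f j \<and> f j \<le> j * W \<and> X \<in> level_hit is_record (f j)"
    by metis
  have less: "f i < f j" if "i \<in> {1..K}" "j \<in> {1..K}" "i < j" for i j
  proof -
    have "f i \<le> i * W" using f that by blast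
    also have "\<dots> \<le> (j - 1) * W" using that by (intro mult_le_mono1) simp
    also have "\<dots> < f j" using f that by blast
    finally show ?thesis .
  qed
  have inj: "inj_on f {1..K}"
  proof (rule inj_onI)
    fix i j assume "i \<in> {1..K}" "j \<in> {1..K}" "f i = f j"
    then show "i = j" using less[of i j] less[of j i] by (cases i j rule: linorder_cases) auto
  qed
  have "f ` {1..K} \<subseteq> {x \<in> {1..K * W}. X \<in> level_hit is_record x}"
  proof
    fix x assume "x \<in> f ` {1..K}"
    then obtain j where j: "j \<in> {1..K}" "x = f j" by blast
    have "f j \<le> j * W" using f[OF j(1)] by blast
    also have "j * W \<le> K * W" using j by (intro mult_le_mono1) simp
    finally have "x \<le> K * W" using j(2) by simp
    moreover have "1 \<le> x" "X \<in> level_hit is_record x" using f[OF j(1)] j(2) by simp_all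
    ultimately show "x \<in> {x \<in> {1..K * W}. X \<in> level_hit is_record x}" by simp
  qed
  from card_inj_on_le[OF inj this] show ?thesis by simp
qed

context transient_environment
begin

text \<open>A path has at most one record at height \<open>x\<close>, and such a record becomes a
  regeneration with probability \<open>p\<close>. Staying to the right of the start is asked only up
  to the record time, which keeps the event adapted; after a regeneration it holds by
  itself.\<close>

lemma regen_level_ge:
  "p * measure renewal_law (level_hit is_record x) \<le> measure renewal_law (level_hit regen x)"
proof -
  interpret L: prob_space "law 0" by (rule prob_space_law)
  let ?N = "\<lambda>m X. is_record m X \<and> X m = int x \<and> (\<forall>i\<le>m. X 0 \<le> X i)"
  have ad: "adapted m (?N m)" for m
    by (intro adapted_conj adapted_is_record) (auto simp: adapted_def)
  have uniq: "m = m'" if "?N m X" "?N m' X" for m m' :: nat and X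
    using that unfolding is_record_def by (cases m m' rule: linorder_cases) auto
  have disj: "disjoint_family (\<lambda>m. {X. ?N m X})"
    unfolding disjoint_family_on_def
  proof (intro ballI impI equals0I)
    fix m m' X assume "m \<noteq> m'" "X \<in> {X. ?N m X} \<inter> {X. ?N m' X}"
    with uniq[of m X m'] show False by simp
  qed
  have disj': "disjoint_family (\<lambda>m. {X. ?N m X \<and> recentre m X \<in> stay_right})"
    unfolding disjoint_family_on_def
  proof (intro ballI impI equals0I)
    fix m m' X assume "m \<noteq> m'" "X \<in> {X. ?N m X \<and> recentre m X \<in> stay_right} \<inter> {X. ?N m' X \<and> recentre m' X \<in> stay_right}"
    with uniq[of m X m'] show False by simp
  qed
  have sN: "{X. ?N m X} \<in> L.events" for m using adapted_sets[OF ad] by simp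
  have sNR: "{X. ?N m X \<and> recentre m X \<in> stay_right} \<in> L.events" for m
    using adapted_recentre_sets[OF ad stay_right_sets] by simp
  have V: "level_hit regen x \<in> sets path_space" and U: "level_hit is_record x \<in> sets path_space"
    by (rule level_hit_sets, measurable)+
  have "L.prob (stay_right \<inter> level_hit is_record x) \<le> L.prob (\<Union>m. {X. ?N m X})"
    by (rule L.finite_measure_mono) (use sN in \<open>auto simp: level_hit_def stay_right_def\<close>)
  also have "\<dots> = (\<Sum>m. L.prob {X. ?N m X})"
    using disj sN by (intro L.finite_measure_UNION[THEN sums_unique]) auto
  finally have "p * L.prob (stay_right \<inter> level_hit is_record x) \<le> p * (\<Sum>m. L.prob {X. ?N m X})"
    using p_pos by simp
  also have "\<dots> = (\<Sum>m. p * L.prob {X. ?N m X})"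
    using disj sN by (intro suminf_mult[symmetric] L.finite_measure_UNION[THEN sums_summable]) auto
  also have "\<dots> = (\<Sum>m. L.prob {X. ?N m X \<and> recentre m X \<in> stay_right})"
  proof (rule suminf_cong)
    fix m
    have "L.prob {X. ?N m X \<and> recentre m X \<in> stay_right} = L.prob {X. ?N m X} * p"
      unfolding p_def by (rule renewal[OF ad]) auto
    then show "p * L.prob {X. ?N m X} = L.prob {X. ?N m X \<and> recentre m X \<in> stay_right}" by simp
  qed
  also have "\<dots> = L.prob (\<Union>m. {X. ?N m X \<and> recentre m X \<in> stay_right})"
    using disj' sNR by (intro L.finite_measure_UNION[THEN sums_unique, symmetric]) auto
  also have "\<dots> \<le> L.prob (stay_right \<inter> level_hit regen x)"
  proof (rule L.finite_measure_mono)
    show "(\<Union>m. {X. ?N m X \<and> recentre m X \<in> stay_right}) \<subseteq> stay_right \<inter> level_hit regen x"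
    proof safe
      fix X m assume *: "is_record m X" "X m = int x" "\<forall>i\<le>m. X 0 \<le> X i" "recentre m X \<in> stay_right"
      then have "regen m X" by (simp add: regen_iff)
      with * show "X \<in> level_hit regen x" by (auto simp: level_hit_def)
      have "X 0 \<le> X i" for i
      proof (cases "i \<le> m")
        case False
        then have "X m \<le> X i" using \<open>regen m X\<close> by (simp add: regen_def)
        moreover have "X 0 \<le> X m" using *(3) by blast
        ultimately show ?thesis by linarith
      qed (use *(3) in blast)
      then show "X \<in> stay_right" by (simp add: stay_right_def)
    qed
  qed (use V in auto)
  finally show ?thesis
    using p_pos unfolding renewal_law_eq[OF V] renewal_law_eq[OF U] by (simp add: field_simps)
qed

lemma expectation_card_levels:
  assumes R: "\<And>m. Measurable.pred path_space (R m)"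
  shows "(\<integral>X. real (card {x \<in> {1..n}. X \<in> level_hit R x}) \<partial>renewal_law) = (\<Sum>x\<in>{1..n}. measure renewal_law (level_hit R x))"
    and "integrable renewal_law (\<lambda>X. real (card {x \<in> {1..n}. X \<in> level_hit R x}))"
proof -
  interpret R: prob_space renewal_law by (rule prob_space_renewal_law)
  have s: "level_hit R x \<in> sets renewal_law" for x using level_hit_sets[OF R] by simp
  have i: "integrable renewal_law (indicator (level_hit R x) :: path \<Rightarrow> real)" for x
    using s by (intro integrable_real_indicator) (auto simp: R.emeasure_eq_measure)
  have eq: "real (card {x \<in> {1..n}. X \<in> level_hit R x}) = (\<Sum>x\<in>{1..n}. indicator (level_hit R x) X)" for X
  proof -
    have "(\<Sum>x\<in>{1..n}. indicator (level_hit R x) X :: real) = (\<Sum>x\<in>{1..n}. if x \<in> {x. X \<in> level_hit R x} then 1 else 0)"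
      by (intro sum.cong) (auto simp: indicator_def)
    also have "\<dots> = (\<Sum>x\<in>{1..n} \<inter> {x. X \<in> level_hit R x}. 1)"
      by (rule sum.inter_restrict[symmetric]) simp
    also have "{1..n} \<inter> {x. X \<in> level_hit R x} = {x \<in> {1..n}. X \<in> level_hit R x}" by auto
    finally show ?thesis by simp
  qed
  show "(\<integral>X. real (card {x \<in> {1..n}. X \<in> level_hit R x}) \<partial>renewal_law) = (\<Sum>x\<in>{1..n}. measure renewal_law (level_hit R x))"
    unfolding eq by (subst Bochner_Integration.integral_sum[OF i]) simp
  show "integrable renewal_law (\<lambda>X. real (card {x \<in> {1..n}. X \<in> level_hit R x}))"
    unfolding eq by (rule Bochner_Integration.integrable_sum[OF i])
qed

lemma measurable_step_height: "step_height \<in> renewal_law \<rightarrow>\<^sub>M count_space UNIV"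
  using measurable_block[of "\<lambda>b X. nat (X b - X 0)"] unfolding step_height_def[abs_def]
  by (simp add: measurable_cong_sets[OF sets_renewal_law refl] adapted_def)

lemma step_height_independent:
  assumes "i \<ge> 1"
  shows "measure renewal_law {X \<in> space renewal_law. step_height X \<in> A \<and> step_height ((renew ^^ i) X) \<in> B} =
    measure renewal_law {X \<in> space renewal_law. step_height X \<in> A} * measure renewal_law {X \<in> space renewal_law. step_height X \<in> B}"
proof -
  have "adapted b (\<lambda>X. nat (X b - X 0) \<in> C)" for b C by (simp add: adapted_def)
  from blocks_independent[of "\<lambda>b X. nat (X b - X 0)", OF this assms] show ?thesis
    unfolding step_height_def by simp
qed

text \<open>With infinite mean the regeneration heights would grow superlinearly, so regeneration
  levels would have density 0, also in expectation by dominated convergence. But record levels have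
  density at least 1 / w, and the expected number of regeneration levels is at least
  \<open>p\<close> times that of record levels.\<close>

lemma integrable_step_height: "integrable renewal_law (\<lambda>X. real (step_height X))"
proof (rule ccontr)
  assume not_int: "\<not> ?thesis"
  interpret R: measure_preserving renewal_law renew by (rule measure_preserving_renew)
  let ?N = "\<lambda>R n X. real (card {x \<in> {1..n}. X \<in> level_hit R x})"
  have pr: "Measurable.pred path_space (regen n)" "Measurable.pred path_space (is_record n)" for n by measurable
  have inf: "AE X in renewal_law. filterlim (\<lambda>n. (\<Sum>i<n. real (step_height ((renew ^^ i) X))) / real n) at_top sequentially"
    by (rule R.average_infinite[OF measurable_step_height step_height_independent not_int])
  have lim: "AE X in renewal_law. (\<lambda>n. ?N regen n X / real n) \<longlonglongrightarrow> 0"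
    using inf AE_good_path AE_renewal_law[OF AE_law_start]
  proof eventually_elim
    case (elim X)
    define A where "A k = (\<Sum>i<k. step_height ((renew ^^ i) X))" for k
    note X = elim(2,3)
    have step: "1 \<le> step_height ((renew ^^ i) X)" for i
    proof -
      have "good_path ((renew ^^ i) X)" by (rule nth_regen_props(2)[OF X])
      from good_pathD(1,2)[OF this] show ?thesis
        by (auto simp: step_height_def regen_def is_record_def)
    qed
    \<comment> \<open>Heights grow by at least one per block, so only finitely many \<open>k\<close>
      satisfy A k \<le> n.\<close>
    have kA: "k \<le> A k" for k
    proof (induction k)
      case (Suc k)
      then show ?case using step[of k] by (simp add: A_def)
    qed simp
    have card: "card {x \<in> {1..n}. X \<in> level_hit regen x} \<le> card {k. 1 \<le> k \<and> A k \<le> n}" for n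
    proof -
      have fin: "finite {k. 1 \<le> k \<and> A k \<le> n}"
      proof (rule finite_subset)
        show "{k. 1 \<le> k \<and> A k \<le> n} \<subseteq> {..n}"
        proof
          fix k assume "k \<in> {k. 1 \<le> k \<and> A k \<le> n}"
          with kA[of k] show "k \<in> {..n}" by simp
        qed
      qed simp
      have "{x \<in> {1..n}. X \<in> level_hit regen x} \<subseteq> A ` {k. 1 \<le> k \<and> A k \<le> n}"
      proof
        fix x assume x: "x \<in> {x \<in> {1..n}. X \<in> level_hit regen x}"
        then obtain m where mm: "regen m X" "X m = int x" by (auto simp: level_hit_def)
        obtain k where k: "m = nth_regen X k" using regen_is_nth_regen[OF X mm(1)] by blast
        have "int (A k) = int x" using nth_regen_props(4)[OF X, of k] k mm(2) by (simp add: A_def)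
        then have "x = A k" by simp
        moreover have "k \<noteq> 0" using x \<open>x = A k\<close> by (intro notI) (simp add: A_def)
        ultimately show "x \<in> A ` {k. 1 \<le> k \<and> A k \<le> n}" using x by auto
      qed
      then show ?thesis using surj_card_le[OF fin] by blast
    qed
    have "filterlim (\<lambda>k. real (A k) / real k) at_top sequentially"
      using elim(1) by (simp add: A_def)
    from count_below_sublinear[OF this]
    show ?case
      by (rule Lim_null_comparison[rotated])
        (use card in \<open>auto intro!: always_eventually divide_right_mono\<close>)
  qed
  have E: "(\<lambda>n. \<integral>X. ?N regen n X / real n \<partial>renewal_law) \<longlonglongrightarrow> (\<integral>X. 0 \<partial>renewal_law)"
  proof (rule integral_dominated_convergence[where w = "\<lambda>_. 1"])
    show "(\<lambda>X. ?N regen n X / real n) \<in> borel_measurable renewal_law" for n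
      using expectation_card_levels(2)[OF pr(1), of n] by auto
    show "AE X in renewal_law. norm (?N regen n X / real n) \<le> 1" for n
    proof (rule AE_I2)
      fix X
      have "card {x \<in> {1..n}. X \<in> level_hit regen x} \<le> card {1..n}" by (intro card_mono) auto
      then show "norm (?N regen n X / real n) \<le> 1" by (cases "n = 0") (auto simp: divide_le_eq)
    qed
  qed (use lim in auto)
  define W where "W = nat w"
  have W: "W \<ge> 1" "int W = w" using w by (auto simp: W_def)
  \<comment> \<open>Up to a multiple \<open>Suc K * W\<close> there are at least
    \<open>Suc K\<close> record levels, a proportion 1 / W; this subsequence suffices to contradict
    the limit 0.\<close>
  have lower: "p / real W \<le> (\<integral>X. ?N regen (Suc K * W) X / real (Suc K * W) \<partial>renewal_law)" for K
  proof -
    let ?n = "Suc K * W"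
    have "real (Suc K) = (\<integral>X. real (Suc K) \<partial>renewal_law)" using R.prob_space by simp
    also have "\<dots> \<le> (\<integral>X. ?N is_record ?n X \<partial>renewal_law)"
    proof (rule integral_mono_AE)
      show "AE X in renewal_law. real (Suc K) \<le> ?N is_record ?n X"
        using AE_renewal_law[OF AE_law_start] AE_renewal_law[OF AE_law_jumps]
          AE_renewal_law[OF AE_unbounded_right[OF escape_pos]]
      proof eventually_elim
        case (elim X)
        have "Suc K \<le> card {x \<in> {1..?n}. X \<in> level_hit is_record x}"
          using elim W by (intro records_dense) auto
        then show ?case by (rule of_nat_mono)
      qed
    qed (simp, rule expectation_card_levels(2)[OF pr(2)])
    also have "\<dots> = (\<Sum>x\<in>{1..?n}. R.prob (level_hit is_record x))"
      by (rule expectation_card_levels(1)[OF pr(2)])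
    finally have "p * real (Suc K) \<le> p * (\<Sum>x\<in>{1..?n}. R.prob (level_hit is_record x))"
      using p_pos by (intro mult_left_mono) auto
    also have "\<dots> = (\<Sum>x\<in>{1..?n}. p * R.prob (level_hit is_record x))" by (rule sum_distrib_left)
    also have "\<dots> \<le> (\<Sum>x\<in>{1..?n}. R.prob (level_hit regen x))"
      by (intro sum_mono regen_level_ge)
    also have "\<dots> = (\<integral>X. ?N regen ?n X \<partial>renewal_law)"
      by (rule expectation_card_levels(1)[OF pr(1), symmetric])
    finally have "p * real (Suc K) / real ?n \<le> (\<integral>X. ?N regen ?n X \<partial>renewal_law) / real ?n"
      by (intro divide_right_mono) auto
    moreover have "p * real (Suc K) / real ?n = p / real W"
      by (simp only: of_nat_mult) simp
    ultimately show ?thesis by simp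
  qed
  have sub: "strict_mono (\<lambda>K. Suc K * W)" using W(1) by (intro strict_monoI mult_strict_right_mono) auto
  have "p / real W \<le> 0"
    using LIMSEQ_le_const[OF LIMSEQ_subseq_LIMSEQ[OF E sub]] lower by (auto simp: comp_def)
  then show False using p_pos W(1) by (simp add: divide_le_0_iff)
qed

text \<open>Under the conditioned law the speed is the quotient of mean height and mean time of a
  block. It carries over to the unconditioned walk because, by \<open>renewal\<close>, a record
  followed by a path that stays to the right without this speed has probability 0.\<close>

lemma velocity_exists: "\<exists>v. AE X in law 0. (\<lambda>n. real_of_int (X n) / real n) \<longlonglongrightarrow> v"
proof -
  interpret R: measure_preserving renewal_law renew by (rule measure_preserving_renew)
  interpret L: prob_space "law 0" by (rule prob_space_law)
  have \<psi>: "adapted b (\<lambda>X. b \<in> C)" for b C by (simp add: adapted_def)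
  have m': "regen_time \<in> renewal_law \<rightarrow>\<^sub>M count_space UNIV"
    using measurable_regen_time by (simp add: measurable_cong_sets[OF sets_renewal_law refl])
  have indep': "R.prob {x \<in> space renewal_law. regen_time x \<in> A \<and> regen_time ((renew ^^ i) x) \<in> B} =
      R.prob {x \<in> space renewal_law. regen_time x \<in> A} * R.prob {x \<in> space renewal_law. regen_time x \<in> B}"
    if "i \<ge> 1" for i A B
    using blocks_independent[of "\<lambda>b X. b", OF \<psi> that, of A B] by simp
  define \<alpha> where "\<alpha> = R.expectation (\<lambda>X. real (step_height X))"
  have a: "AE X in renewal_law. (\<lambda>n. (\<Sum>i<n. real (step_height ((renew ^^ i) X))) / real n) \<longlonglongrightarrow> \<alpha>"
    unfolding \<alpha>_def by (rule R.average_finite[OF measurable_step_height step_height_independent integrable_step_height])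
  \<comment> \<open>The limit \<rho> is the inverse of the mean regeneration time, or 0 if that mean
    is infinite.\<close>
  have "\<exists>\<rho>. AE X in renewal_law. (\<lambda>k. real k / real (nth_regen X k)) \<longlonglongrightarrow> \<rho>"
  proof (cases "integrable renewal_law (\<lambda>X. real (regen_time X))")
    case True
    let ?e = "R.expectation (\<lambda>X. real (regen_time X))"
    have "1 \<le> ?e"
    proof -
      have "(\<integral>X. 1 \<partial>renewal_law) \<le> ?e"
      proof (rule integral_mono_AE)
        show "AE X in renewal_law. 1 \<le> real (regen_time X)"
          using AE_good_path
        proof eventually_elim
          case (elim X)
          from good_pathD(1)[OF elim] show ?case by simp
        qed
      qed (use True in auto)
      then show ?thesis using R.prob_space by simp
    qed
    have "AE X in renewal_law. (\<lambda>n. (\<Sum>i<n. real (regen_time ((renew ^^ i) X))) / real n) \<longlonglongrightarrow> ?e"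
      by (rule R.average_finite[OF m' _ True]) (rule indep')
    then have "AE X in renewal_law. (\<lambda>k. real k / real (nth_regen X k)) \<longlonglongrightarrow> inverse ?e"
    proof eventually_elim
      case (elim X)
      have "(\<lambda>n. inverse ((\<Sum>i<n. real (regen_time ((renew ^^ i) X))) / real n)) \<longlonglongrightarrow> inverse ?e"
        using \<open>1 \<le> ?e\<close> by (intro tendsto_inverse elim) auto
      then show ?case by (simp add: nth_regen_def)
    qed
    then show ?thesis ..
  next
    case False
    have "AE X in renewal_law. filterlim (\<lambda>n. (\<Sum>i<n. real (regen_time ((renew ^^ i) X))) / real n) at_top sequentially"
      by (rule R.average_infinite[OF m' _ False]) (rule indep')
    then have "AE X in renewal_law. (\<lambda>k. real k / real (nth_regen X k)) \<longlonglongrightarrow> 0"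
    proof eventually_elim
      case (elim X)
      have "(\<lambda>n. inverse ((\<Sum>i<n. real (regen_time ((renew ^^ i) X))) / real n)) \<longlonglongrightarrow> 0"
        using elim by (rule tendsto_inverse_0_at_top)
      then show ?case by (simp add: nth_regen_def)
    qed
    then show ?thesis ..
  qed
  then obtain \<rho> where t: "AE X in renewal_law. (\<lambda>k. real k / real (nth_regen X k)) \<longlonglongrightarrow> \<rho>" ..
  define v where "v = \<alpha> * \<rho>"
  let ?V = "{X :: path. (\<lambda>n. real_of_int (X n) / real n) \<longlonglongrightarrow> v}"
  have V: "?V \<in> sets path_space" by (rule velocity_sets)
  have "AE X in renewal_law. X \<in> ?V"
    using a t AE_good_path AE_renewal_law[OF AE_law_start]
  proof eventually_elim
    case (elim X)
    have "(\<lambda>k. real (\<Sum>i<k. step_height ((renew ^^ i) X)) / real k) \<longlonglongrightarrow> \<alpha>" using elim(1) by simp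
    from speed_from_regenerations[OF elim(3,4) this elim(2)] show ?case by (simp add: v_def)
  qed
  moreover have B: "space path_space - ?V \<in> sets path_space" using V by (rule sets.compl_sets)
  then have "space path_space - ?V \<in> R.events" by (simp only: sets_renewal_law)
  ultimately have "R.prob (space path_space - ?V) = 0"
    using R.prob_eq_0 by auto
  then have null: "L.prob (stay_right \<inter> (space path_space - ?V)) = 0"
    using p_pos unfolding renewal_law_eq[OF B] by (simp only: divide_eq_0_iff) auto
  \<comment> \<open>Excluding the bad continuation for all fixed times \<open>n\<close> at once
    covers the random time of a regeneration.\<close>
  have "AE X in law 0. \<forall>n. \<not> (is_record n X \<and> recentre n X \<in> stay_right \<inter> (space path_space - ?V))"
  proof (rule AE_all_countable[THEN iffD2, rule_format])
    fix n
    let ?E = "{X. is_record n X \<and> recentre n X \<in> stay_right \<inter> (space path_space - ?V)}"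
    have S: "stay_right \<inter> (space path_space - ?V) \<in> sets path_space" using B by auto
    have "L.prob ?E = L.prob {X. is_record n X} * L.prob (stay_right \<inter> (space path_space - ?V))"
      by (rule renewal[OF adapted_is_record _ S]) auto
    then have "L.prob ?E = 0" by (simp only: null mult_zero_right)
    moreover have "?E \<in> L.events" using adapted_recentre_sets[OF adapted_is_record S] by simp
    ultimately show "AE X in law 0. \<not> (is_record n X \<and> recentre n X \<in> stay_right \<inter> (space path_space - ?V))"
      using L.prob_eq_0[of ?E] by simp
  qed
  then have "AE X in law 0. (\<lambda>n. real_of_int (X n) / real n) \<longlonglongrightarrow> v"
    using AE_regen
  proof eventually_elim
    case (elim X)
    obtain n where n: "regen n X" using elim(2) by (auto simp: INFM_nat)
    with elim(1) have "recentre n X \<in> ?V" by (auto simp: regen_iff)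
    then have "(\<lambda>i. real_of_int (recentre n X i) / real i) \<longlonglongrightarrow> v" by (rule CollectD)
    then show ?case by (rule velocity_recentre)
  qed
  then show ?thesis ..
qed

end

section \<open>Hitting times\<close>

lemma hitting_time_ge_eq:
  "hitting_time_ge X x = (if \<exists>n. x \<le> X n then enat (LEAST n. x \<le> X n) else \<infinity>)"
proof (cases "\<exists>n. x \<le> X n")
  case True
  have "(INF n\<in>{n. x \<le> X n}. enat n) = enat (LEAST n. x \<le> X n)"
  proof (rule antisym)
    show "(INF n\<in>{n. x \<le> X n}. enat n) \<le> enat (LEAST n. x \<le> X n)"
      using LeastI_ex[OF True] by (intro INF_lower) simp
    show "enat (LEAST n. x \<le> X n) \<le> (INF n\<in>{n. x \<le> X n}. enat n)"
      by (intro INF_greatest) (auto intro: Least_le)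
  qed
  with True show ?thesis by (simp add: hitting_time_ge_def)
next
  case False
  then have "{n. x \<le> X n} = {}" by auto
  with False show ?thesis by (simp add: hitting_time_ge_def top_enat_def)
qed

lemma first_passage_late:
  fixes X :: path
  shows "eventually (\<lambda>x. \<forall>n. x \<le> X n \<longrightarrow> K < n) at_top"
  unfolding eventually_at_top_linorder
proof (intro exI allI impI)
  fix x n assume x: "Max (X ` {..K}) + 1 \<le> x" "x \<le> X n"
  show "K < n"
  proof (rule ccontr)
    assume "\<not> K < n"
    then have "X n \<le> Max (X ` {..K})" by (intro Max_ge) auto
    with x show False by linarith
  qed
qed

text \<open>At the hitting time, X (N x - 1) < x \<le> X (N x), so x / N x is squeezed between two
  ratios that tend to \<open>v\<close>; since v > 0 the limit can be inverted.\<close>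

lemma hitting_time_positive_velocity:
  fixes X :: path
  assumes lim: "(\<lambda>n. real_of_int (X n) / real n) \<longlonglongrightarrow> v" and v: "v > 0"
  shows "((\<lambda>x. ereal_of_enat (hitting_time_ge X x) / ereal (real_of_int x)) \<longlongrightarrow> ereal (1 / v)) at_top"
proof -
  have ex: "\<exists>n. x \<le> X n" for x
  proof -
    have "eventually (\<lambda>n. v / 2 < real_of_int (X n) / real n) sequentially"
      using v by (intro order_tendstoD[OF lim]) simp
    moreover have "eventually (\<lambda>n. nat \<lceil>2 * \<bar>real_of_int x\<bar> / v\<rceil> + 1 \<le> n) sequentially"
      by (rule eventually_ge_at_top)
    ultimately have "eventually (\<lambda>n. x \<le> X n) sequentially"
    proof eventually_elim
      case (elim n)
      have n: "real n > 0" using elim(2) by simp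
      have "2 * \<bar>real_of_int x\<bar> / v \<le> real n" using elim(2) by linarith
      then have "\<bar>real_of_int x\<bar> \<le> v / 2 * real n" using v by (simp add: field_simps)
      also have "\<dots> < real_of_int (X n)" using elim(1) n by (simp add: field_simps)
      finally show ?case by linarith
    qed
    then show ?thesis by (auto simp: eventually_sequentially)
  qed
  define N where "N x = (LEAST n. x \<le> X n)" for x
  have N: "x \<le> X (N x)" for x unfolding N_def using ex by (rule LeastI_ex)
  have before: "X n < x" if "n < N x" for n x
    using not_less_Least[of n "\<lambda>n. x \<le> X n"] that by (simp add: N_def)
  have N_lim: "filterlim N at_top at_top"
    unfolding filterlim_at_top
  proof
    fix K
    show "eventually (\<lambda>x. K \<le> N x) at_top"
      using first_passage_late[of X K] by eventually_elim (use N less_imp_le in blast)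
  qed
  have up: "((\<lambda>x. real_of_int (X (N x)) / real (N x)) \<longlongrightarrow> v) at_top"
    by (rule filterlim_compose[OF lim N_lim])
  \<comment> \<open>The factor n / (n + 1) replaces the denominator N x - 1 by N x.\<close>
  have "(\<lambda>n. real_of_int (X n) / real n * (real n / real (Suc n))) \<longlonglongrightarrow> v * 1"
    by (intro tendsto_mult lim LIMSEQ_n_over_Suc_n)
  then have "((\<lambda>x. real_of_int (X (N x - 1)) / real (N x - 1) * (real (N x - 1) / real (Suc (N x - 1)))) \<longlongrightarrow> v * 1) at_top"
    by (rule filterlim_compose) (rule filterlim_compose[OF filterlim_minus_const_nat_at_top N_lim])
  then have low: "((\<lambda>x. real_of_int (X (N x - 1)) / real (N x - 1) * (real (N x - 1) / real (Suc (N x - 1)))) \<longlongrightarrow> v) at_top"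
    by simp
  have N2: "eventually (\<lambda>x. 2 \<le> N x) at_top" using N_lim by (simp add: filterlim_at_top)
  have "((\<lambda>x. real_of_int x / real (N x)) \<longlongrightarrow> v) at_top"
  proof (rule tendsto_sandwich[OF _ _ low up])
    show "eventually (\<lambda>x. real_of_int (X (N x - 1)) / real (N x - 1) * (real (N x - 1) / real (Suc (N x - 1))) \<le> real_of_int x / real (N x)) at_top"
      using N2
    proof eventually_elim
      case (elim x)
      have "X (N x - 1) < x" using elim by (intro before) simp
      then have "real_of_int (X (N x - 1)) / real (N x) \<le> real_of_int x / real (N x)"
        by (intro divide_right_mono) auto
      moreover have "Suc (N x - 1) = N x" "real (N x - 1) \<noteq> 0" using elim by auto
      ultimately show ?case by simp
    qed
    show "eventually (\<lambda>x. real_of_int x / real (N x) \<le> real_of_int (X (N x)) / real (N x)) at_top"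
      using N by (intro always_eventually allI divide_right_mono) auto
  qed
  then have "((\<lambda>x. inverse (real_of_int x / real (N x))) \<longlongrightarrow> inverse v) at_top"
    using v by (intro tendsto_inverse) auto
  then have "((\<lambda>x. ereal (real (N x) / real_of_int x)) \<longlongrightarrow> ereal (1 / v)) at_top"
    by (simp add: inverse_eq_divide)
  moreover have "eventually (\<lambda>x. ereal (real (N x) / real_of_int x) =
      ereal_of_enat (hitting_time_ge X x) / ereal (real_of_int x)) at_top"
    using eventually_gt_at_top[of 0]
  proof eventually_elim
    case (elim x)
    then show ?case using ex[of x] by (simp add: hitting_time_ge_eq N_def)
  qed
  ultimately show ?thesis by (rule Lim_transform_eventually)
qed

text \<open>Late positions satisfy X n < \<epsilon> n, so level \<open>x\<close> is reached after
  time x / \<epsilon> or never. For v < 0 the latter happens for all large \<open>x\<close>.\<close>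

lemma hitting_time_nonpositive_velocity:
  fixes X :: path
  assumes lim: "(\<lambda>n. real_of_int (X n) / real n) \<longlonglongrightarrow> v" and v: "v \<le> 0"
  shows "((\<lambda>x. ereal_of_enat (hitting_time_ge X x) / ereal (real_of_int x)) \<longlongrightarrow> \<infinity>) at_top"
  unfolding tendsto_PInfty
proof
  fix r :: real
  \<comment> \<open>The inverse of \<epsilon> exceeds \<open>r\<close>, and the modulus keeps
    \<epsilon> positive for every real \<open>r\<close>.\<close>
  define \<epsilon> where "\<epsilon> = 1 / (\<bar>r\<bar> + 1)"
  have \<epsilon>: "\<epsilon> > 0" by (simp add: \<epsilon>_def)
  have "eventually (\<lambda>n. real_of_int (X n) / real n < \<epsilon>) sequentially"
    using v \<epsilon> by (intro order_tendstoD[OF lim]) simp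
  then obtain K where K: "\<And>n. n \<ge> K \<Longrightarrow> real_of_int (X n) / real n < \<epsilon>"
    by (auto simp: eventually_sequentially)
  show "eventually (\<lambda>x. ereal r < ereal_of_enat (hitting_time_ge X x) / ereal (real_of_int x)) at_top"
    using first_passage_late[of X K] eventually_gt_at_top[of 0]
  proof eventually_elim
    case (elim x)
    have x: "real_of_int x > 0" using elim by simp
    show ?case
    proof (cases "\<exists>n. x \<le> X n")
      case True
      define N where "N = (LEAST n. x \<le> X n)"
      have N: "x \<le> X N" unfolding N_def using True by (rule LeastI_ex)
      then have "K < N" using elim(1) by blast
      then have "real_of_int (X N) < \<epsilon> * real N"
        using K[of N] by (simp add: pos_divide_less_eq)
      then have "real_of_int x < \<epsilon> * real N" using N by linarith
      then have "(\<bar>r\<bar> + 1) * real_of_int x < real N"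
        by (simp add: \<epsilon>_def field_simps)
      moreover have "r * real_of_int x \<le> (\<bar>r\<bar> + 1) * real_of_int x"
        using x by (intro mult_right_mono) auto
      ultimately have "r * real_of_int x < real N" by linarith
      then have "r < real N / real_of_int x" using x by (simp add: pos_less_divide_eq)
      then show ?thesis using True x by (simp add: hitting_time_ge_eq N_def)
    next
      case False
      then show ?thesis using x by (simp add: hitting_time_ge_eq)
    qed
  qed
qed

lemma hitting_time_velocity:
  fixes X :: path
  assumes "(\<lambda>n. real_of_int (X n) / real n) \<longlonglongrightarrow> v"
  shows "((\<lambda>x. ereal_of_enat (hitting_time_ge X x) / ereal (real_of_int x))
    \<longlongrightarrow> (if v > 0 then ereal (1 / v) else \<infinity>)) at_top"
  using hitting_time_positive_velocity[OF assms] hitting_time_nonpositive_velocity[OF assms] by auto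

section \<open>From the given environment law to product form\<close>

text \<open>Point masses are continuous for the weak topology, so the sigma-field they generate lies
  inside the Borel field. This links the stated measure structure to the product
  construction.\<close>

lemma measurable_M1_pmf_algebra: "(\<lambda>\<mu>. \<mu>) \<in> M1_space \<rightarrow>\<^sub>M pmf_algebra"
  by (rule measurable_to_pmf_algebra) (rule measurable_M1_pmf)

lemma pmf_map_uminus: "pmf (map_pmf uminus \<mu>) j = pmf \<mu> (- j :: int)"
  using pmf_map_inj'[of uminus \<mu> "- j"] by simp

lemma measurable_M1_reflect: "map_pmf uminus \<in> M1_space \<rightarrow>\<^sub>M pmf_algebra"
  by (rule measurable_to_pmf_algebra) (simp add: pmf_map_uminus)

lemma quenched_reflect:
  "quenched (\<lambda>a. map_pmf uminus (\<omega> (- a))) x = distr (quenched \<omega> (- x)) path_space (\<lambda>X i. - X i)"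
proof (rule path_measure_eqI[symmetric])
  interpret prob_space "quenched \<omega> (- x)" by (rule prob_space_quenched)
  have m: "(\<lambda>X i. - X i) \<in> quenched \<omega> (- x) \<rightarrow>\<^sub>M path_space"
    by (rule measurable_to_path_space) simp
  show "finite_measure (distr (quenched \<omega> (- x)) path_space (\<lambda>X i. - X i))"
    by (rule finite_measure_distr[OF m])
  fix n and xs :: path
  have "emeasure (distr (quenched \<omega> (- x)) path_space (\<lambda>X i. - X i)) (cyl n xs) =
    emeasure (quenched \<omega> (- x)) (cyl n (\<lambda>i. - xs i))"
  proof -
    have "(\<lambda>X i. - X i) -` cyl n xs = cyl n (\<lambda>i. - xs i)" by force
    then show ?thesis using m by (subst emeasure_distr) simp_all
  qed
  also have "\<dots> = emeasure (quenched (\<lambda>a. map_pmf uminus (\<omega> (- a))) x) (cyl n xs)"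
    by (simp add: emeasure_quenched_cylinder transition_def pmf_map_uminus)
  finally show "emeasure (distr (quenched \<omega> (- x)) path_space (\<lambda>X i. - X i)) (cyl n xs) =
    emeasure (quenched (\<lambda>a. map_pmf uminus (\<omega> (- a))) x) (cyl n xs)" .
qed simp_all

lemma irreducible_reflect:
  assumes "irreducible_env \<omega>"
  shows "irreducible_env (\<lambda>a. map_pmf uminus (\<omega> (- a)))"
  unfolding irreducible_env_def
proof (intro allI)
  fix a b
  have m: "(\<lambda>X i. - X i) \<in> quenched \<omega> (- a) \<rightarrow>\<^sub>M path_space"
    by (rule measurable_to_path_space) simp
  have s: "{X \<in> space path_space. X n = b} \<in> sets path_space" for n by measurable
  obtain n where "measure (quenched \<omega> (- a)) {X \<in> space path_space. X n = - b} > 0"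
    using assms unfolding irreducible_env_def by blast
  moreover have "(\<lambda>X i. - X i) -` {X \<in> space path_space. X n = b} = {X \<in> space path_space. X n = - b}"
    by force
  ultimately show "\<exists>n. 0 < measure (quenched (\<lambda>a. map_pmf uminus (\<omega> (- a))) a) {X \<in> space path_space. X n = b}"
    unfolding quenched_reflect using m s by (intro exI[of _ n]) (subst measure_distr, simp_all)
qed

lemma irreducible_env_sets: "{\<omega>. irreducible_env \<omega>} \<in> sets env_algebra"
proof -
  have s: "{X \<in> space path_space. X n = b} \<in> sets path_space" for n b by measurable
  have [measurable]: "(\<lambda>\<omega>. emeasure (quenched \<omega> a) {X \<in> space path_space. X n = b}) \<in> borel_measurable env_algebra" for a b n
    by (rule measurable_emeasure_quenched[OF s])
  have "{\<omega>. irreducible_env \<omega>} = {\<omega> \<in> space env_algebra. \<forall>a b. \<exists>n. 0 < emeasure (quenched \<omega> a) {X \<in> space path_space. X n = b}}"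
    by (simp add: irreducible_env_def quenched_eq_measure)
  also have "\<dots> \<in> sets env_algebra" by measurable
  finally show ?thesis .
qed

text \<open>The walk in the environment with law \<open>P\<close> is seen through the environment whose jump law at \<open>a\<close>
  is \<open>g (\<omega> (s a))\<close>, and through the path \<open>r X\<close>: either nothing is changed, or everything is reflected.\<close>

locale environment_image = prob_space P for P :: "env measure" +
  fixes g :: "int pmf \<Rightarrow> int pmf" and s :: "int \<Rightarrow> int" and r :: "path \<Rightarrow> path" and w :: int
  assumes sets_P: "sets P = sets env_space"
    and indep: "indep_vars (\<lambda>_. M1_space) (\<lambda>x \<omega>. \<omega> x) (UNIV :: int set)"
    and ident: "\<And>x y. distr P M1_space (\<lambda>\<omega>. \<omega> x) = distr P M1_space (\<lambda>\<omega>. \<omega> y)"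
    and g: "g \<in> M1_space \<rightarrow>\<^sub>M pmf_algebra" and s: "inj s"
    and r: "r \<in> path_space \<rightarrow>\<^sub>M path_space"
    and quenched_image: "\<And>\<omega>. quenched (\<lambda>a. g (\<omega> (s a))) 0 = distr (quenched \<omega> 0) path_space r"
    and irr: "AE \<omega> in P. irreducible_env (\<lambda>a. g (\<omega> (s a)))"
    and w_pos: "w \<ge> 1"
    and jumps: "AE \<omega> in P. \<forall>j. \<bar>j\<bar> > w \<longrightarrow> pmf (g (\<omega> 0)) j = 0"
begin

definition site_law :: "int pmf measure" where
  "site_law = distr P pmf_algebra (\<lambda>\<omega>. g (\<omega> 0))"

lemma measurable_site: "(\<lambda>\<omega>. \<omega> a) \<in> P \<rightarrow>\<^sub>M M1_space"
  using measurable_env_component by (simp add: measurable_cong_sets[OF sets_P refl])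

lemma measurable_image_site: "(\<lambda>\<omega>. g (\<omega> a)) \<in> P \<rightarrow>\<^sub>M pmf_algebra"
  by (rule measurable_compose[OF measurable_site g])

lemma distr_site: "distr P pmf_algebra (\<lambda>\<omega>. g (\<omega> a)) = site_law"
proof -
  have "distr P pmf_algebra (\<lambda>\<omega>. g (\<omega> a)) = distr (distr P M1_space (\<lambda>\<omega>. \<omega> a)) pmf_algebra g" for a
    by (subst distr_distr[OF g measurable_site]) (simp add: comp_def)
  then show ?thesis unfolding site_law_def using ident[of a 0] by simp
qed

lemma sets_site_law: "sets site_law = sets pmf_algebra"
  by (simp add: site_law_def)

lemma measurable_image: "(\<lambda>\<omega> a. g (\<omega> (s a))) \<in> P \<rightarrow>\<^sub>M env_algebra"
  by (rule measurable_to_env_algebra) (rule measurable_image_site)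

sublocale E: iid_environment site_law
proof (rule iid_environment.intro)
  show "prob_space site_law"
    unfolding site_law_def by (rule prob_space_distr[OF measurable_image_site])
  show "iid_environment_axioms site_law"
    by (rule iid_environment_axioms.intro[OF sets_site_law])
qed

text \<open>Injectivity of \<open>s\<close> keeps distinct sites distinct, so their jump laws stay
  independent under \<open>g\<close>; independent coordinates with a common law form a product
  measure.\<close>

lemma env_eq: "E.env = distr P env_algebra (\<lambda>\<omega> a. g (\<omega> (s a)))"
proof -
  have "indep_vars (\<lambda>a. \<Pi>\<^sub>M i\<in>{s a}. M1_space) (\<lambda>a \<omega>. restrict (\<lambda>i. \<omega> i) {s a}) UNIV"
    using s by (intro indep_vars_restrict[OF indep]) (auto simp: disjoint_family_on_def inj_on_def)
  then have "indep_vars (\<lambda>_. pmf_algebra) (\<lambda>a \<omega>. g (restrict \<omega> {s a} (s a))) UNIV"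
  proof (rule indep_vars_compose2)
    fix a
    show "(\<lambda>\<eta>. g (\<eta> (s a))) \<in> (\<Pi>\<^sub>M i\<in>{s a}. M1_space) \<rightarrow>\<^sub>M pmf_algebra"
      by (rule measurable_compose[OF _ g]) (rule measurable_component_singleton, simp)
  qed
  then have "indep_vars (\<lambda>_. pmf_algebra) (\<lambda>a \<omega>. g (\<omega> (s a))) UNIV" by simp
  then have "distr P (\<Pi>\<^sub>M a\<in>UNIV. pmf_algebra) (\<lambda>\<omega>. \<lambda>a\<in>UNIV. g (\<omega> (s a))) =
      (\<Pi>\<^sub>M a\<in>UNIV. distr P pmf_algebra (\<lambda>\<omega>. g (\<omega> (s a))))"
    by (subst (asm) indep_vars_iff_distr_eq_PiM') (auto intro: measurable_image_site)
  then show ?thesis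
    by (simp only: distr_site restrict_UNIV E.env_def env_algebra_def)
qed

sublocale E: irreducible_environment site_law w
proof (unfold_locales)
  show "w \<ge> 1" by (rule w_pos)
  have [measurable]: "(\<lambda>\<mu>. pmf \<mu> j) \<in> borel_measurable pmf_algebra" for j by (rule measurable_pmf_algebra)
  have "{\<mu> \<in> space pmf_algebra. \<forall>j. \<bar>j\<bar> > w \<longrightarrow> pmf \<mu> j = 0} \<in> sets pmf_algebra" by measurable
  then show "AE \<mu> in site_law. \<forall>j. \<bar>j\<bar> > w \<longrightarrow> pmf \<mu> j = 0"
    unfolding site_law_def by (subst AE_distr_iff[OF measurable_image_site]) (auto intro: jumps)
  have "{\<omega> \<in> space env_algebra. irreducible_env \<omega>} \<in> sets env_algebra"
    using irreducible_env_sets by simp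
  then show "AE \<omega> in E.env. irreducible_env \<omega>"
    unfolding env_eq by (subst AE_distr_iff[OF measurable_image]) (auto intro: irr)
qed

text \<open>Failures of \<open>Q\<close> are covered by a null set of paths. Its preimage under
  \<open>r\<close>, taken with all environments, is null because the image environment has the
  product law and the quenched laws correspond under \<open>r\<close>.\<close>

lemma AE_annealed:
  assumes "AE X in E.law 0. Q X"
  shows "AE (\<omega>, X) in annealed P 0. Q (r X)"
proof -
  obtain N where N: "{X \<in> space (E.law 0). \<not> Q X} \<subseteq> N" "emeasure (E.law 0) N = 0" "N \<in> sets (E.law 0)"
    using assms by (rule AE_E)
  have N': "N \<in> sets path_space" using N(3) by simp
  have rN: "r -` N \<in> sets path_space"
    using measurable_sets[OF r N'] by simp
  have "emeasure (E.law 0) N = (\<integral>\<^sup>+\<omega>. emeasure (quenched \<omega> 0) N \<partial>E.env)"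
    by (rule E.emeasure_law[OF N'])
  also have "\<dots> = (\<integral>\<^sup>+\<omega>. emeasure (quenched (\<lambda>a. g (\<omega> (s a))) 0) N \<partial>P)"
    unfolding env_eq by (rule nn_integral_distr[OF measurable_image]) (use N' in measurable)
  also have "\<dots> = (\<integral>\<^sup>+\<omega>. emeasure (quenched \<omega> 0) (r -` N) \<partial>P)"
  proof (rule nn_integral_cong)
    fix \<omega>
    have "r \<in> quenched \<omega> 0 \<rightarrow>\<^sub>M path_space" using r by (simp add: measurable_cong_sets[OF sets_quenched refl])
    then show "emeasure (quenched (\<lambda>a. g (\<omega> (s a))) 0) N = emeasure (quenched \<omega> 0) (r -` N)"
      unfolding quenched_image using N' by (subst emeasure_distr) simp_all
  qed
  also have "\<dots> = emeasure (annealed P 0) (UNIV \<times> r -` N)"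
    using emeasure_annealed_Times[OF prob_space_axioms sets_P, of UNIV "r -` N" 0] rN sets.top[of env_space]
    by simp
  finally have "emeasure (annealed P 0) (UNIV \<times> r -` N) = 0" using N(2) by simp
  moreover have "UNIV \<times> r -` N \<in> sets (annealed P 0)"
    unfolding sets_annealed[OF prob_space_axioms sets_P]
    using rN sets.top[of env_space] by (intro pair_measureI) simp_all
  ultimately show ?thesis
    by (intro AE_I[of _ _ "UNIV \<times> r -` N"]) (use N(1) in auto)
qed

end

theorem proposition1p1:
  fixes P :: "env measure"
  assumes "prob_space P"
    and "sets P = sets env_space"
    and C1_indep: "prob_space.indep_vars P (\<lambda>_. M1_space) (\<lambda>x \<omega>. \<omega> x) (UNIV :: int set)"
    and C1_ident: "\<forall>x y. distr P M1_space (\<lambda>\<omega>. \<omega> x) = distr P M1_space (\<lambda>\<omega>. \<omega> y)"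
    and C2: "AE \<omega> in P. irreducible_env \<omega>"
    and C3: "\<exists>L R :: int. AE \<omega> in P. \<forall>a b. b \<notin> {a - L..a + R} \<longrightarrow> transition \<omega> a b = 0"
  shows "\<exists>v :: real.
      (AE (\<omega>, X) in annealed P 0. (\<lambda>n. real_of_int (X n) / real n) \<longlonglongrightarrow> v) \<and>
      (AE (\<omega>, X) in annealed P 0.
         ((\<lambda>x :: int. ereal_of_enat (hitting_time_ge X x) / ereal (real_of_int x))
            \<longlongrightarrow> (if v > 0 then ereal (1 / v) else \<infinity>)) at_top)"
proof -
  interpret prob_space P by fact
  obtain L R :: int where LR: "AE \<omega> in P. \<forall>a b. b \<notin> {a - L..a + R} \<longrightarrow> transition \<omega> a b = 0"
    using C3 by blast
  \<comment> \<open>\<open>L\<close> and \<open>R\<close> are arbitrary integers; the maximum gives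
    one symmetric bound on the jumps that is at least 1.\<close>
  define w where "w = max 1 (max \<bar>L\<bar> \<bar>R\<bar>)"
  have jumps: "AE \<omega> in P. \<forall>j. \<bar>j\<bar> > w \<longrightarrow> pmf (\<omega> 0) j = 0"
    using LR
  proof eventually_elim
    case (elim \<omega>)
    show ?case
    proof (intro allI impI)
      fix j assume "\<bar>j\<bar> > w"
      then have "j \<notin> {0 - L..0 + R}" by (auto simp: w_def)
      then have "transition \<omega> 0 j = 0" using elim by blast
      then show "pmf (\<omega> 0) j = 0" by (simp add: transition_def)
    qed
  qed
  interpret R: environment_image P "\<lambda>\<mu>. \<mu>" "\<lambda>a. a" "\<lambda>X. X" w
  proof unfold_locales
    show "quenched (\<lambda>a. \<omega> a) 0 = distr (quenched \<omega> 0) path_space (\<lambda>X. X)" for \<omega>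
      by (rule distr_id2[symmetric]) simp
  qed (use assms jumps measurable_M1_pmf_algebra in \<open>simp_all add: w_def\<close>)
  \<comment> \<open>This copy sees the reflected walk, so its bounds to the right are bounds to the
    left for the original one.\<close>
  interpret L: environment_image P "map_pmf uminus" uminus "\<lambda>X i. - X i" w
  proof unfold_locales
    show "(\<lambda>X i. - X i) \<in> path_space \<rightarrow>\<^sub>M path_space"
      by (rule measurable_to_path_space) simp
    show "quenched (\<lambda>a. map_pmf uminus (\<omega> (- a))) 0 = distr (quenched \<omega> 0) path_space (\<lambda>X i. - X i)" for \<omega>
      using quenched_reflect[of \<omega> 0] by simp
    show "AE \<omega> in P. irreducible_env (\<lambda>a. map_pmf uminus (\<omega> (- a)))"
      using C2 by eventually_elim (rule irreducible_reflect)
    show "AE \<omega> in P. \<forall>j. w < \<bar>j\<bar> \<longrightarrow> pmf (map_pmf uminus (\<omega> 0)) j = 0"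
      using jumps by eventually_elim (simp add: pmf_map_uminus)
  qed (use assms measurable_M1_reflect in \<open>simp_all add: w_def\<close>)
  have "\<exists>v. AE (\<omega>, X) in annealed P 0. (\<lambda>n. real_of_int (X n) / real n) \<longlonglongrightarrow> v"
  proof -
    consider "emeasure (R.E.law 0) stay_right > 0" | "emeasure (L.E.law 0) stay_right > 0"
      | "emeasure (R.E.law 0) stay_right = 0" "emeasure (L.E.law 0) stay_right = 0"
      by (metis zero_less_iff_neq_zero)
    then show ?thesis
    proof cases
      case 1
      interpret T: transient_environment R.site_law w
        by unfold_locales (rule 1)
      obtain v where "AE X in R.E.law 0. (\<lambda>n. real_of_int (X n) / real n) \<longlonglongrightarrow> v"
        using T.velocity_exists by blast
      from R.AE_annealed[OF this] show ?thesis by blast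
    next
      case 2
      interpret T: transient_environment L.site_law w
        by unfold_locales (rule 2)
      obtain v where "AE X in L.E.law 0. (\<lambda>n. real_of_int (X n) / real n) \<longlonglongrightarrow> v"
        using T.velocity_exists by blast
      from L.AE_annealed[OF this]
      have "AE (\<omega>, X) in annealed P 0. (\<lambda>n. real_of_int (X n) / real n) \<longlonglongrightarrow> - v"
      proof eventually_elim
        case (elim q)
        then show ?case using tendsto_minus by (fastforce split: prod.splits)
      qed
      then show ?thesis by blast
    next
      case 3
      have "AE (\<omega>, X) in annealed P 0. (\<lambda>n. real_of_int (X n) / real n) \<longlonglongrightarrow> 0"
        using R.AE_annealed[OF R.E.slow_right[OF 3(1)]] L.AE_annealed[OF L.E.slow_right[OF 3(2)]]
      proof eventually_elim
        case (elim q)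
        obtain \<omega> X where q: "q = (\<omega>, X)" by (cases q)
        have up: "eventually (\<lambda>n. real_of_int (X n) \<le> \<epsilon> * real n) sequentially"
          and low: "eventually (\<lambda>n. real_of_int (- X n) \<le> \<epsilon> * real n) sequentially" if "\<epsilon> > 0" for \<epsilon>
          using elim that by (auto simp: q)
        have "(\<lambda>n. real_of_int (X n) / real n) \<longlonglongrightarrow> 0"
        proof (rule tendstoI)
          fix e :: real assume "e > 0"
          then have e: "e / 2 > 0" by simp
          show "eventually (\<lambda>n. dist (real_of_int (X n) / real n) 0 < e) sequentially"
            using up[OF e] low[OF e] eventually_gt_at_top[of 0]
          proof eventually_elim
            case (elim n)
            have "\<bar>real_of_int (X n)\<bar> \<le> e / 2 * real n" using elim by (simp add: abs_le_iff)
            also have "\<dots> < e * real n" using elim(3) \<open>e > 0\<close> by simp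
            finally show ?case using elim(3) by (simp add: pos_divide_less_eq)
          qed
        qed
        then show ?case by (simp add: q)
      qed
      then show ?thesis by blast
    qed
  qed
  then obtain v where v: "AE (\<omega>, X) in annealed P 0. (\<lambda>n. real_of_int (X n) / real n) \<longlonglongrightarrow> v" by blast
  then have "AE (\<omega>, X) in annealed P 0.
      ((\<lambda>x :: int. ereal_of_enat (hitting_time_ge X x) / ereal (real_of_int x))
         \<longlongrightarrow> (if v > 0 then ereal (1 / v) else \<infinity>)) at_top"
  proof eventually_elim
    case (elim q)
    obtain \<omega> X where q: "q = (\<omega>, X)" by (cases q)
    from elim show ?case unfolding q prod.case by (rule hitting_time_velocity)
  qed
  with v show ?thesis by blast
qed

end
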